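(* The following holds for rotational axisymmetric $(-\alpha)$-homogeneous solutions of the stationary incompressible Euler equations. (i) For $1\leq\alpha\leq 2$, no such solutions $(u,p)\in C^{1}(\mathbb{R}^{3}\setminus\{0\})$ exist. (ii) For $0\leq\alpha<1$, no such solutions $(u,p)\in C^{2}(\mathbb{R}^{3}\setminus\{0\})$ exist. (iii) For every $\alpha>2$, there exist such solutions $(u,p)\in C^{1}(\mathbb{R}^{3}\setminus\{0\})$ with a nonconstant Bernoulli function such that $u^{P},p\in C^{2}(\mathbb{R}^{3}\setminus\{0\})$ and $u^{\phi}e_{\phi}\in C^{1}(\mathbb{R}^{3}\setminus\{0\})$. (iv) For every $\alpha<-2$, there exist such solutions $(u,p)\in C(\mathbb{R}^{3})$ (in the distributional sense in $\mathbb{R}^3$) with a nonconstant Bernoulli function such that $u^{P},p\in C^{1}(\mathbb{R}^{3}\setminus\{r=0\})\cap C(\mathbb{R}^{3})$ and $u^{\phi}e_{\phi}\in C(\mathbb{R}^{3})$.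
   Context: The stationary Euler equations are $u\cdot\nabla u+\nabla p=0$, $\nabla\cdot u=0$ for $u=(u^1,u^2,u^3)$ and scalar $p$. A pair $(u,p)$ is a $(-\alpha)$-homogeneous solution ($\alpha\in\mathbb{R}$) if it solves these equations and, for all $\lambda>0$, $u(x)=\lambda^{\alpha}u(\lambda x)$ and $p(x)=\lambda^{2\alpha}p(\lambda x)$. Solutions $(u,p)\in C^1(\mathbb{R}^3\setminus\{0\})$ or $C^2(\mathbb{R}^3\setminus\{0\})$ satisfy the equations classically in $\mathbb{R}^3\setminus\{0\}$. Solutions $(u,p)\in C(\mathbb{R}^3)$, considered for $\alpha<0$, satisfy the equations in $\mathbb{R}^3$ in the distributional sense (with $u\cdot\nabla u=\nabla\cdot(u\otimes u)$). A solution is irrotational if $\nabla\times u=0$, and rotational if it is not irrotational. The Bernoulli function is $\Pi=p+|u|^2/2$. Cylindrical coordinates: $x_1=r\cos\phi$, $x_2=r\sin\phi$, $x_3=z$, with the frame $e_r=(\cos\phi,\sin\phi,0)$, $e_\phi=(-\sin\phi,\cos\phi,0)$, $e_z=(0,0,1)$. A solution is axisymmetric if $u=u^re_r+u^\phi e_\phi+u^ze_z$ with $u^r,u^\phi,u^z,p$ independent of $\phi$; its poloidal part is $u^P=u^re_r+u^ze_z$ and its toroidal part is $u^\phi e_\phi$. *)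

theory Defs
  imports "HOL-Analysis.Analysis"
begin

section \<open>Differentiability classes\<close>

text \<open>\<open>C_k_on k S f\<close> says \<open>f \<in> C\<^sup>k(S)\<close>. It is meant for open \<open>S\<close>; the values of \<open>f\<close> outside \<open>S\<close>
  are then irrelevant.\<close>

primrec C_k_on :: "nat \<Rightarrow> 'a::real_normed_vector set \<Rightarrow> ('a \<Rightarrow> 'b::real_normed_vector) \<Rightarrow> bool"
where
  "C_k_on 0 S f \<longleftrightarrow> continuous_on S f"
| "C_k_on (Suc k) S f \<longleftrightarrow> (\<forall>x\<in>S. f differentiable (at x)) \<and>
     (\<forall>v. C_k_on k S (\<lambda>x. frechet_derivative f (at x) v))"

definition test_function :: "(real^3 \<Rightarrow> real) \<Rightarrow> bool" where
  "test_function \<psi> \<longleftrightarrow> (\<forall>k. C_k_on k UNIV \<psi>) \<and> compact (closure {x. \<psi> x \<noteq> 0})"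

section \<open>Differential operators\<close>

definition partial :: "3 \<Rightarrow> (real^3 \<Rightarrow> real) \<Rightarrow> real^3 \<Rightarrow> real" where
  "partial i f x = frechet_derivative f (at x) (axis i 1)"

definition grad :: "(real^3 \<Rightarrow> real) \<Rightarrow> real^3 \<Rightarrow> real^3" where
  "grad f x = (\<chi> i. partial i f x)"

definition divergence :: "(real^3 \<Rightarrow> real^3) \<Rightarrow> real^3 \<Rightarrow> real" where
  "divergence u x = (\<Sum>i\<in>UNIV. partial i (\<lambda>y. u y $ i) x)"

definition curl :: "(real^3 \<Rightarrow> real^3) \<Rightarrow> real^3 \<Rightarrow> real^3" where
  "curl u x = vector
     [partial 2 (\<lambda>y. u y $ 3) x - partial 3 (\<lambda>y. u y $ 2) x,
      partial 3 (\<lambda>y. u y $ 1) x - partial 1 (\<lambda>y. u y $ 3) x,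
      partial 1 (\<lambda>y. u y $ 2) x - partial 2 (\<lambda>y. u y $ 1) x]"

definition convection :: "(real^3 \<Rightarrow> real^3) \<Rightarrow> real^3 \<Rightarrow> real^3" where
  "convection u x = (\<chi> i. \<Sum>j\<in>UNIV. u x $ j * partial j (\<lambda>y. u y $ i) x)"

section \<open>Stationary Euler equations\<close>

definition euler_classical :: "(real^3) set \<Rightarrow> (real^3 \<Rightarrow> real^3) \<Rightarrow> (real^3 \<Rightarrow> real) \<Rightarrow> bool" where
  "euler_classical S u p \<longleftrightarrow>
     (\<forall>x\<in>S. convection u x + grad p x = 0 \<and> divergence u x = 0)"

definition irrotational_classical :: "(real^3) set \<Rightarrow> (real^3 \<Rightarrow> real^3) \<Rightarrow> bool" where
  "irrotational_classical S u \<longleftrightarrow> (\<forall>x\<in>S. curl u x = 0)"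

text \<open>Distributional versions on the whole space, for continuous \<open>u\<close> and \<open>p\<close>. Each equation is
  tested componentwise against scalar test functions, with the sign from the integration by parts
  dropped. The nonlinearity is \<open>\<nabla>\<cdot>(u \<otimes> u)\<close>, whose \<open>i\<close>-th component
  \<open>\<Sum>\<^sub>j \<partial>\<^sub>j (u\<^sup>j u\<^sup>i)\<close> pairs with \<open>\<psi>\<close> to \<open>- \<integral> (u \<cdot> \<nabla>\<psi>) u\<^sup>i\<close>. Similarly \<open>\<nabla> \<times> u\<close> pairs with
  \<open>\<psi>\<close> to \<open>- \<integral> \<nabla>\<psi> \<times> u\<close>.\<close>

definition euler_distributional :: "(real^3 \<Rightarrow> real^3) \<Rightarrow> (real^3 \<Rightarrow> real) \<Rightarrow> bool" where
  "euler_distributional u p \<longleftrightarrow> (\<forall>\<psi>. test_function \<psi> \<longrightarrow>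
     (LINT x|lborel. (u x \<bullet> grad \<psi> x) *\<^sub>R u x + p x *\<^sub>R grad \<psi> x) = 0 \<and>
     (LINT x|lborel. u x \<bullet> grad \<psi> x) = 0)"

definition irrotational_distributional :: "(real^3 \<Rightarrow> real^3) \<Rightarrow> bool" where
  "irrotational_distributional u \<longleftrightarrow> (\<forall>\<psi>. test_function \<psi> \<longrightarrow>
     (LINT x|lborel. cross3 (grad \<psi> x) (u x)) = 0)"

definition homogeneous_on ::
    "(real^3) set \<Rightarrow> real \<Rightarrow> (real^3 \<Rightarrow> real^3) \<Rightarrow> (real^3 \<Rightarrow> real) \<Rightarrow> bool" where
  "homogeneous_on S \<alpha> u p \<longleftrightarrow> (\<forall>l>0. \<forall>x\<in>S.
     u x = (l powr \<alpha>) *\<^sub>R u (l *\<^sub>R x) \<and> p x = l powr (2 * \<alpha>) * p (l *\<^sub>R x))"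

definition bernoulli :: "(real^3 \<Rightarrow> real^3) \<Rightarrow> (real^3 \<Rightarrow> real) \<Rightarrow> real^3 \<Rightarrow> real" where
  "bernoulli u p x = p x + (norm (u x))\<^sup>2 / 2"

section \<open>Cylindrical coordinates\<close>

definition rad :: "real^3 \<Rightarrow> real" where
  "rad x = sqrt ((x $ 1)\<^sup>2 + (x $ 2)\<^sup>2)"

text \<open>The frame as a function of the point. On the axis \<open>r = 0\<close>, where it has no meaning, \<open>e_r\<close> and
  \<open>e_phi\<close> are \<open>0\<close> (division by zero), so that there \<open>poloidal u\<close> is \<open>u\<^sup>z e\<^sub>z\<close> and \<open>toroidal u\<close> is \<open>0\<close>.
  For a continuous axisymmetric \<open>u\<close> these are the continuous extensions across the axis.\<close>

definition e_r :: "real^3 \<Rightarrow> real^3" where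
  "e_r x = vector [x $ 1 / rad x, x $ 2 / rad x, 0]"

definition e_phi :: "real^3 \<Rightarrow> real^3" where
  "e_phi x = vector [- (x $ 2) / rad x, x $ 1 / rad x, 0]"

definition e_z :: "real^3" where
  "e_z = vector [0, 0, 1]"

lemma frame_cylindrical:
  assumes "r > 0"
  shows "rad (vector [r * cos \<phi>, r * sin \<phi>, z]) = r"
    and "e_r (vector [r * cos \<phi>, r * sin \<phi>, z]) = vector [cos \<phi>, sin \<phi>, 0]"
    and "e_phi (vector [r * cos \<phi>, r * sin \<phi>, z]) = vector [- sin \<phi>, cos \<phi>, 0]"
proof -
  have "(r * cos \<phi>)\<^sup>2 + (r * sin \<phi>)\<^sup>2 = r\<^sup>2 * ((sin \<phi>)\<^sup>2 + (cos \<phi>)\<^sup>2)"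
    by (simp add: power_mult_distrib algebra_simps del: sin_cos_squared_add sin_cos_squared_add2)
  then show *: "rad (vector [r * cos \<phi>, r * sin \<phi>, z]) = r"
    using assms by (simp add: rad_def)
  show "e_r (vector [r * cos \<phi>, r * sin \<phi>, z]) = vector [cos \<phi>, sin \<phi>, 0]"
    and "e_phi (vector [r * cos \<phi>, r * sin \<phi>, z]) = vector [- sin \<phi>, cos \<phi>, 0]"
    unfolding e_r_def e_phi_def * using assms by simp_all
qed

text \<open>Independence of \<open>\<phi>\<close> means being a function of \<open>(r, z)\<close>.\<close>

definition axisymmetric :: "(real^3 \<Rightarrow> real^3) \<Rightarrow> (real^3 \<Rightarrow> real) \<Rightarrow> bool" where
  "axisymmetric u p \<longleftrightarrow> (\<exists>ur uphi uz q :: real \<Rightarrow> real \<Rightarrow> real. \<forall>x. rad x > 0 \<longrightarrow>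
     u x = ur (rad x) (x $ 3) *\<^sub>R e_r x + uphi (rad x) (x $ 3) *\<^sub>R e_phi x
           + uz (rad x) (x $ 3) *\<^sub>R e_z \<and>
     p x = q (rad x) (x $ 3))"

definition poloidal :: "(real^3 \<Rightarrow> real^3) \<Rightarrow> real^3 \<Rightarrow> real^3" where
  "poloidal u x = (u x \<bullet> e_r x) *\<^sub>R e_r x + (u x \<bullet> e_z) *\<^sub>R e_z"

definition toroidal :: "(real^3 \<Rightarrow> real^3) \<Rightarrow> real^3 \<Rightarrow> real^3" where
  "toroidal u x = (u x \<bullet> e_phi x) *\<^sub>R e_phi x"

section \<open>Rotational axisymmetric homogeneous solutions\<close>

text \<open>Solutions in \<open>C\<^sup>k(\<real>\<^sup>3 \<setminus> {0})\<close>, used with \<open>k \<ge> 1\<close>; the values of \<open>u\<close> and \<open>p\<close> at \<open>0\<close> play no role.\<close>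

definition rot_axi_hom_solution_punctured ::
    "nat \<Rightarrow> real \<Rightarrow> (real^3 \<Rightarrow> real^3) \<Rightarrow> (real^3 \<Rightarrow> real) \<Rightarrow> bool" where
  "rot_axi_hom_solution_punctured k \<alpha> u p \<longleftrightarrow>
     C_k_on k (- {0}) u \<and> C_k_on k (- {0}) p \<and>
     euler_classical (- {0}) u p \<and> homogeneous_on (- {0}) \<alpha> u p \<and>
     axisymmetric u p \<and> \<not> irrotational_classical (- {0}) u"

text \<open>Solutions in \<open>C(\<real>\<^sup>3)\<close>; the vorticity is a distribution here.\<close>

definition rot_axi_hom_solution_continuous ::
    "real \<Rightarrow> (real^3 \<Rightarrow> real^3) \<Rightarrow> (real^3 \<Rightarrow> real) \<Rightarrow> bool" where
  "rot_axi_hom_solution_continuous \<alpha> u p \<longleftrightarrow>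
     continuous_on UNIV u \<and> continuous_on UNIV p \<and>
     euler_distributional u p \<and> homogeneous_on UNIV \<alpha> u p \<and>
     axisymmetric u p \<and> \<not> irrotational_distributional u"

end

theory Submission
  imports Defs
begin

text \<open>
  Nonexistence for \<open>0 \<le> \<alpha> \<le> 2\<close>: on a meridian of the unit sphere the Euler equations become
  ordinary differential equations for the spherical velocity components \<open>a, b, c\<close> and \<open>p\<close> as
  functions of the polar angle \<open>\<theta>\<close>. The stream function \<open>W = b sin \<theta>\<close> satisfies
  \<open>W' = (\<alpha> - 2) a sin \<theta>\<close> and vanishes at the poles, and powers of \<open>W\<close> times the Bernoulli function
  (respectively the circulation \<open>c sin \<theta>\<close>) are constant where \<open>W \<noteq> 0\<close>. Letting \<open>W \<rightarrow> 0\<close> at the ends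
  of a component of \<open>{W > 0}\<close> kills these constants, and what remains is linear: it is excluded by
  the sign of \<open>a'\<close> for \<open>\<alpha> \<ge> 1\<close>, and for \<open>\<alpha> < 1\<close> by a Wronskian with the constant flow \<open>e\<^sub>z\<close>, which is
  the only survivor (\<open>\<alpha> = 0\<close>). If \<open>W = 0\<close>, the only flow left is the source \<open>x / \<bar>x\<bar>\<^sup>3\<close> for \<open>\<alpha> = 2\<close>.

  Existence for \<open>\<alpha> > 2\<close>: a flow without swirl with stream function \<open>\<psi> = \<bar>x\<bar>\<^bsup>-\<beta>\<^esup> w(x\<^sub>3 / \<bar>x\<bar>)\<close>, \<open>\<beta> = \<alpha> - 2\<close>, and
  Bernoulli function proportional to \<open>-\<bar>\<psi>\<bar>\<^bsup>2+4/\<beta>\<^esup>\<close> solves the Euler equations iff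
  \<open>w'' = - \<beta>(\<beta>+1) w / (1 - \<sigma>\<^sup>2) - k \<bar>w\<bar>\<^bsup>4/\<beta>\<^esup> w\<close>. The solutions that vanish at \<open>\<sigma> = 1\<close> with slope \<open>-1\<close> rotate in
  the phase plane by a total angle over \<open>[0, 1]\<close> that is continuous in \<open>k\<close> and unbounded as \<open>k \<rightarrow> \<infinity>\<close>,
  so some \<open>k\<close> gives \<open>w(0) = 0\<close>, and \<open>w\<close> extends to an odd function.

  Existence for \<open>\<alpha> < -2\<close>: the shear flow \<open>u = r\<^bsup>-\<alpha>\<^esup> e\<^sub>z\<close>, \<open>p = 0\<close>.
\<close>

section \<open>Calculus of \<open>C\<^sup>k\<close> functions\<close>

text \<open>The obstacle throughout is the axis: the equations in spherical or cylindrical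
  components are singular there, while regularity is required across it. In the nonexistence part
  the axis enters through the vanishing of the horizontal velocity at the poles, obtained by
  continuity. An end of a component at a pole needs its own estimate, because there
  \<open>sin\<close> kills the identity that settles an interior end. In the construction the factor
  1 - sigma^2 is divided out of \<open>w\<close>, and the quotient is carried on a neighbourhood of
  [-1, 1], so that smoothness across the axis becomes smoothness of a function of one variable. The
  exponent is forced by scaling: the stream function has degree -\<beta>, the Bernoulli function
  must have degree -2\<alpha> = -2(\<beta> + 2), and the quotient is 2 + 4/\<beta>. The energy of
  the profile equation is not conserved; the unbounded rotation rests on a lower bound for it that
  does not depend on k. One shooting parameter is enough because a zero at the equator is a single
  condition and the odd reflection then takes care of the second pole.\<close>

lemma has_derivative_cong_open:
  assumes "open S" "\<And>x. x \<in> S \<Longrightarrow> f x = g x" "x \<in> S"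
  shows "(f has_derivative D) (at x) \<longleftrightarrow> (g has_derivative D) (at x)"
  using assms has_derivative_transform_within_open[of f D x UNIV S g]
    has_derivative_transform_within_open[of g D x UNIV S f] by force

lemma frechet_derivative_cong_open:
  assumes "open S" "\<And>x. x \<in> S \<Longrightarrow> f x = g x" "x \<in> S"
  shows "frechet_derivative f (at x) = frechet_derivative g (at x)"
  unfolding frechet_derivative_def using has_derivative_cong_open[OF assms] by simp

lemma C_k_on_cong:
  assumes "open S" "\<And>x. x \<in> S \<Longrightarrow> f x = g x"
  shows "C_k_on k S f \<longleftrightarrow> C_k_on k S g"
  using assms
proof (induction k arbitrary: f g)
  case 0
  then show ?case using continuous_on_cong[of S S f g] by simp
next
  case (Suc k)
  have "f differentiable (at x) \<longleftrightarrow> g differentiable (at x)" if "x \<in> S" for x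
    unfolding differentiable_def using has_derivative_cong_open[OF Suc.prems that] by auto
  moreover have "C_k_on k S (\<lambda>x. frechet_derivative f (at x) v) \<longleftrightarrow>
      C_k_on k S (\<lambda>x. frechet_derivative g (at x) v)" for v
    by (rule Suc.IH) (use Suc.prems frechet_derivative_cong_open[of S f g] in auto)
  ultimately show ?case by auto
qed

lemma C_k_on_SucI:
  assumes "open S" "\<And>x. x \<in> S \<Longrightarrow> (f has_derivative f' x) (at x)"
    "\<And>v. C_k_on k S (\<lambda>x. f' x v)"
  shows "C_k_on (Suc k) S f"
proof -
  have "C_k_on k S (\<lambda>x. frechet_derivative f (at x) v) \<longleftrightarrow> C_k_on k S (\<lambda>x. f' x v)" for v
    by (rule C_k_on_cong) (use assms frechet_derivative_at in fastforce)+
  then show ?thesis using assms by (auto simp: differentiable_def)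
qed

lemma C_k_on_SucD:
  assumes "C_k_on (Suc k) S f"
  shows "C_k_on k S f"
  using assms
proof (induction k arbitrary: f)
  case 0
  then show ?case
    by (auto intro!: continuous_at_imp_continuous_on differentiable_imp_continuous_within)
qed (auto simp: )

lemma C_k_on_mono: "C_k_on n S f \<Longrightarrow> k \<le> n \<Longrightarrow> C_k_on k S f"
proof (induction n)
  case (Suc n)
  then show ?case using C_k_on_SucD[of n S f] by (cases "k = Suc n") (auto simp del: C_k_on.simps)
qed simp

lemma C_k_on_imp_continuous_on: "C_k_on k S f \<Longrightarrow> continuous_on S f"
  using C_k_on_mono[of k S f 0] by simp

lemma C_k_on_Suc_has_derivative:
  "C_k_on (Suc k) S f \<Longrightarrow> x \<in> S \<Longrightarrow> (f has_derivative frechet_derivative f (at x)) (at x)"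
  using frechet_derivative_works by auto

lemma C_k_on_const: "open S \<Longrightarrow> C_k_on k S (\<lambda>x. c)"
proof (induction k arbitrary: c)
  case (Suc k)
  show ?case by (rule C_k_on_SucI[where f'="\<lambda>x v. 0"]) (use Suc in auto)
qed simp

lemma C_k_on_add:
  assumes "open S" "C_k_on k S f" "C_k_on k S g"
  shows "C_k_on k S (\<lambda>x. f x + g x)"
  using assms
proof (induction k arbitrary: f g)
  case 0
  then show ?case by (auto intro: continuous_on_add)
next
  case (Suc k)
  note D = C_k_on_Suc_has_derivative[OF Suc.prems(2)] C_k_on_Suc_has_derivative[OF Suc.prems(3)]
  have "C_k_on k S (\<lambda>x. frechet_derivative f (at x) v + frechet_derivative g (at x) v)" for v
    by (rule Suc.IH) (use Suc.prems in simp_all)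
  from C_k_on_SucI[OF Suc.prems(1) has_derivative_add[OF D] this] show ?case by simp
qed

lemma (in bounded_linear) C_k_on_compose:
  assumes "open S" "C_k_on k S g"
  shows "C_k_on k S (\<lambda>x. f (g x))"
  using assms(2)
proof (induction k arbitrary: g)
  case 0
  then show ?case by (auto intro: continuous_on)
next
  case (Suc k)
  note D = C_k_on_Suc_has_derivative[OF Suc.prems]
  have "C_k_on k S (\<lambda>x. f (frechet_derivative g (at x) v))" for v
    by (rule Suc.IH) (use Suc.prems in simp)
  from C_k_on_SucI[OF assms(1) has_derivative[OF D] this] show ?case by simp
qed

lemma C_k_on_bounded_linear:
  assumes "open S" "bounded_linear f"
  shows "C_k_on k S f"
proof (cases k)
  case 0
  then show ?thesis using assms linear_continuous_on by auto
next
  case (Suc n)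
  show ?thesis unfolding Suc
    by (rule C_k_on_SucI[where f'="\<lambda>x. f"])
      (use assms bounded_linear_imp_has_derivative C_k_on_const in blast)+
qed

lemma (in bounded_bilinear) C_k_on_prod:
  assumes "open S" "C_k_on k S f" "C_k_on k S g"
  shows "C_k_on k S (\<lambda>x. prod (f x) (g x))"
  using assms(2,3)
proof (induction k arbitrary: f g)
  case 0
  then show ?case by (auto intro: continuous_on)
next
  case (Suc k)
  note D = C_k_on_Suc_has_derivative[OF Suc.prems(1)] C_k_on_Suc_has_derivative[OF Suc.prems(2)]
  have "C_k_on k S (\<lambda>x. prod (f x) (frechet_derivative g (at x) v) + prod (frechet_derivative f (at x) v) (g x))" for v
    by (intro C_k_on_add Suc.IH assms(1) C_k_on_SucD[OF Suc.prems(1)] C_k_on_SucD[OF Suc.prems(2)])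
      (use Suc.prems in simp_all)
  from C_k_on_SucI[OF assms(1) FDERIV[OF D] this] show ?case by simp
qed

lemmas C_k_on_mult = bounded_bilinear.C_k_on_prod[OF bounded_bilinear_mult]
lemmas C_k_on_scaleR = bounded_bilinear.C_k_on_prod[OF bounded_bilinear_scaleR]
lemmas C_k_on_inner = bounded_bilinear.C_k_on_prod[OF bounded_bilinear_inner]

lemma C_k_on_minus: "open S \<Longrightarrow> C_k_on k S f \<Longrightarrow> C_k_on k S (\<lambda>x. - f x)"
  by (rule bounded_linear.C_k_on_compose[OF bounded_linear_minus[OF bounded_linear_ident]])

lemma C_k_on_diff: "open S \<Longrightarrow> C_k_on k S f \<Longrightarrow> C_k_on k S g \<Longrightarrow> C_k_on k S (\<lambda>x. f x - g x)"
  using C_k_on_add[of S k f "\<lambda>x. - g x"] C_k_on_minus[of S k g] by simp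

lemma C_k_on_cmult: "open S \<Longrightarrow> C_k_on k S f \<Longrightarrow> C_k_on k S (\<lambda>x. c * f x :: real)"
  by (intro C_k_on_mult C_k_on_const)

lemma C_k_on_nth: "open S \<Longrightarrow> C_k_on k S (\<lambda>x::real^'n. x $ i)"
  by (rule C_k_on_bounded_linear) (simp_all add: bounded_linear_vec_nth)

lemma C_k_on_id: "open S \<Longrightarrow> C_k_on k S (\<lambda>x. x)"
  by (rule C_k_on_bounded_linear) (simp_all add: bounded_linear_ident)

lemma C_k_on_realI:
  assumes "open S" "\<And>t. t \<in> S \<Longrightarrow> (f has_real_derivative f' t) (at t)" "C_k_on k S f'"
  shows "C_k_on (Suc k) S f"
  by (rule C_k_on_SucI[where f'="\<lambda>t v. f' t * v"])
    (use assms in \<open>auto simp: has_field_derivative_def intro: C_k_on_mult C_k_on_const\<close>)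

text \<open>The chain rule produces the factor \<open>\<phi>' (f x)\<close>, again a composition
  with the same inner function. Hence the induction generalises over \<open>\<phi>\<close> and keeps
  \<open>f\<close> fixed.\<close>

lemma C_k_on_compose_real:
  fixes f :: "'a::real_normed_vector \<Rightarrow> real" and \<phi> :: "real \<Rightarrow> real"
  assumes "open S" "open I" "f ` S \<subseteq> I" "C_k_on k S f" "C_k_on k I \<phi>"
  shows "C_k_on k S (\<lambda>x. \<phi> (f x))"
  using assms(4,5)
proof (induction k arbitrary: \<phi>)
  case 0
  then show ?case using assms(3) by (auto intro: continuous_on_compose2)
next
  case (Suc k)
  let ?d = "\<lambda>t. frechet_derivative \<phi> (at t) 1"
  have d: "((\<lambda>x. \<phi> (f x)) has_derivative (\<lambda>v. ?d (f x) * frechet_derivative f (at x) v)) (at x)"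
    if "x \<in> S" for x
  proof -
    have 1: "(\<phi> has_derivative frechet_derivative \<phi> (at (f x))) (at (f x))"
      by (rule C_k_on_Suc_has_derivative[OF Suc.prems(2)]) (use assms(3) that in auto)
    have 2: "(\<lambda>v. frechet_derivative \<phi> (at (f x)) (D v)) = (\<lambda>v. ?d (f x) * D v)"
      for D :: "'a \<Rightarrow> real"
    proof
      fix v
      show "frechet_derivative \<phi> (at (f x)) (D v) = ?d (f x) * D v" using linear.scaleR[OF has_derivative_linear[OF 1], of "D v" 1] by simp
    qed
    show ?thesis
      using has_derivative_compose[OF C_k_on_Suc_has_derivative[OF Suc.prems(1) that] 1]
      unfolding 2 .
  qed
  have "C_k_on k S (\<lambda>x. ?d (f x))"
    by (rule Suc.IH) (use Suc.prems C_k_on_SucD in auto)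
  then show ?case
    by (intro C_k_on_SucI[OF assms(1) d] C_k_on_mult assms(1)) (use Suc.prems in auto)
qed

lemma C_k_on_powr: "C_k_on k {0<..} (\<lambda>t::real. t powr a)"
proof (induction k arbitrary: a)
  case 0
  show ?case by (auto intro!: continuous_intros)
next
  case (Suc k)
  show ?case
    by (rule C_k_on_realI[where f'="\<lambda>t. a * t powr (a - 1)"])
      (auto intro: C_k_on_cmult Suc has_real_derivative_powr simp del: C_k_on.simps)
qed

lemma partialI: "(f has_derivative D) (at x) \<Longrightarrow> partial i f x = D (axis i 1)"
  unfolding partial_def using frechet_derivative_at by metis

section \<open>Test functions and the shear flow\<close>

text \<open>The powers of \<open>t\<close> in the denominator make the family closed under
  differentiation up to linear combinations, so smoothness of all members follows by one
  induction.\<close>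

definition flat_exp :: "nat \<Rightarrow> real \<Rightarrow> real" where
  "flat_exp n t = (if t > 0 then exp (- (1 / t)) / t ^ n else 0)"

lemma flat_exp_tendsto: "(flat_exp n \<longlongrightarrow> 0) (at_right 0)"
proof -
  have "((\<lambda>t::real. (inverse t) ^ n / exp (inverse t)) \<longlongrightarrow> 0) (at_right 0)"
    by (rule filterlim_compose[OF tendsto_power_div_exp_0 filterlim_inverse_at_top_right])
  moreover have "\<forall>\<^sub>F t in at_right 0. (inverse t) ^ n / exp (inverse t) = flat_exp n t"
    unfolding eventually_at_right_field
    by (intro exI[of _ 1]) (auto simp: flat_exp_def exp_minus field_simps)
  ultimately show ?thesis by (rule Lim_transform_eventually)
qed

lemma DERIV_flat_exp:
  "(flat_exp n has_real_derivative flat_exp (n + 2) t - real n * flat_exp (n + 1) t) (at t)"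
proof -
  consider "t > 0" | "t < 0" | "t = 0" by linarith
  then show ?thesis
  proof cases
    case 1
    have "((\<lambda>t. exp (- (1 / t)) / t ^ n) has_real_derivative
        flat_exp (n + 2) t - real n * flat_exp (n + 1) t) (at t)"
    proof (cases n)
      case 0
      then show ?thesis using 1 by (auto intro!: derivative_eq_intros simp: flat_exp_def field_simps power2_eq_square)
    next
      case (Suc k)
      then show ?thesis using 1
        by (auto intro!: derivative_eq_intros simp: flat_exp_def divide_simps) (cases k; simp add: algebra_simps)
    qed
    then show ?thesis
      by (rule has_field_derivative_transform_within_open[where S="{0<..}"])
        (use 1 in \<open>auto simp: flat_exp_def\<close>)
  next
    case 2
    have "((\<lambda>t. 0) has_real_derivative 0) (at t)" by simp
    then have "(flat_exp n has_real_derivative 0) (at t)"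
      by (rule has_field_derivative_transform_within_open[where S="{..<0}"])
        (use 2 in \<open>auto simp: flat_exp_def\<close>)
    then show ?thesis using 2 by (simp add: flat_exp_def)
  next
    case 3
    have "((\<lambda>h. (flat_exp n (0 + h) - flat_exp n 0) / h) \<longlongrightarrow> 0) (at 0)"
    proof (rule filterlim_split_at)
      have "\<forall>\<^sub>F h in at_left 0. 0 = (flat_exp n (0 + h) - flat_exp n 0) / h"
        unfolding eventually_at_left_field by (intro exI[of _ "-1"]) (auto simp: flat_exp_def)
      then show "((\<lambda>h. (flat_exp n (0 + h) - flat_exp n 0) / h) \<longlongrightarrow> 0) (at_left 0)"
        by (rule Lim_transform_eventually[OF tendsto_const])
      \<comment> \<open>The difference quotient at 0 of one member is the next member of the family,
        which tends to 0.\<close>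
      have "\<forall>\<^sub>F h in at_right 0. flat_exp (n + 1) h = (flat_exp n (0 + h) - flat_exp n 0) / h"
        unfolding eventually_at_right_field by (intro exI[of _ "1"]) (auto simp: flat_exp_def)
      then show "((\<lambda>h. (flat_exp n (0 + h) - flat_exp n 0) / h) \<longlongrightarrow> 0) (at_right 0)"
        by (rule Lim_transform_eventually[OF flat_exp_tendsto])
    qed
    then show ?thesis using 3 by (simp add: DERIV_def flat_exp_def)
  qed
qed

lemma C_k_on_flat_exp: "C_k_on k UNIV (flat_exp n)"
proof (induction k arbitrary: n)
  case 0
  show ?case using DERIV_isCont[OF DERIV_flat_exp] by (auto intro: continuous_at_imp_continuous_on)
next
  case (Suc k)
  show ?case
    by (rule C_k_on_realI[OF open_UNIV DERIV_flat_exp]) (intro C_k_on_diff C_k_on_cmult Suc open_UNIV)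
qed

text \<open>The polynomial 1 - |x - c|^2 is positive exactly on the open unit ball about
  \<open>c\<close>; smoothness is inherited from \<open>flat_exp 0\<close>.\<close>

lemma exists_bump_test_function:
  fixes c :: "real^3"
  obtains \<psi> where "test_function \<psi>" "\<And>x. \<psi> x \<ge> 0" "\<And>x. \<psi> x > 0 \<longleftrightarrow> dist c x < 1"
proof
  let ?\<psi> = "\<lambda>x. flat_exp 0 (1 - (x - c) \<bullet> (x - c))"
  have iff: "?\<psi> x > 0 \<longleftrightarrow> dist c x < 1" for x
  proof -
    have "norm (x - c) = dist c x" by (simp add: dist_norm norm_minus_commute)
    then show ?thesis by (simp add: flat_exp_def power2_norm_eq_inner[symmetric] abs_square_less_1)
  qed
  show "?\<psi> x \<ge> 0" for x by (simp add: flat_exp_def)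
  have "{x. ?\<psi> x \<noteq> 0} \<subseteq> cball c 1"
    using iff \<open>\<And>x. ?\<psi> x \<ge> 0\<close> by (force simp: less_eq_real_def)
  then have "bounded {x. ?\<psi> x \<noteq> 0}" using bounded_subset bounded_cball by blast
  moreover have "C_k_on k UNIV ?\<psi>" for k
    by (rule C_k_on_compose_real[OF open_UNIV open_UNIV _ _ C_k_on_flat_exp])
      (intro subset_UNIV C_k_on_diff C_k_on_inner C_k_on_const C_k_on_id open_UNIV)+
  ultimately show "test_function ?\<psi>"
    by (simp add: test_function_def del: C_k_on.simps)
  show "?\<psi> x > 0 \<longleftrightarrow> dist c x < 1" for x by (rule iff)
qed

section \<open>Integration by parts for compactly supported integrands\<close>

lemma integrable_continuous_compact_support:
  fixes f :: "'a::euclidean_space \<Rightarrow> 'b::{banach, second_countable_topology}"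
  assumes "continuous_on UNIV f" "\<And>x. norm x > R \<Longrightarrow> f x = 0"
  shows "integrable lborel f"
proof -
  have "integrable lborel (\<lambda>x. indicator (cball 0 R) x *\<^sub>R f x)"
    by (rule borel_integrable_compact) (use assms continuous_on_subset[OF assms(1)] in auto)
  moreover have "(\<lambda>x. indicator (cball 0 R) x *\<^sub>R f x) = f"
    using assms(2) by (force simp: indicator_def)
  ultimately show ?thesis by simp
qed

lemma lborel_integral_translate:
  fixes f :: "'a::euclidean_space \<Rightarrow> real"
  assumes "f \<in> borel_measurable borel"
  shows "(LINT x|lborel. f (c + x)) = (LINT x|lborel. f x)"
proof -
  have "(LINT x|lborel. f x) = (LINT x|distr lborel borel ((+) c). f x)"
    by (simp add: lborel_distr_plus)
  also have "\<dots> = (LINT x|lborel. f (c + x))"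
    by (rule integral_distr) (use assms in auto)
  finally show ?thesis by simp
qed

text \<open>Translation invariance makes the integrals of the difference quotients vanish, and these
  converge boundedly to the derivative.\<close>

lemma integral_directional_derivative_eq_0:
  fixes F D :: "'a::euclidean_space \<Rightarrow> real"
  assumes deriv: "\<And>x. ((\<lambda>t. F (x + t *\<^sub>R e)) has_real_derivative D x) (at 0)"
    and contF: "continuous_on UNIV F" and contD: "continuous_on UNIV D"
    and supp: "\<And>x. norm x > R \<Longrightarrow> F x = 0"
  shows "(LINT x|lborel. D x) = 0"
proof -
  have derivt: "((\<lambda>t. F (x + t *\<^sub>R e)) has_real_derivative D (x + s *\<^sub>R e)) (at s)" for x s
  proof -
    have "((\<lambda>t. F ((x + s *\<^sub>R e) + (t - s) *\<^sub>R e)) has_real_derivative D (x + s *\<^sub>R e) * 1) (at s)"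
      by (rule DERIV_chain2[where g="\<lambda>t. t - s" and f="\<lambda>t. F ((x + s *\<^sub>R e) + t *\<^sub>R e)"])
        (use deriv[of "x + s *\<^sub>R e"] in \<open>auto intro!: derivative_eq_intros\<close>)
    then show ?thesis by (simp add: algebra_simps)
  qed
  define Q where "Q n x = (F (x + (1 / real (Suc n)) *\<^sub>R e) - F x) * real (Suc n)" for n x
  have mvt: "\<exists>\<xi>. norm (\<xi> - x) \<le> norm e \<and> Q n x = D \<xi>" for n x
  proof -
    have "\<exists>z. 0 < z \<and> z < 1 / real (Suc n) \<and> F (x + (1 / real (Suc n)) *\<^sub>R e) - F (x + 0 *\<^sub>R e)
        = (1 / real (Suc n) - 0) * D (x + z *\<^sub>R e)"
      by (rule MVT2) (use derivt in auto)
    then obtain z where z: "0 < z" "z < 1 / real (Suc n)" "Q n x = D (x + z *\<^sub>R e)"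
      by (auto simp: Q_def field_simps simp del: of_nat_Suc)
    have "1 / real (Suc n) \<le> 1" by simp
    with z have "z \<le> 1" by linarith
    then have "norm ((x + z *\<^sub>R e) - x) \<le> norm e" using z(1) by (simp add: mult_left_le_one_le)
    with z show ?thesis by blast
  qed
  \<comment> \<open>The quotients are supported in the ball of radius \<open>R + norm e\<close>, and
    the mean value point may lie \<open>norm e\<close> further out; this gives one dominating
    constant for all of them.\<close>
  obtain B where B: "\<And>x. x \<in> cball 0 (R + 2 * norm e) \<Longrightarrow> \<bar>D x\<bar> \<le> B"
  proof -
    have "compact (D ` cball 0 (R + 2 * norm e))"
      by (rule compact_continuous_image) (use contD continuous_on_subset in auto)
    then show ?thesis using that by (force dest!: compact_imp_bounded simp: bounded_iff)
  qed
  have Q0: "Q n x = 0" if "norm x > R + norm e" for n x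
  proof -
    have "norm ((1 / real (Suc n)) *\<^sub>R e) \<le> norm e" by (simp add: divide_le_eq mult_le_cancel_left1)
    then have "norm (x + (1 / real (Suc n)) *\<^sub>R e) \<ge> norm x - norm e"
      using norm_diff_ineq[of x "(1 / real (Suc n)) *\<^sub>R e"] by linarith
    then have "norm (x + (1 / real (Suc n)) *\<^sub>R e) > R" using that by linarith
    moreover have "norm x > R" using that norm_ge_zero[of e] by linarith
    ultimately show ?thesis by (simp add: Q_def supp)
  qed
  have contQ: "continuous_on UNIV (Q n)" for n
    unfolding Q_def by (intro continuous_intros continuous_on_compose2[OF contF]) auto
  have "(\<lambda>n. LINT x|lborel. Q n x) \<longlonglongrightarrow> (LINT x|lborel. D x)"
  proof (rule integral_dominated_convergence[where w="\<lambda>x. indicator (cball 0 (R + norm e)) x *\<^sub>R B"])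
    show "D \<in> borel_measurable lborel" "\<And>n. Q n \<in> borel_measurable lborel"
      using contD contQ borel_measurable_continuous_onI by auto
    show "integrable lborel (\<lambda>x. indicator (cball 0 (R + norm e)) x *\<^sub>R B :: real)"
      by (rule borel_integrable_compact) auto
    show "AE x in lborel. (\<lambda>n. Q n x) \<longlonglongrightarrow> D x"
    proof (rule AE_I2)
      fix x
      have "((\<lambda>h. (F (x + h *\<^sub>R e) - F x) / h) \<longlongrightarrow> D x) (at 0)"
        using deriv[of x] by (simp add: DERIV_def)
      moreover have "filterlim (\<lambda>n. 1 / real (Suc n)) (at 0) sequentially"
        unfolding filterlim_at using lim_1_over_n[THEN LIMSEQ_Suc] by (auto simp: field_simps)
      ultimately have "(\<lambda>n. (F (x + (1 / real (Suc n)) *\<^sub>R e) - F x) / (1 / real (Suc n))) \<longlonglongrightarrow> D x"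
        by (rule filterlim_compose)
      then show "(\<lambda>n. Q n x) \<longlonglongrightarrow> D x" by (simp add: Q_def)
    qed
    show "AE x in lborel. norm (Q n x) \<le> indicator (cball 0 (R + norm e)) x *\<^sub>R B" for n
    proof (rule AE_I2)
      fix x
      show "norm (Q n x) \<le> indicator (cball 0 (R + norm e)) x *\<^sub>R B"
      proof (cases "norm x > R + norm e")
        case True
        then show ?thesis using Q0[OF True] by simp
      next
        case False
        obtain \<xi> where xi: "norm (\<xi> - x) \<le> norm e" "Q n x = D \<xi>" using mvt by blast
        have "norm \<xi> \<le> R + 2 * norm e" using False xi(1) norm_triangle_sub[of \<xi> x] by linarith
        then have "\<bar>D \<xi>\<bar> \<le> B" using B[of \<xi>] by simp
        then show ?thesis using False xi(2) by simp
      qed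
    qed
  qed
  moreover have "(LINT x|lborel. Q n x) = 0" for n
  proof -
    have iF: "integrable lborel F" by (rule integrable_continuous_compact_support[OF contF supp])
    have iFt: "integrable lborel (\<lambda>x. F (x + (1 / real (Suc n)) *\<^sub>R e))"
    proof (rule integrable_continuous_compact_support[where R="R + norm e"])
      show "continuous_on UNIV (\<lambda>x. F (x + (1 / real (Suc n)) *\<^sub>R e))"
        by (intro continuous_intros continuous_on_compose2[OF contF]) auto
      fix x :: 'a assume x: "norm x > R + norm e"
      then have "F x = 0" using supp[of x] norm_ge_zero[of e] by linarith
      with Q0[OF x, of n] show "F (x + (1 / real (Suc n)) *\<^sub>R e) = 0" by (simp add: Q_def)
    qed
    have "(LINT x|lborel. F (x + (1 / real (Suc n)) *\<^sub>R e)) = (LINT x|lborel. F x)"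
      using lborel_integral_translate[of F "(1 / real (Suc n)) *\<^sub>R e"] contF
      by (simp add: add.commute borel_measurable_continuous_onI)
    then show ?thesis unfolding Q_def using iF iFt by (simp add: Bochner_Integration.integral_diff)
  qed
  ultimately show ?thesis using LIMSEQ_unique[OF _ tendsto_const] by (simp add: LIMSEQ_const_iff)
qed

text \<open>A zero integral would make the open set where \<open>f\<close> is nonzero a null set,
  hence empty.\<close>

lemma integral_pos_if_continuous:
  fixes f :: "'a::euclidean_space \<Rightarrow> real"
  assumes "continuous_on UNIV f" "integrable lborel f" "\<And>x. f x \<ge> 0" "f c > 0"
  shows "(LINT x|lborel. f x) > 0"
proof (rule ccontr)
  assume "\<not> ?thesis"
  moreover have "integral\<^sup>L lborel f \<ge> 0"
    by (rule Bochner_Integration.integral_nonneg) (use assms(3) in auto)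
  ultimately have "integral\<^sup>L lborel f = 0" by linarith
  then have "AE x in lborel. f x = 0" using integral_nonneg_eq_0_iff_AE[OF assms(2)] assms(3) by auto
  moreover have open': "open {x. f x \<noteq> 0}"
    by (rule open_Collect_neq) (use assms(1) in auto)
  moreover have "{x. f x \<noteq> 0} \<in> sets lborel" using open' by simp
  ultimately have "{x. f x \<noteq> 0} \<in> null_sets lborel" by (simp add: AE_iff_null)
  then have "negligible {x. f x \<noteq> 0}"
    by (simp add: negligible_iff_null_sets null_sets_completionI)
  then show False using open' open_not_negligible assms(4) by force
qed

lemma cross3_vertical_nth: "cross3 v (vector [0, 0, t]) $ 2 = - (v $ 1 * t)"
  by (simp add: cross3_def)

text \<open>The flow is vertical and independent of z, so in the weak equations a function of r
  alone always multiplies a z-derivative of the test function, and each integral vanishes.\<close>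

lemma ex_shear_solution:
  fixes \<alpha> :: real
  assumes "\<alpha> < -2"
  shows "\<exists>u p. rot_axi_hom_solution_continuous \<alpha> u p \<and>
               \<not> bernoulli u p constant_on UNIV \<and>
               C_k_on 1 {x. rad x \<noteq> 0} (poloidal u) \<and> continuous_on UNIV (poloidal u) \<and>
               C_k_on 1 {x. rad x \<noteq> 0} p \<and> continuous_on UNIV p \<and>
               continuous_on UNIV (toroidal u)"
proof -
  \<comment> \<open>\<open>R\<close> is r^2, a polynomial, so no square root has to be
    differentiated. With \<open>a = - \<alpha> / 2\<close> the speed is \<open>R powr a\<close>, and
    \<open>a > 1\<close> keeps \<open>R powr (a - 1)\<close> continuous across the axis.\<close>
  define R where "R x = (x $ 1)\<^sup>2 + (x $ 2)\<^sup>2" for x :: "real^3"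
  define a where "a = - \<alpha> / 2"
  have a: "a > 1" using assms by (simp add: a_def)
  have Rnn: "R x \<ge> 0" for x by (simp add: R_def)
  have contR: "continuous_on UNIV R" unfolding R_def by (intro continuous_intros)
  have contRp: "continuous_on UNIV (\<lambda>x. R x powr b)" if "b > 0" for b
    by (rule continuous_on_powr') (use contR Rnn that in auto)
  define u :: "real^3 \<Rightarrow> real^3" where "u x = (R x powr a) *\<^sub>R e_z" for x
  define p :: "real^3 \<Rightarrow> real" where "p x = 0" for x
  have rad_R: "rad x powr b = R x powr (b / 2)" for x b
    by (simp add: rad_def R_def powr_half_sqrt[symmetric] powr_powr)
  have contu: "continuous_on UNIV u"
    unfolding u_def using a by (intro continuous_intros contRp) auto
  have pol: "poloidal u = u"
    by (auto simp: fun_eq_iff poloidal_def u_def e_r_def e_z_def inner_vec_def sum_3 vec_eq_iff forall_3)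
  have tor: "toroidal u = (\<lambda>x. 0)"
    by (auto simp: fun_eq_iff toroidal_def u_def e_phi_def e_z_def inner_vec_def sum_3)
  have C1: "C_k_on 1 {x. rad x \<noteq> 0} u"
  proof -
    have eq: "{x. rad x \<noteq> 0} = R -` {0<..}"
      by (auto simp: rad_def R_def less_le)
    have op: "open {x. rad x \<noteq> 0}"
      unfolding eq using continuous_open_vimage[of "{0<..}" R] contR
      by (auto simp: continuous_on_eq_continuous_at)
    have "C_k_on 1 {x. rad x \<noteq> 0} R"
      unfolding R_def power2_eq_square by (intro C_k_on_add C_k_on_mult C_k_on_nth op)
    from C_k_on_compose_real[OF op open_greaterThan _ this C_k_on_powr]
    have "C_k_on 1 {x. rad x \<noteq> 0} (\<lambda>x. R x powr a)" using eq by (auto simp del: C_k_on.simps)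
    then show ?thesis
      unfolding u_def by (intro C_k_on_scaleR C_k_on_const op)
  qed
  have test: "(\<psi> has_derivative frechet_derivative \<psi> (at x)) (at x)"
      "continuous_on UNIV (\<lambda>x. frechet_derivative \<psi> (at x) v)" "continuous_on UNIV \<psi>"
    if "test_function \<psi>" for \<psi> x v
  proof -
    have C: "C_k_on (Suc 0) UNIV \<psi>" using that unfolding test_function_def by blast
    show "(\<psi> has_derivative frechet_derivative \<psi> (at x)) (at x)"
      using C_k_on_Suc_has_derivative[OF C] by simp
    show "continuous_on UNIV (\<lambda>x. frechet_derivative \<psi> (at x) v)" "continuous_on UNIV \<psi>"
      using C C_k_on_imp_continuous_on[OF C] by simp_all
  qed
  have dir: "((\<lambda>t. \<psi> (x + t *\<^sub>R e)) has_real_derivative frechet_derivative \<psi> (at x) e) (at 0)"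
    if "test_function \<psi>" for \<psi> x e
  proof -
    have "((\<lambda>t. \<psi> (x + t *\<^sub>R e)) has_derivative (\<lambda>t. frechet_derivative \<psi> (at x) (t *\<^sub>R e))) (at 0)"
      by (rule has_derivative_compose[where f="\<lambda>t. x + t *\<^sub>R e" and g=\<psi>])
        (use test(1)[OF that] in \<open>auto intro!: derivative_eq_intros\<close>)
    then show ?thesis
      using linear.scaleR[OF has_derivative_linear[OF test(1)[OF that]]]
      by (simp add: has_field_derivative_def mult_commute_abs)
  qed
  have supp: "\<exists>B. (\<forall>x. norm x > B \<longrightarrow> \<psi> x = 0 \<and> frechet_derivative \<psi> (at x) = (\<lambda>v. 0))"
    if "test_function \<psi>" for \<psi>
  proof -
    have "bounded (closure {x. \<psi> x \<noteq> 0})"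
      using that compact_imp_bounded unfolding test_function_def by blast
    then have "bounded {x. \<psi> x \<noteq> 0}" using bounded_subset closure_subset by blast
    then obtain B where B: "\<And>x. \<psi> x \<noteq> 0 \<Longrightarrow> norm x \<le> B" unfolding bounded_iff by auto
    have "frechet_derivative \<psi> (at x) = (\<lambda>v. 0)" if "norm x > B" for x
    proof -
      have "open {x::real^3. norm x > B}" by (intro open_Collect_less continuous_intros)
      then have "frechet_derivative \<psi> (at x) = frechet_derivative (\<lambda>x. 0) (at x)"
        by (rule frechet_derivative_cong_open) (use B that in force)+
      then show ?thesis by simp
    qed
    then show ?thesis using B by force
  qed
  have zint: "integrable lborel (\<lambda>x. R x powr b * partial 3 \<psi> x)"
      "(LINT x|lborel. R x powr b * partial 3 \<psi> x) = 0"
    if t: "test_function \<psi>" "b > 0" for \<psi> b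
  proof -
    obtain B where B: "\<And>x. norm x > B \<Longrightarrow> \<psi> x = 0 \<and> frechet_derivative \<psi> (at x) = (\<lambda>v. 0)"
      using supp[OF t(1)] by blast
    have cont: "continuous_on UNIV (\<lambda>x. R x powr b * partial 3 \<psi> x)"
      unfolding partial_def using that by (intro continuous_intros contRp test)
    show "integrable lborel (\<lambda>x. R x powr b * partial 3 \<psi> x)"
      by (rule integrable_continuous_compact_support[OF cont, of B]) (use B in \<open>auto simp: partial_def\<close>)
    show "(LINT x|lborel. R x powr b * partial 3 \<psi> x) = 0"
    proof (rule integral_directional_derivative_eq_0[where F="\<lambda>x. R x powr b * \<psi> x" and e="axis 3 1" and R=B])
      show "((\<lambda>t. R (x + t *\<^sub>R axis 3 1) powr b * \<psi> (x + t *\<^sub>R axis 3 1)) has_real_derivative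
          R x powr b * partial 3 \<psi> x) (at 0)" for x
      proof -
        have "R (x + t *\<^sub>R axis 3 1) = R x" for t by (simp add: R_def axis_def)
        then show ?thesis using DERIV_cmult[OF dir[OF that(1)]] by (simp add: partial_def)
      qed
      show "continuous_on UNIV (\<lambda>x. R x powr b * \<psi> x)"
        using that by (intro continuous_intros contRp test)
    qed (use cont B in auto)
  qed
  have euler: "euler_distributional u p"
    unfolding euler_distributional_def
  proof (intro allI impI conjI)
    fix \<psi> assume t: "test_function \<psi>"
    have ez: "e_z \<bullet> grad \<psi> x = partial 3 \<psi> x" for x
      by (simp add: e_z_def grad_def inner_vec_def sum_3)
    have "(u x \<bullet> grad \<psi> x) *\<^sub>R u x + p x *\<^sub>R grad \<psi> x = (R x powr (2 * a) * partial 3 \<psi> x) *\<^sub>R e_z" for x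
      using powr_add[of "R x" a a] by (simp add: u_def p_def ez)
    moreover have "(LINT x|lborel. (R x powr (2 * a) * partial 3 \<psi> x) *\<^sub>R e_z) = 0"
      using zint[OF t, of "2 * a"] a by simp
    ultimately show "(LINT x|lborel. (u x \<bullet> grad \<psi> x) *\<^sub>R u x + p x *\<^sub>R grad \<psi> x) = 0" by simp
    show "(LINT x|lborel. u x \<bullet> grad \<psi> x) = 0"
      using zint(2)[OF t, of a] a by (simp add: u_def ez)
  qed
  have hom: "homogeneous_on UNIV \<alpha> u p"
    unfolding homogeneous_on_def
  proof (intro allI ballI impI conjI)
    fix l :: real and x :: "real^3" assume l: "l > 0"
    have "R (l *\<^sub>R x) = l\<^sup>2 * R x" by (simp add: R_def power_mult_distrib algebra_simps)
    then have "R (l *\<^sub>R x) powr a = (l powr 2) powr a * R x powr a"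
      using l Rnn by (simp add: powr_mult)
    also have "(l powr 2) powr a = l powr (- \<alpha>)" by (simp add: powr_powr a_def)
    finally have "l powr \<alpha> * R (l *\<^sub>R x) powr a = R x powr a"
      using l by (simp add: powr_minus field_simps)
    then show "u x = l powr \<alpha> *\<^sub>R u (l *\<^sub>R x)" by (simp add: u_def)
  qed (simp add: p_def)
  have axi: "axisymmetric u p"
    unfolding axisymmetric_def
    by (intro exI[of _ "\<lambda>r z. 0"] exI[of _ "\<lambda>r z. r powr (2 * a)"] allI impI) (simp add: u_def p_def rad_R)
  have rot: "\<not> irrotational_distributional u"
  proof
    assume irr: "irrotational_distributional u"
    \<comment> \<open>A bump around this point lives where x_1 > 1, and there the x_1-derivative of
      \<open>R powr a\<close> is positive. Integration by parts turns its integral against the bump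
      into the second component of the tested curl.\<close>
    define c :: "real^3" where "c = vector [2, 0, 0]"
    obtain \<psi> where t: "test_function \<psi>" and nn: "\<And>x. \<psi> x \<ge> 0" and pos: "\<And>x. \<psi> x > 0 \<longleftrightarrow> dist c x < 1"
      using exists_bump_test_function by metis
    obtain B where B: "\<And>x. norm x > B \<Longrightarrow> \<psi> x = 0 \<and> frechet_derivative \<psi> (at x) = (\<lambda>v. 0)"
      using supp[OF t] by blast
    have x1: "x $ 1 > 1" if "\<psi> x > 0" for x
      using that pos[of x] component_le_norm_cart[of "c - x" 1] by (auto simp: c_def dist_norm)
    define D2 where "D2 x = R x powr a * partial 1 \<psi> x" for x
    define D1 where "D1 x = a * R x powr (a - 1) * (2 * x $ 1) * \<psi> x" for x
    have c1: "continuous_on UNIV D1" and c2: "continuous_on UNIV D2"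
      unfolding D1_def D2_def partial_def using a by (intro continuous_intros contRp test[OF t]; simp)+
    have "(LINT x|lborel. D1 x + D2 x) = 0"
    proof (rule integral_directional_derivative_eq_0[where F="\<lambda>x. R x powr a * \<psi> x" and e="axis 1 1" and R=B])
      show "((\<lambda>t. R (x + t *\<^sub>R axis 1 1) powr a * \<psi> (x + t *\<^sub>R axis 1 1)) has_real_derivative
          D1 x + D2 x) (at 0)" for x
      proof (cases "R x = 0")
        case False
        have Rt: "R (x + t *\<^sub>R axis 1 1) = (x $ 1 + t)\<^sup>2 + (x $ 2)\<^sup>2" for t by (simp add: R_def axis_def)
        have "((\<lambda>t. R (x + t *\<^sub>R axis 1 1)) has_real_derivative 2 * x $ 1) (at 0)"
          unfolding Rt by (auto intro!: derivative_eq_intros)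
        then have "((\<lambda>t. R (x + t *\<^sub>R axis 1 1) powr a) has_real_derivative a * R x powr (a - 1) * (2 * x $ 1)) (at 0)"
          by (rule DERIV_chain2[rotated])
            (use has_real_derivative_powr[of "R x" a] False Rnn[of x] in \<open>simp add: less_le\<close>)
        from DERIV_mult[OF this dir[OF t]] show ?thesis
          by (simp add: D1_def D2_def partial_def algebra_simps)
      next
        case True
        then have "x $ 1 = 0" by (simp add: R_def sum_power2_eq_zero_iff)
        have "((\<lambda>t::real. 0) has_real_derivative 0) (at 0)" by simp
        then have "((\<lambda>t. R (x + t *\<^sub>R axis 1 1) powr a * \<psi> (x + t *\<^sub>R axis 1 1)) has_real_derivative 0) (at 0)"
        proof (rule has_field_derivative_transform_within_open[where S="{..<1}"])
          fix t :: real assume "t \<in> {..<1}"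
          then have "\<not> (x + t *\<^sub>R axis 1 1) $ 1 > 1" using \<open>x $ 1 = 0\<close> by (simp add: axis_def)
          then have "\<psi> (x + t *\<^sub>R axis 1 1) = 0" using x1 nn by (metis less_le)
          then show "0 = R (x + t *\<^sub>R axis 1 1) powr a * \<psi> (x + t *\<^sub>R axis 1 1)" by simp
        qed auto
        then show ?thesis using True by (simp add: D1_def D2_def)
      qed
      show "continuous_on UNIV (\<lambda>x. R x powr a * \<psi> x)"
        using a by (intro continuous_intros contRp test[OF t]) simp
    qed (use c1 c2 B in \<open>auto intro: continuous_on_add\<close>)
    moreover have i1: "integrable lborel D1" and i2: "integrable lborel D2"
      by (rule integrable_continuous_compact_support[OF c1, of B] integrable_continuous_compact_support[OF c2, of B];
          use B in \<open>simp add: D1_def D2_def partial_def\<close>)+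
    moreover have "(LINT x|lborel. D1 x) > 0"
    proof (rule integral_pos_if_continuous[OF c1 i1, of c])
      show "D1 x \<ge> 0" for x
        using x1[of x] nn[of x] a by (cases "\<psi> x = 0") (auto simp: D1_def)
      have "R c = 4" "c $ 1 = 2" "\<psi> c > 0" using pos by (simp_all add: R_def c_def)
      then show "D1 c > 0" using a by (simp add: D1_def)
    qed
    ultimately have neg: "(LINT x|lborel. D2 x) < 0" by simp
    have ezv: "u x = vector [0, 0, R x powr a]" for x
      by (simp add: u_def e_z_def vec_eq_iff forall_3)
    have comp: "cross3 (grad \<psi> x) (u x) $ 2 = - D2 x" for x
      unfolding ezv cross3_vertical_nth by (simp add: D2_def grad_def)
    have "integrable lborel (\<lambda>x. cross3 (grad \<psi> x) (u x))"
    proof (rule integrable_continuous_compact_support[where R=B])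
      have "cross3 (grad \<psi> x) (u x) = (R x powr a * partial 2 \<psi> x) *\<^sub>R axis 1 1 - (R x powr a * partial 1 \<psi> x) *\<^sub>R axis 2 1" for x
        unfolding ezv by (simp add: cross3_def grad_def vec_eq_iff forall_3 axis_def)
      moreover have "continuous_on UNIV (\<lambda>x. (R x powr a * partial 2 \<psi> x) *\<^sub>R axis 1 1 - (R x powr a * partial 1 \<psi> x) *\<^sub>R axis 2 (1::real) :: real^3)"
        unfolding partial_def using a by (intro continuous_intros contRp test[OF t]) auto
      ultimately show "continuous_on UNIV (\<lambda>x. cross3 (grad \<psi> x) (u x))" by simp
      show "cross3 (grad \<psi> x) (u x) = 0" if "norm x > B" for x
        using B[OF that] by (simp add: grad_def partial_def cross3_def vec_eq_iff forall_3)
    qed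
    then have "(LINT x|lborel. cross3 (grad \<psi> x) (u x) $ 2) = (LINT x|lborel. cross3 (grad \<psi> x) (u x)) $ 2"
      by (rule integral_bounded_linear[OF bounded_linear_vec_nth])
    also have "\<dots> = 0" using irr t unfolding irrotational_distributional_def by simp
    finally show False using neg comp by simp
  qed
  have "bernoulli u p 0 = 0" "bernoulli u p (vector [1, 0, 0]) = 1 / 2"
    by (simp_all add: bernoulli_def u_def p_def R_def e_z_def norm_vec_def L2_set_def sum_3)
  then have "\<not> bernoulli u p constant_on UNIV"
    unfolding constant_on_def by (metis UNIV_I zero_neq_one divide_eq_0_iff zero_neq_numeral)
  moreover have "C_k_on 1 {x. rad x \<noteq> 0} p"
    using C1 unfolding p_def
    by (simp add: differentiable_def)
  moreover have "continuous_on UNIV p" by (simp add: p_def)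
  ultimately show ?thesis
    using contu euler hom axi rot C1 pol tor
    by (intro exI[of _ u] exI[of _ p]) (simp add: rot_axi_hom_solution_continuous_def del: C_k_on.simps)
qed

section \<open>A family of Volterra equations\<close>

lemma integral_monomial_unit: "integral {0..1} (\<lambda>s::real. s ^ n) = 1 / real (Suc n)"
proof -
  have "((\<lambda>s::real. s ^ n) has_integral (1 ^ Suc n / real (Suc n) - 0 ^ Suc n / real (Suc n))) {0..1}"
    by (rule fundamental_theorem_of_calculus)
      (auto intro!: derivative_eq_intros simp: has_real_derivative_iff_has_vector_derivative[symmetric] simp del: of_nat_Suc power_Suc)
  then show ?thesis by (simp add: integral_unique)
qed

lemma scaled_in_closed_interval:
  fixes s x :: real
  assumes "s \<in> {0..1}" "x \<in> {a..b}" "a \<le> 0" "0 \<le> b"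
  shows "s * x \<in> {a..b}"
proof (cases "x \<ge> 0")
  case True
  then have "0 \<le> s * x" "s * x \<le> x" using assms mult_left_le_one_le[of x s] by auto
  then show ?thesis using assms by auto
next
  case False
  then have "s * x \<le> 0" "x \<le> s * x"
    using assms mult_right_mono_neg[of s 1 x] mult_nonneg_nonpos[of s x] by auto
  then show ?thesis using assms by auto
qed

text \<open>For w'' = -H with w(0) = 0 and w'(0) = 1 one has w(x) = x - (integral over [0, x] of (x
  - t) H dt). Substituting t = s x and dividing by x gives the equation for \<open>G\<close> = w/x,
  with no singularity left at x = 0. Continuity jointly in the parameter is what the shooting
  argument will use.\<close>

lemma volterra_family:
  fixes H :: "'a::metric_space \<Rightarrow> real \<Rightarrow> real \<Rightarrow> real" and a b :: real
  assumes ab: "a \<le> 0" "0 \<le> b"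
    and H: "continuous_on (P \<times> {a..b} \<times> UNIV) (\<lambda>(k, t, g). H k t g)"
    and lip: "\<And>Q. compact Q \<Longrightarrow> Q \<subseteq> P \<Longrightarrow>
      \<exists>L\<ge>0. \<forall>k\<in>Q. \<forall>t\<in>{a..b}. \<forall>g g'. \<bar>H k t g - H k t g'\<bar> \<le> L * \<bar>g - g'\<bar>"
  obtains G where "\<And>Q. compact Q \<Longrightarrow> Q \<subseteq> P \<Longrightarrow> continuous_on (Q \<times> {a..b}) (\<lambda>(k, x). G k x)"
    "\<And>k x. k \<in> P \<Longrightarrow> x \<in> {a..b} \<Longrightarrow>
      G k x = 1 - x * integral {0..1} (\<lambda>s. (1 - s) * H k (s * x) (G k (s * x)))"
proof -
  define V where "V G k x = 1 - x * integral {0..1} (\<lambda>s. (1 - s) * H k (s * x) (G k (s * x)))" for G k x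
  define I where "I n = (V ^^ n) (\<lambda>_ _. 1)" for n
  have I_Suc: "I (Suc n) = V (I n)" for n by (simp add: I_def)
  note sx = scaled_in_closed_interval[OF _ _ ab]
  have contH: "continuous_on (Q \<times> {a..b} \<times> {0..1}) (\<lambda>(k, x, s). (1 - s) * H k (s * x) (G k (s * x)))"
    if G: "continuous_on (Q \<times> {a..b}) (\<lambda>(k, x). G k x)" and Q: "Q \<subseteq> P" for G Q
  proof -
    have 1: "continuous_on (Q \<times> {a..b} \<times> {0..1}) (\<lambda>z. G (fst z) (snd (snd z) * fst (snd z)))"
      by (rule continuous_on_compose2[OF G, where f="\<lambda>z. (fst z, snd (snd z) * fst (snd z))", simplified])
        (auto intro!: continuous_intros sx[simplified])
    have "continuous_on (Q \<times> {a..b} \<times> {0..1}) (\<lambda>z. H (fst z) (snd (snd z) * fst (snd z)) (G (fst z) (snd (snd z) * fst (snd z))))"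
      by (rule continuous_on_compose2[OF H, where f="\<lambda>z. (fst z, snd (snd z) * fst (snd z), G (fst z) (snd (snd z) * fst (snd z)))", simplified])
        (use Q in \<open>auto intro!: continuous_intros 1 sx[simplified]\<close>)
    then show ?thesis unfolding case_prod_beta by (intro continuous_intros)
  qed
  have contV: "continuous_on (Q \<times> {a..b}) (\<lambda>(k, x). V G k x)"
    if G: "continuous_on (Q \<times> {a..b}) (\<lambda>(k, x). G k x)" and Q: "Q \<subseteq> P" for G Q
  proof -
    have "continuous_on ((Q \<times> {a..b}) \<times> {0..1}) (\<lambda>w. (fst (fst w), snd (fst w), snd w))"
      by (intro continuous_intros)
    from continuous_on_compose2[OF contH[OF that] this]
    have "continuous_on ((Q \<times> {a..b}) \<times> {0..1})
        (\<lambda>w. (1 - snd w) * H (fst (fst w)) (snd w * snd (fst w)) (G (fst (fst w)) (snd w * snd (fst w))))"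
      by (force simp: case_prod_beta)
    then have "continuous_on (Q \<times> {a..b}) (\<lambda>z. integral (cbox 0 1) (\<lambda>s. (1 - s) * H (fst z) (s * snd z) (G (fst z) (s * snd z))))"
      by (intro integral_continuous_on_param) (simp add: case_prod_beta)
    then show ?thesis unfolding V_def case_prod_beta by (intro continuous_intros) simp
  qed
  have contI: "continuous_on (P \<times> {a..b}) (\<lambda>(k, x). I n k x)" for n
  proof (induction n)
    case 0 show ?case by (simp add: I_def case_prod_beta)
  next
    case (Suc n) show ?case unfolding I_Suc by (rule contV[OF Suc order_refl])
  qed
  have intH: "(\<lambda>s. (1 - s) * H k (s * x) (G k (s * x))) integrable_on {0..1}"
    if G: "continuous_on ({k} \<times> {a..b}) (\<lambda>(k, x). G k x)" and "k \<in> P" "x \<in> {a..b}" for G k x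
  proof (rule integrable_continuous_interval)
    show "continuous_on {0..1} (\<lambda>s. (1 - s) * H k (s * x) (G k (s * x)))"
    proof -
      have "continuous_on {0..1} (\<lambda>s. (k, x, s))" by (intro continuous_intros)
      from continuous_on_compose2[OF contH[OF G] this] that(2,3) show ?thesis by force
    qed
  qed
  \<comment> \<open>Each application gains a factor \<open>L * \<bar>x\<bar> / (n + 1)\<close>, the
    denominator coming from the integral of \<open>s ^ n\<close>. The factorials make the Picard
    series converge on the whole interval, however large the Lipschitz constant is.\<close>
  have step: "\<bar>V G k x - V G' k x\<bar> \<le> D * (L * \<bar>x\<bar>) ^ Suc n / fact (Suc n)"
    if k: "k \<in> P" and x: "x \<in> {a..b}" and L: "L \<ge> 0"
      "\<And>t g g'. t \<in> {a..b} \<Longrightarrow> \<bar>H k t g - H k t g'\<bar> \<le> L * \<bar>g - g'\<bar>"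
      and G: "continuous_on ({k} \<times> {a..b}) (\<lambda>(k, x). G k x)"
      and G': "continuous_on ({k} \<times> {a..b}) (\<lambda>(k, x). G' k x)"
      and D: "\<And>t. t \<in> {a..b} \<Longrightarrow> \<bar>G k t - G' k t\<bar> \<le> D * (L * \<bar>t\<bar>) ^ n / fact n"
    for G G' k x L D n
  proof -
    let ?f = "\<lambda>G s. (1 - s) * H k (s * x) (G k (s * x))"
    let ?C = "L * (D * (L * \<bar>x\<bar>) ^ n / fact n)"
    have "norm (integral {0..1} (\<lambda>s. ?f G s - ?f G' s)) \<le> integral {0..1} (\<lambda>s. ?C * s ^ n)"
    proof (rule Henstock_Kurzweil_Integration.integral_norm_bound_integral)
      fix s :: real assume s: "s \<in> {0..1}"
      have "\<bar>?f G s - ?f G' s\<bar> = (1 - s) * \<bar>H k (s * x) (G k (s * x)) - H k (s * x) (G' k (s * x))\<bar>"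
        using s by (simp add: abs_mult right_diff_distrib[symmetric])
      also have "\<dots> \<le> 1 * (L * \<bar>G k (s * x) - G' k (s * x)\<bar>)"
        by (rule mult_mono) (use s L(2)[OF sx[OF s x]] in auto)
      also have "\<dots> \<le> L * (D * (L * \<bar>s * x\<bar>) ^ n / fact n)"
        unfolding mult_1 by (rule mult_left_mono[OF D[OF sx[OF s x]] L(1)])
      also have "\<dots> = ?C * s ^ n" using s by (simp add: abs_mult power_mult_distrib)
      finally show "norm (?f G s - ?f G' s) \<le> ?C * s ^ n" by simp
    next
      show "(\<lambda>s. ?f G s - ?f G' s) integrable_on {0..1}"
        by (intro Henstock_Kurzweil_Integration.integrable_diff intH G G' k x)
      show "(\<lambda>s. ?C * s ^ n) integrable_on {0..1}"
        by (intro integrable_continuous_interval continuous_intros)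
    qed
    also have "\<dots> = ?C / real (Suc n)" by (simp add: integral_monomial_unit del: of_nat_Suc)
    finally have "\<bar>x\<bar> * \<bar>integral {0..1} (?f G) - integral {0..1} (?f G')\<bar> \<le> \<bar>x\<bar> * (?C / real (Suc n))"
      unfolding Henstock_Kurzweil_Integration.integral_diff[OF intH[OF G k x] intH[OF G' k x]] real_norm_def
      by (rule mult_left_mono) simp
    moreover have "\<bar>x\<bar> * (?C / real (Suc n)) = D * (L * \<bar>x\<bar>) ^ Suc n / fact (Suc n)"
      by (simp add: field_simps)
    moreover have "V G k x - V G' k x = - (x * (integral {0..1} (?f G) - integral {0..1} (?f G')))"
      by (simp add: V_def algebra_simps)
    ultimately show ?thesis by (simp add: abs_mult)
  qed
  \<comment> \<open>The limit of the iterates as a telescoping series; the leading 1 is the iterate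
    of index 0.\<close>
  define G where "G k x = 1 + (\<Sum>n. I (Suc n) k x - I n k x)" for k x
  have unif: "uniform_limit (Q \<times> {a..b}) (\<lambda>n (k, x). I n k x) (\<lambda>(k, x). G k x) sequentially"
    if Q: "compact Q" "Q \<subseteq> P" for Q
  proof -
    obtain L where L: "L \<ge> 0" "\<And>k t g g'. k \<in> Q \<Longrightarrow> t \<in> {a..b} \<Longrightarrow> \<bar>H k t g - H k t g'\<bar> \<le> L * \<bar>g - g'\<bar>"
      using lip[OF Q] by blast
    have cQ: "continuous_on (Q \<times> {a..b}) (\<lambda>(k, x). I n k x)" for n
      by (rule continuous_on_subset[OF contI]) (use Q in auto)
    have ck: "continuous_on ({k} \<times> {a..b}) (\<lambda>(k, x). I n k x)" if "k \<in> Q" for k n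
      by (rule continuous_on_subset[OF cQ]) (use that in auto)
    have "compact ((\<lambda>(k, x). I 1 k x - I 0 k x) ` (Q \<times> {a..b}))"
      by (rule compact_continuous_image)
        (use cQ[of 0] cQ[of 1] Q in \<open>auto intro!: continuous_intros compact_Times simp: case_prod_beta\<close>)
    then obtain D where D: "\<And>k x. k \<in> Q \<Longrightarrow> x \<in> {a..b} \<Longrightarrow> \<bar>I 1 k x - I 0 k x\<bar> \<le> D"
      by (force dest!: compact_imp_bounded simp: bounded_iff)
    have est: "\<bar>I (Suc n) k x - I n k x\<bar> \<le> D * (L * \<bar>x\<bar>) ^ n / fact n" if "k \<in> Q" "x \<in> {a..b}" for n k x
      using that(2)
    proof (induction n arbitrary: x)
      case 0
      then show ?case using D[OF that(1)] by simp
    next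
      case (Suc n)
      have kP: "k \<in> P" using that(1) Q by auto
      show ?case
        using step[OF kP Suc.prems L(1) L(2)[OF that(1)] ck[OF that(1), of "Suc n"] ck[OF that(1), of n] Suc.IH]
        unfolding I_Suc by simp
    qed
    define B where "B = max (- a) b"
    have M: "norm (I (Suc n) k x - I n k x) \<le> D * ((L * B) ^ n / fact n)" if "k \<in> Q" "x \<in> {a..b}" for n k x
    proof -
      have "\<bar>x\<bar> \<le> B" using that(2) by (auto simp: B_def)
      then have "(L * \<bar>x\<bar>) ^ n \<le> (L * B) ^ n" using L(1) by (intro power_mono mult_left_mono) auto
      moreover have "D \<ge> 0" using D[OF that] by linarith
      ultimately have "D * (L * \<bar>x\<bar>) ^ n / fact n \<le> D * ((L * B) ^ n / fact n)"
        by (simp add: divide_right_mono mult_left_mono)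
      with est[OF that, of n] show ?thesis by simp
    qed
    have "uniform_limit (Q \<times> {a..b}) (\<lambda>n z. \<Sum>i<n. I (Suc i) (fst z) (snd z) - I i (fst z) (snd z))
        (\<lambda>z. \<Sum>i. I (Suc i) (fst z) (snd z) - I i (fst z) (snd z)) sequentially"
    proof (rule Weierstrass_m_test)
      show "summable (\<lambda>n. D * ((L * B) ^ n / fact n))"
        by (intro summable_mult) (use summable_exp[of "L * B"] in \<open>simp add: field_simps\<close>)
    qed (use M in auto)
    then have "uniform_limit (Q \<times> {a..b}) (\<lambda>n z. 1 + (\<Sum>i<n. I (Suc i) (fst z) (snd z) - I i (fst z) (snd z)))
        (\<lambda>z. G (fst z) (snd z)) sequentially"
      unfolding G_def by (intro uniform_limit_intros)
    moreover have "1 + (\<Sum>i<n. I (Suc i) k x - I i k x) = I n k x" for n k x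
      using sum_lessThan_telescope[of "\<lambda>i. I i k x" n] by (simp add: I_def)
    ultimately show ?thesis by (simp add: case_prod_unfold)
  qed
  have contG: "continuous_on (Q \<times> {a..b}) (\<lambda>(k, x). G k x)" if Q: "compact Q" "Q \<subseteq> P" for Q
    by (rule uniform_limit_theorem[OF _ unif[OF Q]])
      (use Q in \<open>auto intro!: always_eventually continuous_on_subset[OF contI]\<close>)
  moreover have "G k x = V G k x" if k: "k \<in> P" and x: "x \<in> {a..b}" for k x
  proof -
    have Q: "compact {k}" "{k} \<subseteq> P" using k by auto
    obtain L where L: "L \<ge> 0" "\<And>t g g'. t \<in> {a..b} \<Longrightarrow> \<bar>H k t g - H k t g'\<bar> \<le> L * \<bar>g - g'\<bar>"
      using lip[OF Q] by blast
    note u = unif[OF Q]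
    have lim1: "(\<lambda>n. I n k x) \<longlonglongrightarrow> G k x"
      using tendsto_uniform_limitI[OF u, of "(k, x)"] x by simp
    have "(\<lambda>n. V (I n) k x) \<longlonglongrightarrow> V G k x"
    proof (rule LIMSEQ_I)
      fix r :: real assume r: "r > 0"
      define e where "e = r / (L * \<bar>x\<bar> + 1)"
      have Lx: "L * \<bar>x\<bar> \<ge> 0" using L by simp
      have e: "e > 0" using r Lx by (simp add: e_def add_nonneg_pos)
      obtain N where N: "\<And>n t. n \<ge> N \<Longrightarrow> t \<in> {a..b} \<Longrightarrow> \<bar>I n k t - G k t\<bar> < e"
        using u[unfolded uniform_limit_iff, rule_format, OF e]
        unfolding eventually_sequentially dist_real_def by fastforce
      have "norm (V (I n) k x - V G k x) < r" if n: "n \<ge> N" for n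
      proof -
        \<comment> \<open>\<open>step\<close> with n = 0, that is, with a constant bound for the
          difference of the two arguments.\<close>
        have "\<bar>V (I n) k x - V G k x\<bar> \<le> e * (L * \<bar>x\<bar>) ^ Suc 0 / fact (Suc 0)"
        proof (rule step[OF k x L])
          show "continuous_on ({k} \<times> {a..b}) (\<lambda>(k, x). I n k x)"
            by (rule continuous_on_subset[OF contI]) (use k in auto)
          show "\<bar>I n k t - G k t\<bar> \<le> e * (L * \<bar>t\<bar>) ^ 0 / fact 0" if "t \<in> {a..b}" for t
            using N[OF n that] by simp
        qed (use contG[OF Q] in auto)
        also have "\<dots> < e * (L * \<bar>x\<bar> + 1)" using e by simp
        also have "\<dots> = r" using Lx by (simp add: e_def)
        finally show ?thesis by simp
      qed
      then show "\<exists>N. \<forall>n\<ge>N. norm (V (I n) k x - V G k x) < r" by blast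
    qed
    moreover have "(\<lambda>n. V (I n) k x) \<longlonglongrightarrow> G k x"
      using LIMSEQ_Suc[OF lim1] by (simp add: I_Suc)
    ultimately show ?thesis using LIMSEQ_unique by blast
  qed
  ultimately show thesis using that[of G] unfolding V_def by blast
qed

section \<open>The profile equation\<close>

lemma nonneg_derivative_imp_le:
  fixes f f' :: "real \<Rightarrow> real"
  assumes "a \<le> b" "continuous_on {a..b} f"
    and "\<And>x. a < x \<Longrightarrow> x < b \<Longrightarrow> (f has_real_derivative f' x) (at x)"
    and "\<And>x. a < x \<Longrightarrow> x < b \<Longrightarrow> f' x \<ge> 0"
  shows "f a \<le> f b"
proof (cases "a = b")
  case False
  with assms(1) have "a < b" by simp
  from MVT[OF this assms(2)] assms(3) obtain l z where "a < z" "z < b"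
      "(f has_real_derivative l) (at z)" "f b - f a = (b - a) * l"
    using real_differentiable_def by blast
  moreover from this have "l = f' z" using assms(3) DERIV_unique by blast
  ultimately have "f b - f a \<ge> 0" using assms(4) \<open>a < b\<close> by simp
  then show ?thesis by simp
qed simp

lemma DERIV_abs_powr_mult:
  fixes p x :: real
  assumes "p > 0"
  shows "((\<lambda>w. \<bar>w\<bar> powr p * w) has_real_derivative (p + 1) * \<bar>x\<bar> powr p) (at x)"
proof -
  consider "x > 0" | "x < 0" | "x = 0" by linarith
  then show ?thesis
  proof cases
    case 1
    have "((\<lambda>w. w powr (p + 1)) has_real_derivative (p + 1) * \<bar>x\<bar> powr p) (at x)"
      using has_real_derivative_powr[OF 1, of "p + 1"] 1 by simp
    then show ?thesis
      by (rule has_field_derivative_transform_within_open[where S="{0<..}"])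
        (use 1 in \<open>auto simp: powr_add\<close>)
  next
    case 2
    have "((\<lambda>w. - ((- w) powr (p + 1))) has_real_derivative (p + 1) * \<bar>x\<bar> powr p) (at x)"
      using DERIV_minus[OF DERIV_chain2[OF has_real_derivative_powr[of "- x" "p + 1"] DERIV_minus[OF DERIV_ident]]] 2
      by simp
    then show ?thesis
      by (rule has_field_derivative_transform_within_open[where S="{..<0}"])
        (use 2 in \<open>auto simp: powr_add\<close>)
  next
    case 3
    have "((\<lambda>h::real. \<bar>h\<bar> powr p) \<longlongrightarrow> \<bar>0\<bar> powr p) (at 0)"
      by (rule tendsto_powr') (use assms in \<open>auto intro!: tendsto_intros tendsto_rabs_zero\<close>)
    then have "((\<lambda>h::real. \<bar>h\<bar> powr p) \<longlongrightarrow> 0) (at 0)" by simp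
    then have "((\<lambda>h::real. (\<bar>0 + h\<bar> powr p * (0 + h) - \<bar>0\<bar> powr p * 0) / h) \<longlongrightarrow> 0) (at 0)"
      by (rule Lim_transform_eventually) (auto simp: eventually_at_filter)
    then show ?thesis using 3 by (simp add: DERIV_def)
  qed
qed

lemma DERIV_abs_powr:
  fixes p x :: real
  assumes "p > 1"
  shows "((\<lambda>w. \<bar>w\<bar> powr p) has_real_derivative p * (\<bar>x\<bar> powr (p - 2) * x)) (at x)"
proof -
  consider "x > 0" | "x < 0" | "x = 0" by linarith
  then show ?thesis
  proof cases
    case 1
    have "((\<lambda>w. w powr p) has_real_derivative p * (\<bar>x\<bar> powr (p - 2) * x)) (at x)"
      using has_real_derivative_powr[OF 1, of p] 1 powr_add[of x "p - 2" 1] by simp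
    then show ?thesis
      by (rule has_field_derivative_transform_within_open[where S="{0<..}"]) (use 1 in auto)
  next
    case 2
    have "((\<lambda>w. (- w) powr p) has_real_derivative p * (\<bar>x\<bar> powr (p - 2) * x)) (at x)"
      using DERIV_chain2[OF has_real_derivative_powr[of "- x" p] DERIV_minus[OF DERIV_ident]] 2
        powr_add[of "- x" "p - 2" 1]
      by simp
    then show ?thesis
      by (rule has_field_derivative_transform_within_open[where S="{..<0}"]) (use 2 in auto)
  next
    case 3
    have eq: "\<bar>h\<bar> powr p = \<bar>h\<bar> powr (p - 1) * \<bar>h\<bar>" for h :: real
      using powr_add[of "\<bar>h\<bar>" "p - 1" 1] by simp
    have "((\<lambda>h::real. \<bar>h\<bar> powr (p - 1)) \<longlongrightarrow> \<bar>0\<bar> powr (p - 1)) (at 0)"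
      by (rule tendsto_powr') (use assms in \<open>auto intro!: tendsto_intros tendsto_rabs_zero\<close>)
    then have "((\<lambda>h::real. \<bar>h\<bar> powr (p - 1)) \<longlongrightarrow> 0) (at 0)" by simp
    then have "((\<lambda>h::real. \<bar>(\<bar>0 + h\<bar> powr p - \<bar>0\<bar> powr p) / h\<bar>) \<longlongrightarrow> 0) (at 0)"
      by (rule Lim_transform_eventually) (auto simp: eventually_at_filter eq abs_mult)
    then have "((\<lambda>h::real. (\<bar>0 + h\<bar> powr p - \<bar>0\<bar> powr p) / h) \<longlongrightarrow> 0) (at 0)"
      by (rule tendsto_rabs_zero_cancel)
    then show ?thesis using 3 by (simp add: DERIV_def)
  qed
qed

lemma real_antiderivative:
  fixes f :: "real \<Rightarrow> real"
  assumes "continuous_on UNIV f"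
  obtains F where "\<And>x. (F has_real_derivative f x) (at x)" "F 0 = 0"
proof -
  obtain F where F: "\<And>x. (F has_real_derivative f x) (at x)"
    using einterval_antiderivative[of "-\<infinity>" "\<infinity>" f] assms
    by (auto simp: continuous_on_eq_continuous_at has_real_derivative_iff_has_vector_derivative)
  show thesis
    by (rule that[of "\<lambda>x. F x - F 0"]) (auto intro!: derivative_eq_intros F)
qed

text \<open>The global Lipschitz bound makes the Picard iteration converge without a priori estimates; the
  energy bound below then shows that the solutions never leave \<open>[-1, 1]\<close>.\<close>

lemma truncated_power:
  fixes q :: real
  assumes q: "q > 1"
  obtains N N' \<Phi> where "\<And>w. (N has_real_derivative N' w) (at w)" "continuous_on UNIV N'"
    "\<And>v w. \<bar>N v - N w\<bar> \<le> q * \<bar>v - w\<bar>"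
    "\<And>w. \<bar>w\<bar> \<le> 1 \<Longrightarrow> N w = \<bar>w\<bar> powr (q - 1) * w"
    "\<And>w. (\<Phi> has_real_derivative N w) (at w)" "\<And>w. \<Phi> w \<ge> 0"
    "\<And>w. \<bar>w\<bar> \<le> 1 \<Longrightarrow> \<Phi> w = \<bar>w\<bar> powr (q + 1) / (q + 1)"
proof -
  \<comment> \<open>The derivative of \<open>\<bar>w\<bar> powr (q - 1) * w\<close>, frozen at its
    boundary value outside [-1, 1]. It is continuous and bounded by \<open>q\<close>, so its
    antiderivative is continuously differentiable and globally Lipschitz.\<close>
  define n where "n w = q * min \<bar>w\<bar> 1 powr (q - 1)" for w :: real
  have contn: "continuous_on UNIV n"
    unfolding n_def by (intro continuous_intros continuous_on_powr') (use q in auto)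
  have nn: "0 \<le> n w" "n w \<le> q" for w
    using powr_mono2[of "q - 1" "min \<bar>w\<bar> 1" 1] q by (auto simp: n_def)
  obtain N where N: "\<And>w. (N has_real_derivative n w) (at w)" "N 0 = 0"
    using real_antiderivative[OF contn] by blast
  have contN: "continuous_on UNIV N"
    using N(1) DERIV_isCont by (blast intro: continuous_at_imp_continuous_on)
  obtain \<Phi> where P: "\<And>w. (\<Phi> has_real_derivative N w) (at w)" "\<Phi> 0 = 0"
    using real_antiderivative[OF contN] by blast
  have contP: "continuous_on UNIV \<Phi>"
    using P(1) DERIV_isCont by (blast intro: continuous_at_imp_continuous_on)
  have lip: "\<bar>N v - N w\<bar> \<le> q * \<bar>v - w\<bar>" for v w
    using field_differentiable_bound[of UNIV N n q v w] N nn by auto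
  have mono: "N v \<le> N w" if "v \<le> w" for v w
    using nonneg_derivative_imp_le[OF that continuous_on_subset[OF contN subset_UNIV] N(1) nn(1)] .
  have zero: "f w = 0" if "\<And>x. \<bar>x\<bar> < 1 \<Longrightarrow> (f has_real_derivative 0) (at x)" "f 0 = 0"
      "continuous_on UNIV f" "\<bar>w\<bar> \<le> 1" for f :: "real \<Rightarrow> real" and w
  proof -
    have c: "continuous_on {-1..1} f" using that(3) continuous_on_subset by blast
    have "f x = f (-1)" if "\<bar>x\<bar> \<le> 1" for x
      by (rule DERIV_isconst2[OF _ c]) (use that \<open>\<And>x. \<bar>x\<bar> < 1 \<Longrightarrow> (f has_real_derivative 0) (at x)\<close> in auto)
    from this[of w] this[of 0] that(2,4) show ?thesis by simp
  qed
  have Neq: "N w = \<bar>w\<bar> powr (q - 1) * w" if "\<bar>w\<bar> \<le> 1" for w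
  proof -
    have "N w - \<bar>w\<bar> powr (q - 1) * w = 0"
    proof (rule zero[OF _ _ _ that])
      fix x :: real assume x: "\<bar>x\<bar> < 1"
      have "n x = (q - 1 + 1) * \<bar>x\<bar> powr (q - 1)" using x by (simp add: n_def)
      then show "((\<lambda>w. N w - \<bar>w\<bar> powr (q - 1) * w) has_real_derivative 0) (at x)"
        using DERIV_diff[OF N(1) DERIV_abs_powr_mult[of "q - 1" x]] q by fastforce
    next
      show "continuous_on UNIV (\<lambda>w. N w - \<bar>w\<bar> powr (q - 1) * w)"
        by (intro continuous_intros contN continuous_on_powr') (use q in auto)
    qed (simp add: N)
    then show ?thesis by simp
  qed
  have Peq: "\<Phi> w = \<bar>w\<bar> powr (q + 1) / (q + 1)" if "\<bar>w\<bar> \<le> 1" for w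
  proof -
    have "\<Phi> w - \<bar>w\<bar> powr (q + 1) / (q + 1) = 0"
    proof (rule zero[OF _ _ _ that])
      fix x :: real assume x: "\<bar>x\<bar> < 1"
      have "((\<lambda>w. \<Phi> w - \<bar>w\<bar> powr (q + 1) / (q + 1)) has_real_derivative
          (N x - (q + 1) * (\<bar>x\<bar> powr (q + 1 - 2) * x) / (q + 1))) (at x)"
        by (intro DERIV_diff P DERIV_cdivide DERIV_abs_powr) (use q in auto)
      moreover have "N x - (q + 1) * (\<bar>x\<bar> powr (q + 1 - 2) * x) / (q + 1) = 0"
        using Neq[of x] x q by simp
      ultimately show "((\<lambda>w. \<Phi> w - \<bar>w\<bar> powr (q + 1) / (q + 1)) has_real_derivative 0) (at x)" by simp
    next
      show "continuous_on UNIV (\<lambda>w. \<Phi> w - \<bar>w\<bar> powr (q + 1) / (q + 1))"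
        by (intro continuous_intros contP continuous_on_powr') (use q in auto)
    qed (use q in \<open>simp add: P\<close>)
    then show ?thesis by simp
  qed
  have "\<Phi> w \<ge> 0" for w
  proof (cases "w \<ge> 0")
    case True
    then show ?thesis
      using nonneg_derivative_imp_le[OF True continuous_on_subset[OF contP subset_UNIV] P(1)] P(2) mono[of 0] N(2) by simp
  next
    case False
    then show ?thesis
      using nonneg_derivative_imp_le[OF _ continuous_on_subset[OF continuous_on_minus[OF contP] subset_UNIV] DERIV_minus[OF P(1)], of w 0]
        P(2) mono[of _ 0] N(2) by simp
  qed
  with that[OF N(1) contn lip Neq P(1) _ Peq] show thesis by blast
qed

section \<open>Mean value integrals over [0, x], scaled to the unit interval\<close>

lemma scaled_in_interval:
  fixes s x :: real
  assumes "s \<in> {0..1}" "x \<in> {a<..<b}" "a < 0" "0 < b"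
  shows "s * x \<in> {a<..<b}"
proof (cases "x \<ge> 0")
  case True
  then have "0 \<le> s * x" "s * x \<le> x" using assms mult_left_le_one_le[of x s] by auto
  then show ?thesis using assms by auto
next
  case False
  then have "s * x \<le> 0" "x \<le> s * x"
    using assms mult_right_mono_neg[of s 1 x] mult_nonneg_nonpos[of s x] by auto
  then show ?thesis using assms by auto
qed

text \<open>The function is the integral of \<open>h\<close> from 0 to x, in a form that needs no
  case distinction on the sign of x.\<close>

lemma DERIV_mean_value_integral:
  fixes h :: "real \<Rightarrow> real"
  assumes "continuous_on {a..b} h" "a < 0" "0 < b" "x \<in> {a<..<b}"
  shows "((\<lambda>x. x * integral {0..1} (\<lambda>s. h (s * x))) has_real_derivative h x) (at x)"
proof -
  let ?J = "\<lambda>x. integral {a..x} h - integral {a..0} h"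
  have J: "(?J has_real_derivative h x) (at x)" if "x \<in> {a<..<b}" for x
  proof -
    have "(?J has_real_derivative h x) (at x within {a..b})"
      using DERIV_diff[OF integral_has_real_derivative[OF assms(1)] DERIV_const] that by fastforce
    then have "(?J has_real_derivative h x) (at x within {a<..<b})"
      by (rule DERIV_subset) auto
    then show ?thesis using that by (simp add: at_within_open[of x "{a<..<b}"])
  qed
  have eq: "?J x = x * integral {0..1} (\<lambda>s. h (s * x))" if x: "x \<in> {a<..<b}" for x
  proof -
    note sx = scaled_in_interval[OF _ x assms(2,3)]
    have "((\<lambda>s. x * h (s * x)) has_integral (?J (1 * x) - ?J (0 * x))) {0..1}"
    proof (rule fundamental_theorem_of_calculus)
      fix s :: real assume s: "s \<in> {0..1}"
      have "((\<lambda>s. ?J (s * x)) has_real_derivative h (s * x) * x) (at s)"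
        by (rule DERIV_chain2[where f="?J" and g="\<lambda>s. s * x", OF J[OF sx[OF s]]]) (auto intro!: derivative_eq_intros)
      then show "((\<lambda>s. ?J (s * x)) has_vector_derivative x * h (s * x)) (at s within {0..1})"
        by (simp add: has_real_derivative_iff_has_vector_derivative[symmetric] mult.commute has_field_derivative_at_within)
    qed simp
    from integral_unique[OF this] show ?thesis by simp
  qed
  show ?thesis
    by (rule has_field_derivative_transform_within_open[OF J[OF assms(4)], where S="{a<..<b}"])
      (use assms(4) eq in auto)
qed

text \<open>Differentiation under the integral sign raises the weight by one power of
  \<open>s\<close>. This yields derivatives of w(x)/x at x = 0 as well, where the quotient rule is
  useless.\<close>

lemma DERIV_weighted_mean_integral:
  fixes f f' :: "real \<Rightarrow> real"
  assumes "\<And>x. x \<in> {a<..<b} \<Longrightarrow> (f has_real_derivative f' x) (at x)" "continuous_on {a<..<b} f'"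
    "a < 0" "0 < b" "x \<in> {a<..<b}"
  shows "((\<lambda>x. integral {0..1} (\<lambda>s. s ^ n * f (s * x))) has_real_derivative
    integral {0..1} (\<lambda>s. s ^ Suc n * f' (s * x))) (at x)"
proof -
  note sx = scaled_in_interval[OF _ _ assms(3,4)]
  have cf: "continuous_on {a<..<b} f"
    using assms(1) DERIV_isCont by (blast intro: continuous_at_imp_continuous_on)
  have "((\<lambda>x. integral (cbox 0 1) (\<lambda>s. s ^ n * f (s * x))) has_field_derivative
      integral (cbox 0 1) (\<lambda>s. s ^ Suc n * f' (s * x))) (at x within {a<..<b})"
  proof (rule leibniz_rule_field_derivative)
    fix x s :: real assume x: "x \<in> {a<..<b}" and s: "s \<in> cbox 0 1"
    have "((\<lambda>x. f (s * x)) has_real_derivative f' (s * x) * s) (at x)"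
      by (rule DERIV_chain2[OF assms(1)]) (use sx x s in \<open>auto intro!: derivative_eq_intros\<close>)
    from DERIV_cmult[OF this, of "s ^ n"]
    show "((\<lambda>x. s ^ n * f (s * x)) has_field_derivative s ^ Suc n * f' (s * x)) (at x within {a<..<b})"
      by (simp add: has_field_derivative_at_within mult_ac)
  next
    fix x assume x: "x \<in> {a<..<b}"
    show "(\<lambda>s. s ^ n * f (s * x)) integrable_on cbox 0 1"
      by (rule integrable_continuous)
        (intro continuous_intros continuous_on_compose2[OF cf], use sx x in auto)
  next
    have "continuous_on ({a<..<b} \<times> cbox 0 1) (\<lambda>z. f' (snd z * fst z))"
      by (rule continuous_on_compose2[OF assms(2)]) (use sx in \<open>auto intro!: continuous_intros\<close>)
    then show "continuous_on ({a<..<b} \<times> cbox 0 1) (\<lambda>(x, s). s ^ Suc n * f' (s * x))"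
      unfolding case_prod_beta by (intro continuous_intros)
  qed (use assms(5) in \<open>auto intro: convex_real_interval\<close>)
  then show ?thesis using assms(5) by (simp add: at_within_open[of x "{a<..<b}"])
qed

text \<open>The variable x is 1 - sigma, the distance from the pole, so 1 - sigma^2 = x (2 - x).
  With w = x G the singular term lam w / (1 - sigma^2) becomes \<open>lam * G x / (2 - x)\<close>.
  Here \<open>v\<close> is w', and slope -1 in sigma is slope 1 in x.\<close>

locale profile_ode =
  fixes lam q k :: real and N \<Phi> G v :: "real \<Rightarrow> real"
  assumes lam: "lam > 0" and q: "q > 1" and k: "k \<ge> 1"
    and N_eq: "\<And>w. \<bar>w\<bar> \<le> 1 \<Longrightarrow> N w = \<bar>w\<bar> powr (q - 1) * w"
    and contN: "continuous_on UNIV N"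
    and Phi_deriv: "\<And>w. (\<Phi> has_real_derivative N w) (at w)" and Phi_nonneg: "\<And>w. \<Phi> w \<ge> 0"
    and Phi_eq: "\<And>w. \<bar>w\<bar> \<le> 1 \<Longrightarrow> \<Phi> w = \<bar>w\<bar> powr (q + 1) / (q + 1)"
    and contG: "continuous_on {0..1} G"
    and dw: "\<And>x. x \<in> {0..1} \<Longrightarrow> ((\<lambda>x. x * G x) has_real_derivative v x) (at x)"
    and dv: "\<And>x. x \<in> {0..1} \<Longrightarrow>
      (v has_real_derivative - (lam * G x / (2 - x) + k * N (x * G x))) (at x)"
    and v0: "v 0 = 1"
begin

section \<open>Energy estimates for the profile\<close>

definition w :: "real \<Rightarrow> real" where "w x = x * G x"

text \<open>Mechanical energy of w'' = -lam w / (x (2 - x)) - k N(w). The quadratic part w^2 / (x (2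
  - x)) is written with \<open>G\<close> so that it makes sense at x = 0. Its coefficient decreases
  on [0, 1], and this explicit dependence on x is the only source of energy loss.\<close>

definition energy :: "real \<Rightarrow> real" where
  "energy x = (v x)\<^sup>2 / 2 + lam * (w x * G x / (2 * (2 - x))) + k * \<Phi> (w x)"

lemma cont_v: "continuous_on {0..1} v"
  using dv DERIV_isCont by (blast intro: continuous_at_imp_continuous_on)

lemma cont_w: "continuous_on {0..1} w"
  unfolding w_def by (intro continuous_intros contG)

lemma cont_Phi: "continuous_on UNIV \<Phi>"
  using Phi_deriv DERIV_isCont by (blast intro: continuous_at_imp_continuous_on)

lemma cont_energy: "continuous_on {0..1} energy"
  unfolding energy_def
  by (intro continuous_intros contG cont_w cont_v continuous_on_compose2[OF cont_Phi]) auto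

lemma deriv_w: "x \<in> {0..1} \<Longrightarrow> (w has_real_derivative v x) (at x)"
  using dw unfolding w_def[abs_def] .

lemma deriv_v: "x \<in> {0..1} \<Longrightarrow>
    (v has_real_derivative - (lam * G x / (2 - x) + k * N (w x))) (at x)"
  using dv unfolding w_def .

lemma deriv_energy:
  assumes x: "0 < x" "x < 1"
  shows "(energy has_real_derivative - (lam * (G x)\<^sup>2 * (1 - x) / (2 - x)\<^sup>2)) (at x)"
proof -
  \<comment> \<open>The quotient form is differentiated because derivatives of \<open>w\<close> and
    \<open>v\<close> are at hand, but none of \<open>G\<close>.\<close>
  have "((\<lambda>x. (v x)\<^sup>2 / 2 + lam * ((w x)\<^sup>2 / (2 * (x * (2 - x)))) + k * \<Phi> (w x)) has_real_derivative
      v x * - (lam * G x / (2 - x) + k * N (w x)) +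
      lam * ((2 * w x * v x * (2 * (x * (2 - x))) - (w x)\<^sup>2 * (2 * (2 - 2 * x))) / (2 * (x * (2 - x)))\<^sup>2) +
      k * (N (w x) * v x)) (at x)"
    using x by (auto intro!: derivative_eq_intros deriv_w deriv_v
        DERIV_chain2[OF Phi_deriv deriv_w] simp: power2_eq_square) (simp add: field_simps)
  moreover have "v x * - (lam * G x / (2 - x) + k * N (w x)) +
      lam * ((2 * w x * v x * (2 * (x * (2 - x))) - (w x)\<^sup>2 * (2 * (2 - 2 * x))) / (2 * (x * (2 - x)))\<^sup>2) +
      k * (N (w x) * v x) = - (lam * (G x)\<^sup>2 * (1 - x) / (2 - x)\<^sup>2)"
  proof -
    have "lam * ((2 * w x * v x * (2 * (x * (2 - x))) - (w x)\<^sup>2 * (2 * (2 - 2 * x))) / (2 * (x * (2 - x)))\<^sup>2)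
        = lam * (v x * G x / (2 - x) - (G x)\<^sup>2 * (1 - x) / (2 - x)\<^sup>2)"
      using x unfolding w_def by (simp add: divide_simps) (simp add: power2_eq_square algebra_simps)
    then show ?thesis by (simp add: algebra_simps)
  qed
  ultimately have "((\<lambda>x. (v x)\<^sup>2 / 2 + lam * ((w x)\<^sup>2 / (2 * (x * (2 - x)))) + k * \<Phi> (w x))
      has_real_derivative - (lam * (G x)\<^sup>2 * (1 - x) / (2 - x)\<^sup>2)) (at x)" by simp
  then show ?thesis
    by (rule has_field_derivative_transform_within_open[where S="{0<..<1}"])
      (use x in \<open>auto simp: energy_def w_def power2_eq_square\<close>)
qed

lemma energy_0: "energy 0 = 1 / 2"
  using Phi_eq[of 0] q by (simp add: energy_def w_def v0)

lemma potential_nonneg: "x \<in> {0..1} \<Longrightarrow> lam * (w x * G x / (2 * (2 - x))) \<ge> 0"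
  using lam by (auto simp: w_def mult.assoc intro!: mult_nonneg_nonneg divide_nonneg_nonneg)

lemma energy_le: assumes "x \<in> {0..1}" shows "energy x \<le> 1 / 2"
proof -
  have "- energy 0 \<le> - energy x"
  proof (rule nonneg_derivative_imp_le[where f="\<lambda>x. - energy x" and f'="\<lambda>y. lam * (G y)\<^sup>2 * (1 - y) / (2 - y)\<^sup>2"])
    show "continuous_on {0..x} (\<lambda>x. - energy x)"
      using assms by (intro continuous_intros continuous_on_subset[OF cont_energy]) auto
    show "((\<lambda>x. - energy x) has_real_derivative lam * (G y)\<^sup>2 * (1 - y) / (2 - y)\<^sup>2) (at y)"
      if "0 < y" "y < x" for y
      using DERIV_minus[OF deriv_energy[of y]] that assms by simp
    show "lam * (G y)\<^sup>2 * (1 - y) / (2 - y)\<^sup>2 \<ge> 0" if "0 < y" "y < x" for y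
      using lam that assms by simp
  qed (use assms in auto)
  then show ?thesis by (simp add: energy_0)
qed

text \<open>All three parts of the energy are nonnegative and it never exceeds its initial value
  1/2. Integrating this bound gives \<open>w_le\<close>, which keeps \<open>w\<close> where the
  truncated nonlinearity is the pure power.\<close>

lemma v_le: assumes "x \<in> {0..1}" shows "\<bar>v x\<bar> \<le> 1"
proof -
  have "(v x)\<^sup>2 \<le> 1"
    using energy_le[OF assms] potential_nonneg[OF assms] Phi_nonneg[of "w x"] k
      mult_nonneg_nonneg[of k "\<Phi> (w x)"]
    unfolding energy_def by linarith
  then show ?thesis by (simp add: abs_square_le_1)
qed

lemma w_le: assumes "x \<in> {0..1}" shows "\<bar>w x\<bar> \<le> x"
proof -
  have c: "continuous_on {0..x} w" using cont_w by (rule continuous_on_subset) (use assms in auto)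
  have v: "\<bar>v y\<bar> \<le> 1" "(w has_real_derivative v y) (at y)" if "0 < y" "y < x" for y
    using v_le[of y] deriv_w[of y] that assms by auto
  have "0 - w 0 \<le> x - w x"
  proof (rule nonneg_derivative_imp_le[where f="\<lambda>x. x - w x" and f'="\<lambda>y. 1 - v y"])
    show "((\<lambda>x. x - w x) has_real_derivative 1 - v y) (at y)" if "0 < y" "y < x" for y
      by (intro DERIV_diff DERIV_ident v that)
    show "1 - v y \<ge> 0" if "0 < y" "y < x" for y using v(1)[OF that] by simp
  qed (use assms in \<open>auto intro!: continuous_on_diff c\<close>)
  moreover have "0 + w 0 \<le> x + w x"
  proof (rule nonneg_derivative_imp_le[where f="\<lambda>x. x + w x" and f'="\<lambda>y. 1 + v y"])
    show "((\<lambda>x. x + w x) has_real_derivative 1 + v y) (at y)" if "0 < y" "y < x" for y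
      by (intro DERIV_add DERIV_ident v that)
    show "1 + v y \<ge> 0" if "0 < y" "y < x" for y using v(1)[OF that] by linarith
  qed (use assms in \<open>auto intro!: continuous_on_add c\<close>)
  ultimately show ?thesis by (simp add: w_def abs_le_iff)
qed

lemma w_le_1: "x \<in> {0..1} \<Longrightarrow> \<bar>w x\<bar> \<le> 1"
  using w_le[of x] by auto

lemma G_le: assumes "0 < x" "x \<le> 1" shows "\<bar>G x\<bar> \<le> 1"
  using w_le[of x] assms by (simp add: w_def abs_mult)

text \<open>The rate of energy loss is at most \<open>lam\<close>: \<open>G\<close> is bounded by 1
  and 1 - x <= (2 - x)^2 on the interval. This bound is useful only near the pole.\<close>

lemma energy_ge: assumes "x \<in> {0..1}" shows "energy x \<ge> 1 / 2 - lam * x"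
proof -
  have "energy 0 + lam * 0 \<le> energy x + lam * x"
  proof (rule nonneg_derivative_imp_le[where f="\<lambda>x. energy x + lam * x"
      and f'="\<lambda>y. - (lam * (G y)\<^sup>2 * (1 - y) / (2 - y)\<^sup>2) + lam"])
    show "continuous_on {0..x} (\<lambda>x. energy x + lam * x)"
      using assms by (intro continuous_intros continuous_on_subset[OF cont_energy]) auto
    fix y assume y: "0 < y" "y < x"
    show "((\<lambda>x. energy x + lam * x) has_real_derivative - (lam * (G y)\<^sup>2 * (1 - y) / (2 - y)\<^sup>2) + lam) (at y)"
      using deriv_energy[of y] y assms by (auto intro!: derivative_eq_intros)
    have "(G y)\<^sup>2 \<le> 1" using G_le[of y] y assms by (simp add: abs_square_le_1)
    then have "(G y)\<^sup>2 * (1 - y) \<le> 1 * 1" using y assms by (intro mult_mono) auto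
    also have "1 * 1 \<le> (2 - y)\<^sup>2" using y assms by (simp add: one_le_power)
    finally have "(G y)\<^sup>2 * (1 - y) / (2 - y)\<^sup>2 \<le> 1" using y assms by (simp add: divide_le_eq)
    then have "lam * ((G y)\<^sup>2 * (1 - y) / (2 - y)\<^sup>2) \<le> lam * 1" using lam by (intro mult_left_mono) auto
    then show "- (lam * (G y)\<^sup>2 * (1 - y) / (2 - y)\<^sup>2) + lam \<ge> 0" by (simp add: mult.assoc)
  qed (use assms in auto)
  then show ?thesis by (simp add: energy_0)
qed

text \<open>The loss of energy times the weight x (2 - x) is exactly 2 - 2x times the quadratic part
  of the energy. The growth 2 - 2x of the weight multiplies the whole energy and therefore outweighs
  it.\<close>

lemma weighted_energy_mono:
  assumes "0 \<le> y" "y \<le> x" "x \<le> 1"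
  shows "y * (2 - y) * energy y \<le> x * (2 - x) * energy x"
proof (rule nonneg_derivative_imp_le[where f="\<lambda>x. x * (2 - x) * energy x"
    and f'="\<lambda>z. (2 - 2 * z) * energy z + z * (2 - z) * - (lam * (G z)\<^sup>2 * (1 - z) / (2 - z)\<^sup>2)"])
  show "continuous_on {y..x} (\<lambda>x. x * (2 - x) * energy x)"
    using assms by (intro continuous_intros continuous_on_subset[OF cont_energy]) auto
  fix z assume z: "y < z" "z < x"
  show "((\<lambda>x. x * (2 - x) * energy x) has_real_derivative
      (2 - 2 * z) * energy z + z * (2 - z) * - (lam * (G z)\<^sup>2 * (1 - z) / (2 - z)\<^sup>2)) (at z)"
  proof -
    have "((\<lambda>x. x * (2 - x)) has_real_derivative 2 - 2 * z) (at z)"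
      by (auto intro!: derivative_eq_intros)
    from DERIV_mult[OF this deriv_energy[of z]] z assms show ?thesis by (simp add: mult.commute)
  qed
  have "z * (2 - z) * (lam * (G z)\<^sup>2 * (1 - z) / (2 - z)\<^sup>2) = (2 - 2 * z) * (lam * (w z * G z / (2 * (2 - z))))"
    using z assms by (simp add: w_def divide_simps) (simp add: power2_eq_square algebra_simps)
  also have "\<dots> \<le> (2 - 2 * z) * energy z"
    using z assms k Phi_nonneg[of "w z"] by (intro mult_left_mono) (auto simp: energy_def)
  finally show "(2 - 2 * z) * energy z + z * (2 - z) * - (lam * (G z)\<^sup>2 * (1 - z) / (2 - z)\<^sup>2) \<ge> 0" by simp
qed (use assms in auto)

text \<open>The point where the two lower bounds are joined: lam \<delta> <= 1/4 leaves energy at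
  least 1/4 there.\<close>

definition \<delta> :: real where "\<delta> = min (1 / 2) (1 / (4 * lam))"

text \<open>A lower bound for the weighted energy at \<delta>. By monotonicity it persists beyond
  \<delta>, and the weight is at most 1, so it bounds the energy itself. It depends on
  \<open>lam\<close> alone, hence is uniform in \<open>k\<close>.\<close>

definition e0 :: real where "e0 = \<delta> * (2 - \<delta>) / 4"

lemma \<delta>: "0 < \<delta>" "\<delta> \<le> 1 / 2" "lam * \<delta> \<le> 1 / 4"
proof -
  show "0 < \<delta>" "\<delta> \<le> 1 / 2" using lam by (auto simp: \<delta>_def)
  have "lam * \<delta> \<le> lam * (1 / (4 * lam))" using lam by (intro mult_left_mono) (auto simp: \<delta>_def)
  then show "lam * \<delta> \<le> 1 / 4" using lam by simp
qed

lemma e0: "0 < e0" "e0 \<le> 1 / 4"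
proof -
  show "0 < e0" using \<delta> by (simp add: e0_def)
  have "\<delta> * (2 - \<delta>) = 1 - (1 - \<delta>)\<^sup>2" by (simp add: power2_eq_square algebra_simps)
  then have "\<delta> * (2 - \<delta>) \<le> 1" by simp
  then show "e0 \<le> 1 / 4" by (simp add: e0_def)
qed

lemma energy_lower_bound: assumes "x \<in> {0..1}" shows "energy x \<ge> e0"
proof (cases "x \<le> \<delta>")
  case True
  have "lam * x \<le> lam * \<delta>" using True lam by (intro mult_left_mono) auto
  then show ?thesis using energy_ge[OF assms] \<delta> e0 by linarith
next
  case False
  have d: "energy \<delta> \<ge> 1 / 4" using energy_ge[of \<delta>] \<delta> by auto
  have "e0 \<le> \<delta> * (2 - \<delta>) * energy \<delta>"
    using mult_left_mono[OF d, of "\<delta> * (2 - \<delta>)"] \<delta> by (simp add: e0_def)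
  also have "\<dots> \<le> x * (2 - x) * energy x"
    by (rule weighted_energy_mono) (use False assms \<delta> in auto)
  finally have *: "e0 \<le> x * (2 - x) * energy x" .
  have "0 < x * (2 - x)" using False assms \<delta> by auto
  then have "energy x > 0" using * e0 by (smt (verit) mult_nonneg_nonpos)
  moreover have "x * (2 - x) = 1 - (1 - x)\<^sup>2" by (simp add: power2_eq_square algebra_simps)
  then have "x * (2 - x) \<le> 1" by simp
  ultimately have "x * (2 - x) * energy x \<le> 1 * energy x" by (intro mult_right_mono) auto
  with * show ?thesis by simp
qed

section \<open>Rotation in the phase plane\<close>

definition A :: real where "A = k powr (1 / (q + 1))"

text \<open>The squared modulus of v + i A w. The energy bounds k |w|^(q+1), which is the power q +
  1 of A |w|; this scaling keeps the modulus bounded uniformly in \<open>k\<close>.\<close>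

definition R2 :: "real \<Rightarrow> real" where "R2 x = A\<^sup>2 * (w x)\<^sup>2 + (v x)\<^sup>2"

text \<open>The derivative of the argument of v + i A w, namely A (v^2 - w v') / \<open>R2\<close>,
  with the differential equation inserted for v'.\<close>

definition angular_speed :: "real \<Rightarrow> real" where
  "angular_speed x = A * ((v x)\<^sup>2 + lam * (w x * G x / (2 - x)) + k * (N (w x) * w x)) / R2 x"

lemma A_ge_1: "A \<ge> 1"
  using k q by (simp add: A_def ge_one_powr_ge_zero)

lemma N_mult: "x \<in> {0..1} \<Longrightarrow> N (w x) * w x = \<bar>w x\<bar> powr (q + 1)"
proof -
  assume "x \<in> {0..1}"
  then have "N (w x) * w x = \<bar>w x\<bar> powr (q - 1) * (\<bar>w x\<bar> * \<bar>w x\<bar>)"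
    using N_eq[OF w_le_1] by (simp add: mult.assoc)
  also have "\<dots> = \<bar>w x\<bar> powr (q + 1)"
    using powr_add[of "\<bar>w x\<bar>" "q - 1" 2] by (simp add: power2_eq_square add.commute)
  finally show ?thesis .
qed

lemma R2_pos: assumes x: "x \<in> {0..1}" shows "R2 x > 0"
proof (rule ccontr)
  assume "\<not> ?thesis"
  then have "A\<^sup>2 * (w x)\<^sup>2 + (v x)\<^sup>2 = 0" unfolding R2_def by (smt (verit) mult_nonneg_nonneg zero_le_power2)
  then have "w x = 0" "v x = 0" using A_ge_1 by (auto simp: add_nonneg_eq_0_iff)
  then show False using energy_lower_bound[OF x] e0 Phi_eq[of 0] q by (simp add: energy_def)
qed

text \<open>Either A |w| <= 1, or A |w| is at most its power q + 1, which the energy bounds by (q +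
  1)/2.\<close>

lemma R2_le: assumes x: "x \<in> {0..1}" shows "R2 x \<le> (q + 1)\<^sup>2 + 1"
proof -
  have "k * \<Phi> (w x) \<le> 1 / 2"
    using energy_le[OF x] potential_nonneg[OF x] unfolding energy_def by (smt (verit) zero_le_power2 divide_nonneg_pos)
  then have "k * \<bar>w x\<bar> powr (q + 1) \<le> (q + 1) / 2"
    using Phi_eq[OF w_le_1[OF x]] q by (simp add: field_simps)
  moreover have "(A * \<bar>w x\<bar>) powr (q + 1) = k * \<bar>w x\<bar> powr (q + 1)"
    using k q A_ge_1 by (simp add: powr_mult A_def powr_powr)
  ultimately have "(A * \<bar>w x\<bar>) powr (q + 1) \<le> (q + 1) / 2" by simp
  also have "\<dots> \<le> q + 1" using q by simp
  finally have *: "(A * \<bar>w x\<bar>) powr (q + 1) \<le> q + 1" .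
  have "A * \<bar>w x\<bar> \<le> q + 1"
  proof (cases "A * \<bar>w x\<bar> \<le> 1")
    case False
    then have "(A * \<bar>w x\<bar>) powr 1 \<le> (A * \<bar>w x\<bar>) powr (q + 1)" using q by (intro powr_mono) auto
    then show ?thesis using * False by simp
  qed (use q in linarith)
  then have "(A * \<bar>w x\<bar>)\<^sup>2 \<le> (q + 1)\<^sup>2" using A_ge_1 by (intro power_mono) auto
  then have "A\<^sup>2 * (w x)\<^sup>2 \<le> (q + 1)\<^sup>2" by (simp add: power_mult_distrib)
  moreover have "(v x)\<^sup>2 \<le> 1" using v_le[OF x] by (simp add: abs_square_le_1)
  ultimately show ?thesis by (simp add: R2_def)
qed

text \<open>Since q + 1 >= 2, the product \<open>N (w x) * w x\<close> is at least
  \<open>2 * \<Phi> (w x)\<close>, so the numerator is at least A times twice the energy. As the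
  denominator is bounded, the speed grows at least like a constant times \<open>A\<close>.\<close>

lemma angular_speed_ge:
  assumes x: "x \<in> {0..1}"
  shows "angular_speed x \<ge> 2 * e0 * A / ((q + 1)\<^sup>2 + 1)"
proof -
  have p: "N (w x) * w x \<ge> 2 * \<Phi> (w x)"
  proof -
    have "2 * (\<bar>w x\<bar> powr (q + 1) / (q + 1)) \<le> \<bar>w x\<bar> powr (q + 1)"
      using q mult_left_mono[of 2 "q + 1" "\<bar>w x\<bar> powr (q + 1)"] by (simp add: divide_le_eq)
    then show ?thesis using N_mult[OF x] Phi_eq[OF w_le_1[OF x]] by simp
  qed
  let ?n = "(v x)\<^sup>2 + lam * (w x * G x / (2 - x)) + k * (N (w x) * w x)"
  have "2 * energy x = (v x)\<^sup>2 + lam * (w x * G x / (2 - x)) + k * (2 * \<Phi> (w x))"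
    using x unfolding energy_def by (simp add: field_simps)
  also have "\<dots> \<le> ?n" using p k by (intro add_mono mult_left_mono order_refl) auto
  finally have n: "2 * e0 \<le> ?n" using energy_lower_bound[OF x] by linarith
  have "2 * e0 * A / ((q + 1)\<^sup>2 + 1) \<le> 2 * e0 * A / R2 x"
    using R2_pos[OF x] R2_le[OF x] e0 A_ge_1 by (intro divide_left_mono) (auto simp: add_pos_pos)
  also have "\<dots> \<le> A * ?n / R2 x"
    using n A_ge_1 R2_pos[OF x] by (intro divide_right_mono) (auto simp: mult.commute[of A])
  finally show ?thesis by (simp add: angular_speed_def)
qed

lemma cont_angular_speed: "continuous_on {0..1} angular_speed"
  unfolding angular_speed_def R2_def
  by (intro continuous_intros cont_v cont_w contG continuous_on_compose2[OF contN])
    (use R2_pos in \<open>fastforce simp: R2_def\<close>)+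

lemma total_angle_ge: "integral {0..1} angular_speed \<ge> 2 * e0 * A / ((q + 1)\<^sup>2 + 1)"
proof -
  have "integral {0..1} (\<lambda>x::real. 2 * e0 * A / ((q + 1)\<^sup>2 + 1)) \<le> integral {0..1} angular_speed"
    by (rule integral_le) (auto intro!: integrable_continuous_interval cont_angular_speed angular_speed_ge)
  then show ?thesis by simp
qed

text \<open>The angle is the argument of \<open>v + \<i> A w\<close>.\<close>

lemma zero_if_angle_multiple_of_pi:
  assumes "integral {0..1} angular_speed = real n * pi"
  shows "G 1 = 0"
proof -
  define \<Theta> where "\<Theta> x = integral {0..x} angular_speed" for x
  have dT: "(\<Theta> has_real_derivative angular_speed x) (at x within {0..1})" if "x \<in> {0..1}" for x
    unfolding \<Theta>_def using integral_has_real_derivative[OF cont_angular_speed that] .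
  have contT: "continuous_on {0..1} \<Theta>"
    using dT DERIV_continuous continuous_on_eq_continuous_within by blast
  \<comment> \<open>\<open>D\<close> is |v + i A w| times the sine of \<Theta> minus the argument,
    so \<open>D^2 / R2\<close> is a squared sine. Showing that it is constant avoids choosing a
    branch of the argument.\<close>
  define D where "D x = v x * sin (\<Theta> x) - A * w x * cos (\<Theta> x)" for x
  have contD: "continuous_on {0..1} (\<lambda>x. (D x)\<^sup>2 / R2 x)"
    unfolding D_def R2_def
    by (intro continuous_intros cont_v cont_w contT) (use R2_pos in \<open>fastforce simp: R2_def\<close>)
  have "(D 1)\<^sup>2 / R2 1 = (D 0)\<^sup>2 / R2 0"
  proof (rule DERIV_isconst_end[OF _ contD])
    fix x :: real assume x: "0 < x" "x < 1"
    define a where "a = - (lam * G x / (2 - x) + k * N (w x))"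
    define F where "F = angular_speed x"
    have dv': "(v has_real_derivative a) (at x)" unfolding a_def by (rule deriv_v) (use x in auto)
    have dw': "(w has_real_derivative v x) (at x)" by (rule deriv_w) (use x in auto)
    have dT': "(\<Theta> has_real_derivative F) (at x)"
      using dT[of x] x at_within_Icc_at[of 0 x 1] by (simp add: F_def)
    have R: "R2 x > 0" using R2_pos x by simp
    have FR: "F * R2 x = A * ((v x)\<^sup>2 - w x * a)"
    proof -
      have "F * R2 x = A * ((v x)\<^sup>2 + lam * (w x * G x / (2 - x)) + k * (N (w x) * w x))"
        using R by (simp add: F_def angular_speed_def)
      then show ?thesis by (simp add: a_def algebra_simps)
    qed
    define D' where "D' = a * sin (\<Theta> x) + v x * (cos (\<Theta> x) * F) - (A * v x * cos (\<Theta> x) - A * w x * (sin (\<Theta> x) * F))"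
    define R' where "R' = A\<^sup>2 * (2 * w x * v x) + 2 * v x * a"
    have dD: "(D has_real_derivative D') (at x)"
      unfolding D_def D'_def
      by (auto intro!: derivative_eq_intros dv' dw' dT' simp: algebra_simps)
    have dR: "(R2 has_real_derivative R') (at x)"
      unfolding R2_def R'_def
      by (auto intro!: derivative_eq_intros dv' dw' simp: algebra_simps)
    have key: "2 * D' * R2 x = D x * R'"
    proof -
      have "2 * D' * R2 x = 2 * sin (\<Theta> x) * (a * R2 x + A * w x * (F * R2 x))
          + 2 * cos (\<Theta> x) * (v x * (F * R2 x) - A * v x * R2 x)"
        by (simp add: D'_def algebra_simps)
      also have "\<dots> = D x * R'"
        unfolding FR by (simp add: R2_def D_def R'_def power2_eq_square algebra_simps)
      finally show ?thesis .
    qed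
    have "((\<lambda>x. (D x)\<^sup>2 / R2 x) has_real_derivative
        ((2 * D x * D') * R2 x - (D x)\<^sup>2 * R') / (R2 x * R2 x)) (at x)"
      using R by (auto intro!: derivative_eq_intros dD dR)
    moreover have "(2 * D x * D') * R2 x - (D x)\<^sup>2 * R' = D x * (2 * D' * R2 x - D x * R')"
      by (simp add: power2_eq_square algebra_simps)
    ultimately show "((\<lambda>x. (D x)\<^sup>2 / R2 x) has_real_derivative 0) (at x)" using key by simp
  qed simp
  moreover have "D 0 = 0" by (simp add: D_def \<Theta>_def w_def)
  ultimately have "D 1 = 0" using R2_pos[of 1] by simp
  moreover have "\<Theta> 1 = real n * pi" using assms by (simp add: \<Theta>_def)
  ultimately have "A * w 1 * cos (real n * pi) = 0" by (simp add: D_def)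
  then have "w 1 = 0" using A_ge_1 by (simp add: cos_npi)
  then show ?thesis by (simp add: w_def)
qed

end

section \<open>Shooting in the parameter k\<close>

lemma continuous_on_integral_scaled:
  fixes f :: "'a::topological_space \<Rightarrow> real \<Rightarrow> real"
  assumes f: "continuous_on (Q \<times> X) (\<lambda>(k, x). f k x)"
    and X: "\<And>s x. s \<in> {0..1} \<Longrightarrow> x \<in> X \<Longrightarrow> s * x \<in> X"
  shows "continuous_on (Q \<times> X) (\<lambda>z. integral {0..1} (\<lambda>s. s ^ n * f (fst z) (s * snd z)))"
proof -
  have "continuous_on ((Q \<times> X) \<times> {0..1}) (\<lambda>y. (fst (fst y), snd y * snd (fst y)))"
    by (intro continuous_intros)
  from continuous_on_compose2[OF f this]
  have "continuous_on ((Q \<times> X) \<times> {0..1}) (\<lambda>y. f (fst (fst y)) (snd y * snd (fst y)))"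
    using X by force
  then have "continuous_on ((Q \<times> X) \<times> cbox 0 1) (\<lambda>(z, s). s ^ n * f (fst z) (s * snd z))"
    unfolding case_prod_beta by (intro continuous_intros) simp
  from integral_continuous_on_param[OF this] show ?thesis by simp
qed

text \<open>Integration by parts in \<open>s\<close>: the function
  \<open>- ((1 - s) * J (s * x))\<close> vanishes at both ends, at 1 through its first factor and at
  0 because \<open>J 0 = 0\<close>.\<close>

lemma mean_value_integral_twice:
  fixes h :: "real \<Rightarrow> real"
  assumes h: "continuous_on {a..b} h" and ab: "a < 0" "0 < b" and x: "x \<in> {a<..<b}"
  defines "J \<equiv> \<lambda>y. y * integral {0..1} (\<lambda>s. h (s * y))"
  shows "integral {0..1} (\<lambda>s. J (s * x)) = x * integral {0..1} (\<lambda>s. (1 - s) * h (s * x))"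
proof -
  note sx = scaled_in_interval[OF _ x ab]
  have dJ: "(J has_real_derivative h y) (at y)" if "y \<in> {a<..<b}" for y
    unfolding J_def by (rule DERIV_mean_value_integral[OF h ab that])
  have dJs: "((\<lambda>s. J (s * x)) has_real_derivative h (s * x) * x) (at s)" if "s \<in> {0..1}" for s
    by (rule DERIV_chain2[where f=J and g="\<lambda>s. s * x", OF dJ[OF sx[OF that]]])
      (auto intro!: derivative_eq_intros)
  have "((\<lambda>s. J (s * x) - x * ((1 - s) * h (s * x))) has_integral
      (- ((1 - 1) * J (1 * x)) - - ((1 - 0) * J (0 * x)))) {0..1}"
  proof (rule fundamental_theorem_of_calculus)
    fix s :: real assume s: "s \<in> {0..1}"
    have "((\<lambda>s. - ((1 - s) * J (s * x))) has_real_derivative J (s * x) - x * ((1 - s) * h (s * x))) (at s)"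
      by (rule derivative_eq_intros dJs[OF s] refl)+ (simp add: algebra_simps)
    then show "((\<lambda>s. - ((1 - s) * J (s * x))) has_vector_derivative J (s * x) - x * ((1 - s) * h (s * x))) (at s within {0..1})"
      by (simp add: has_real_derivative_iff_has_vector_derivative[symmetric] has_field_derivative_at_within)
  qed simp
  then have "integral {0..1} (\<lambda>s. J (s * x) - x * ((1 - s) * h (s * x))) = 0"
    by (simp add: integral_unique J_def)
  moreover have "(\<lambda>s. J (s * x)) integrable_on {0..1}"
    using dJs DERIV_isCont by (intro integrable_continuous_interval) (blast intro: continuous_at_imp_continuous_on)
  moreover have "(\<lambda>s. x * ((1 - s) * h (s * x))) integrable_on {0..1}"
    by (intro integrable_continuous_interval continuous_intros continuous_on_compose2[OF h]) (use sx in force)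
  ultimately show ?thesis by (simp add: Henstock_Kurzweil_Integration.integral_diff)
qed

text \<open>Shooting: the total angle depends continuously on \<open>k\<close> and is unbounded as \<open>k \<rightarrow> \<infinity>\<close>, hence is a
  multiple of \<open>\<pi>\<close> for some \<open>k\<close>.\<close>

lemma exists_profile:
  fixes lam q :: real
  assumes lam: "lam > 0" and q: "q > 1"
  obtains k :: real and G G' G'' h h' :: "real \<Rightarrow> real"
  where "k \<ge> 1"
    "\<And>x. x \<in> {-1/2<..<3/2} \<Longrightarrow> (G has_real_derivative G' x) (at x)"
    "\<And>x. x \<in> {-1/2<..<3/2} \<Longrightarrow> (G' has_real_derivative G'' x) (at x)"
    "continuous_on {-1/2<..<3/2} G''" "G 0 = 1" "G 1 = 0"
    "\<And>x. x \<in> {-1/2<..<3/2} \<Longrightarrow> (h has_real_derivative h' x) (at x)"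
    "continuous_on {-1/2<..<3/2} h'"
    "\<And>x. x \<in> {-1/2<..<3/2} \<Longrightarrow> x * G'' x + 2 * G' x = - h x"
    "\<And>x. x \<in> {0..1} \<Longrightarrow> h x = lam * G x / (2 - x) + k * (\<bar>x * G x\<bar> powr (q - 1) * (x * G x))"
proof -
  obtain N N' \<Phi> where N: "\<And>w. (N has_real_derivative N' w) (at w)" and contN': "continuous_on UNIV N'"
    and N_lip: "\<And>v w. \<bar>N v - N w\<bar> \<le> q * \<bar>v - w\<bar>"
    and N_eq: "\<And>w. \<bar>w\<bar> \<le> 1 \<Longrightarrow> N w = \<bar>w\<bar> powr (q - 1) * w"
    and Phi: "\<And>w. (\<Phi> has_real_derivative N w) (at w)" "\<And>w. \<Phi> w \<ge> 0"
      "\<And>w. \<bar>w\<bar> \<le> 1 \<Longrightarrow> \<Phi> w = \<bar>w\<bar> powr (q + 1) / (q + 1)"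
    by (rule truncated_power[OF q]) blast
  have contN: "continuous_on UNIV N"
    using N DERIV_isCont by (blast intro: continuous_at_imp_continuous_on)
  \<comment> \<open>An interval that contains [0, 1] in its interior and stays away from x = 2, so
    that derivatives at the pole and at the equator are two-sided.\<close>
  let ?a = "-1/2 :: real" and ?b = "3/2 :: real"
  define H where "H k t g = lam * g / (2 - t) + k * N (t * g)" for k t g :: real
  have contH: "continuous_on ({1..} \<times> {?a..?b} \<times> UNIV) (\<lambda>(k, t, g). H k t g)"
    unfolding H_def case_prod_beta
    by (intro continuous_intros continuous_on_compose2[OF contN]) auto
  have lip: "\<exists>L\<ge>0. \<forall>k\<in>Q. \<forall>t\<in>{?a..?b}. \<forall>g g'. \<bar>H k t g - H k t g'\<bar> \<le> L * \<bar>g - g'\<bar>"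
    if Q: "compact Q" "Q \<subseteq> {1..}" for Q
  proof -
    obtain K0 where K0: "\<forall>k\<in>Q. norm k \<le> K0"
      using compact_imp_bounded[OF Q(1)] unfolding bounded_iff by blast
    define K where "K = max 0 K0"
    have K: "\<And>k. k \<in> Q \<Longrightarrow> k \<le> K" "K \<ge> 0" using K0 by (force simp: K_def)+
    \<comment> \<open>On this interval 1 / (2 - t) <= 2 and |t| <= 2; these are the two factors 2 in
      the constant.\<close>
    show ?thesis
    proof (intro exI[of _ "2 * lam + K * (q * 2)"] conjI ballI allI)
      show "2 * lam + K * (q * 2) \<ge> 0" using lam q K by simp
      fix k t g g' :: real assume k: "k \<in> Q" and t: "t \<in> {?a..?b}"
      have "\<bar>lam * g / (2 - t) - lam * g' / (2 - t)\<bar> = lam * \<bar>g - g'\<bar> * (1 / (2 - t))"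
        using lam t by (simp add: diff_divide_distrib[symmetric] right_diff_distrib[symmetric] abs_mult)
      also have "\<dots> \<le> lam * \<bar>g - g'\<bar> * 2"
        using lam t by (intro mult_left_mono) (auto simp: divide_le_eq)
      finally have 1: "\<bar>lam * g / (2 - t) - lam * g' / (2 - t)\<bar> \<le> 2 * lam * \<bar>g - g'\<bar>" by simp
      have "\<bar>N (t * g) - N (t * g')\<bar> \<le> q * \<bar>t * g - t * g'\<bar>" by (rule N_lip)
      also have "\<dots> = q * (\<bar>t\<bar> * \<bar>g - g'\<bar>)" by (simp add: right_diff_distrib[symmetric] abs_mult)
      also have "\<dots> \<le> q * (2 * \<bar>g - g'\<bar>)" using t q by (intro mult_left_mono mult_right_mono) auto
      finally have "\<bar>N (t * g) - N (t * g')\<bar> \<le> q * 2 * \<bar>g - g'\<bar>" by simp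
      then have "k * \<bar>N (t * g) - N (t * g')\<bar> \<le> K * (q * 2 * \<bar>g - g'\<bar>)"
        using K k Q(2) by (intro mult_mono) auto
      moreover have "k \<ge> 0" using k Q(2) by force
      ultimately have 2: "\<bar>k * N (t * g) - k * N (t * g')\<bar> \<le> K * (q * 2) * \<bar>g - g'\<bar>"
        by (simp add: right_diff_distrib[symmetric] abs_mult mult.assoc)
      show "\<bar>H k t g - H k t g'\<bar> \<le> (2 * lam + K * (q * 2)) * \<bar>g - g'\<bar>"
        using 1 2 unfolding H_def distrib_right by linarith
    qed
  qed
  obtain G where contG: "\<And>Q. compact Q \<Longrightarrow> Q \<subseteq> {1..} \<Longrightarrow> continuous_on (Q \<times> {?a..?b}) (\<lambda>(k, x). G k x)"
    and G: "\<And>k x. k \<in> {1..} \<Longrightarrow> x \<in> {?a..?b} \<Longrightarrow>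
      G k x = 1 - x * integral {0..1} (\<lambda>s. (1 - s) * H k (s * x) (G k (s * x)))"
  proof (rule volterra_family[OF _ _ contH lip])
  qed (auto)
  define h where "h k x = H k x (G k x)" for k x
  have conth: "continuous_on (Q \<times> {?a..?b}) (\<lambda>(k, x). h k x)" if "compact Q" "Q \<subseteq> {1..}" for Q
  proof -
    have "continuous_on (Q \<times> {?a..?b}) (\<lambda>z. G (fst z) (snd z))"
      using contG[OF that] by (simp add: case_prod_unfold)
    then show ?thesis
      unfolding h_def H_def case_prod_beta
      by (intro continuous_intros continuous_on_compose2[OF contN]) auto
  qed
  have scaled: "s * x \<in> {?a..?b}" if "s \<in> {0..1}" "x \<in> {?a..?b}" for s x
    by (rule scaled_in_closed_interval[OF that]) auto
  define v where "v k x = 1 - x * integral {0..1} (\<lambda>s. h k (s * x))" for k x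
  have contv: "continuous_on (Q \<times> {?a..?b}) (\<lambda>(k, x). v k x)" if "compact Q" "Q \<subseteq> {1..}" for Q
    using continuous_on_integral_scaled[OF conth[OF that] scaled, of 0]
    unfolding v_def case_prod_beta by (intro continuous_intros) simp
  have single: "continuous_on {?a..?b} (f k)"
    if "continuous_on ({k} \<times> {?a..?b}) (\<lambda>(k, x). f k x)" for f :: "real \<Rightarrow> real \<Rightarrow> real" and k
  proof -
    have "continuous_on {?a..?b} (\<lambda>x. (k, x))" by (intro continuous_intros)
    from continuous_on_compose2[OF that this] show ?thesis by force
  qed
  have conth1: "continuous_on {?a..?b} (h k)" if "k \<ge> 1" for k
    by (rule single, rule conth) (use that in auto)
  have contv1: "continuous_on {?a..?b} (v k)" if "k \<ge> 1" for k
    by (rule single, rule contv) (use that in auto)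
  have contG1: "continuous_on {?a..?b} (G k)" if "k \<ge> 1" for k
    by (rule single, rule contG) (use that in auto)
  \<comment> \<open>As the mean of \<open>v\<close> over the segment from 0 to x, \<open>G\<close>
    has x G as an antiderivative of \<open>v\<close>, and its own derivatives at x = 0 come from
    differentiating under the integral.\<close>
  have G_mean: "G k x = integral {0..1} (\<lambda>s. v k (s * x))" if "k \<ge> 1" "x \<in> {?a<..<?b}" for k x
  proof -
    let ?J = "\<lambda>y. y * integral {0..1} (\<lambda>s. h k (s * y))"
    have "continuous_on {?a..?b} (\<lambda>y. 1 - v k y)"
      by (intro continuous_intros contv1 that)
    then have cJ: "continuous_on {?a..?b} ?J" by (simp add: v_def)
    have "continuous_on {0..1} (\<lambda>s. s * x)" by (intro continuous_intros)
    from continuous_on_compose2[OF cJ this] scaled[of _ x] that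
    have "continuous_on {0..1} (\<lambda>s. ?J (s * x))" by force
    then have "(\<lambda>s. ?J (s * x)) integrable_on {0..1}" by (rule integrable_continuous_interval)
    then have "integral {0..1} (\<lambda>s. v k (s * x)) = 1 - integral {0..1} (\<lambda>s. ?J (s * x))"
      unfolding v_def by (subst Henstock_Kurzweil_Integration.integral_diff) auto
    also have "\<dots> = 1 - x * integral {0..1} (\<lambda>s. (1 - s) * h k (s * x))"
      using mean_value_integral_twice[OF conth1[OF that(1)] _ _ that(2)] by simp
    also have "\<dots> = G k x" using G[of k x] that unfolding h_def by auto
    finally show ?thesis by simp
  qed
  have dv: "(v k has_real_derivative - h k x) (at x)" if "k \<ge> 1" "x \<in> {?a<..<?b}" for k x
    using DERIV_diff[OF DERIV_const[of 1] DERIV_mean_value_integral[OF conth1[OF that(1)] _ _ that(2)]]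
    unfolding v_def by simp
  have dw: "((\<lambda>x. x * G k x) has_real_derivative v k x) (at x)" if "k \<ge> 1" "x \<in> {?a<..<?b}" for k x
    by (rule has_field_derivative_transform_within_open[where S="{?a<..<?b}",
          OF DERIV_mean_value_integral[OF contv1[OF that(1)] _ _ that(2)]])
      (use that G_mean in auto)
  have prof: "profile_ode lam q k N \<Phi> (G k) (v k)" if "k \<ge> 1" for k
  proof
    show "continuous_on {0..1} (G k)" by (rule continuous_on_subset[OF contG1[OF that]]) auto
    show "v k 0 = 1" by (simp add: v_def)
    show "((\<lambda>x. x * G k x) has_real_derivative v k x) (at x)" if "x \<in> {0..1}" for x
      by (rule dw) (use that \<open>k \<ge> 1\<close> in auto)
    show "(v k has_real_derivative - (lam * G k x / (2 - x) + k * N (x * G k x))) (at x)" if "x \<in> {0..1}" for x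
      using dv[of k x] that \<open>k \<ge> 1\<close> by (simp add: h_def H_def)
  qed (use lam q that N_eq contN Phi in auto)
  define S where "S k = profile_ode.angular_speed lam q k N (G k) (v k)" for k
  define \<theta> where "\<theta> k = integral {0..1} (S k)" for k
  have cont\<theta>: "continuous_on {1..K} \<theta>" for K
  proof -
    let ?Q = "{1..K} \<times> {0..1::real}"
    have sub: "continuous_on ?Q (\<lambda>z. G (fst z) (snd z))" "continuous_on ?Q (\<lambda>z. v (fst z) (snd z))"
      using contG[of "{1..K}"] contv[of "{1..K}"]
      by (auto simp: case_prod_unfold elim!: continuous_on_subset)
    define A where "A k = k powr (1 / (q + 1))" for k
    have Seq: "S k x = A k * ((v k x)\<^sup>2 + lam * (x * G k x * G k x / (2 - x)) + k * (N (x * G k x) * (x * G k x)))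
        / ((A k)\<^sup>2 * (x * G k x)\<^sup>2 + (v k x)\<^sup>2)"
      and pos: "(A k)\<^sup>2 * (x * G k x)\<^sup>2 + (v k x)\<^sup>2 \<noteq> 0" if "k \<ge> 1" "x \<in> {0..1}" for k x
      using profile_ode.angular_speed_def[OF prof[OF that(1)]] profile_ode.R2_def[OF prof[OF that(1)]]
        profile_ode.w_def[OF prof[OF that(1)]] profile_ode.A_def[OF prof[OF that(1)]]
        profile_ode.R2_pos[OF prof[OF that(1)] that(2)]
      by (simp_all add: S_def A_def)
    have "continuous_on ?Q (\<lambda>z. A (fst z) * ((v (fst z) (snd z))\<^sup>2 + lam * (snd z * G (fst z) (snd z) * G (fst z) (snd z) / (2 - snd z))
        + fst z * (N (snd z * G (fst z) (snd z)) * (snd z * G (fst z) (snd z))))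
        / ((A (fst z))\<^sup>2 * (snd z * G (fst z) (snd z))\<^sup>2 + (v (fst z) (snd z))\<^sup>2))"
      unfolding A_def
      by (intro continuous_intros sub continuous_on_compose2[OF contN])
        (use pos in \<open>auto simp: A_def\<close>)
    then have "continuous_on ?Q (\<lambda>(k, x). S k x)"
      by (rule continuous_on_cong[THEN iffD1, rotated 2]) (use Seq in auto)
    then have "continuous_on ({1..K} \<times> cbox 0 1) (\<lambda>(k, x). S k x)" by simp
    from integral_continuous_on_param[OF this] show ?thesis unfolding \<theta>_def by simp
  qed
  \<comment> \<open>\<open>e0\<close> involves \<open>lam\<close> only, so one constant serves all
    parameters and the total angle is at least \<open>c * k powr (1 / (q + 1))\<close>.\<close>
  define c where "c = 2 * profile_ode.e0 lam / ((q + 1)\<^sup>2 + 1)"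
  have c: "c > 0"
    using profile_ode.e0[OF prof[of 1]] by (auto simp: c_def intro!: divide_pos_pos add_nonneg_pos)
  have \<theta>_ge: "\<theta> k \<ge> c * k powr (1 / (q + 1))" if "k \<ge> 1" for k
    using profile_ode.total_angle_ge[OF prof[OF that]] profile_ode.A_def[OF prof[OF that]]
    by (simp add: \<theta>_def S_def c_def)
  \<comment> \<open>Any multiple of pi above the angle at k = 1 will do. \<open>K\<close> is taken
    so large that the lower bound passes it, and the intermediate value theorem applies on
    [1, K].\<close>
  obtain n :: nat where n: "\<theta> 1 \<le> real n * pi"
    using ex_less_of_nat_mult[OF pi_gt_zero, of "\<theta> 1"] less_imp_le by blast
  define K where "K = max 1 ((real n * pi / c) powr (q + 1))"
  have "real n * pi / c = ((real n * pi / c) powr (q + 1)) powr (1 / (q + 1))"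
    using q c by (simp add: powr_powr)
  also have "\<dots> \<le> K powr (1 / (q + 1))" using q by (intro powr_mono2) (auto simp: K_def)
  finally have "real n * pi \<le> c * K powr (1 / (q + 1))" using c by (simp add: field_simps)
  also have "\<dots> \<le> \<theta> K" by (rule \<theta>_ge) (simp add: K_def)
  finally have "\<exists>k\<ge>1. k \<le> K \<and> \<theta> k = real n * pi"
    using IVT'[of \<theta> 1 "real n * pi" K] n cont\<theta> by (auto simp: K_def)
  then obtain k where hk: "k \<ge> 1" "\<theta> k = real n * pi" by blast
  interpret pk: profile_ode lam q k N \<Phi> "G k" "v k" by (rule prof[OF hk(1)])
  have G1: "G k 1 = 0" by (rule pk.zero_if_angle_multiple_of_pi) (use hk(2) in \<open>simp add: \<theta>_def S_def\<close>)
  \<comment> \<open>The weighted mean of v' = -h, from differentiating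
    \<open>G_mean\<close>.\<close>
  define G' where "G' x = integral {0..1} (\<lambda>s. s ^ 1 * - h k (s * x))" for x
  have dG: "(G k has_real_derivative G' x) (at x)" if x: "x \<in> {?a<..<?b}" for x
  proof -
    have "((\<lambda>x. integral {0..1} (\<lambda>s. s ^ 0 * v k (s * x))) has_real_derivative
        integral {0..1} (\<lambda>s. s ^ Suc 0 * - h k (s * x))) (at x)"
      by (rule DERIV_weighted_mean_integral[OF dv[OF hk(1)] _ _ _ x])
        (auto intro!: continuous_on_minus continuous_on_subset[OF conth1[OF hk(1)]])
    then have "((\<lambda>x. integral {0..1} (\<lambda>s. v k (s * x))) has_real_derivative G' x) (at x)"
      by (simp add: G'_def)
    then show ?thesis
      by (rule has_field_derivative_transform_within_open[where S="{?a<..<?b}"])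
        (use x G_mean[OF hk(1)] in auto)
  qed
  define h' where "h' x = lam * (G' x * (2 - x) + G k x) / (2 - x)\<^sup>2 + k * (N' (x * G k x) * v k x)" for x
  have dh: "((\<lambda>x. - h k x) has_real_derivative - h' x) (at x)" if x: "x \<in> {?a<..<?b}" for x
  proof -
    have "((\<lambda>x. lam * (G k x / (2 - x))) has_real_derivative
        lam * ((G' x * (2 - x) - G k x * - 1) / ((2 - x) * (2 - x)))) (at x)"
      using x by (auto intro!: derivative_eq_intros dG simp: algebra_simps)
    moreover have "((\<lambda>x. k * N (x * G k x)) has_real_derivative k * (N' (x * G k x) * v k x)) (at x)"
      by (intro DERIV_cmult DERIV_chain2[OF N dw[OF hk(1) x]])
    ultimately have "((\<lambda>x. - (lam * (G k x / (2 - x)) + k * N (x * G k x))) has_real_derivative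
        - (lam * ((G' x * (2 - x) - G k x * - 1) / ((2 - x) * (2 - x))) + k * (N' (x * G k x) * v k x))) (at x)"
      by (intro DERIV_minus DERIV_add)
    then show ?thesis by (simp add: h_def H_def h'_def power2_eq_square)
  qed
  have mean_cont: "continuous_on {?a<..<?b} (\<lambda>x. integral {0..1} (\<lambda>s. s ^ n * f (s * x)))"
    if "continuous_on {?a<..<?b} f" for f :: "real \<Rightarrow> real" and n
  proof -
    have "continuous_on ({0::real} \<times> {?a<..<?b}) (\<lambda>(k, x). f x)"
      unfolding case_prod_beta by (intro continuous_on_compose2[OF that] continuous_intros) auto
    from continuous_on_integral_scaled[OF this, of n] scaled_in_interval[of _ _ ?a ?b]
    have 1: "continuous_on ({0::real} \<times> {?a<..<?b}) (\<lambda>z. integral {0..1} (\<lambda>s. s ^ n * f (s * snd z)))" by simp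
    have "continuous_on {?a<..<?b} (\<lambda>x. (0::real, x))" by (intro continuous_intros)
    from continuous_on_compose2[OF 1 this] show ?thesis by force
  qed
  have ch: "continuous_on {?a<..<?b} (\<lambda>x. - h k x)"
    using dh DERIV_isCont by (blast intro: continuous_at_imp_continuous_on)
  have cG': "continuous_on {?a<..<?b} G'" unfolding G'_def by (rule mean_cont[OF ch])
  have ch': "continuous_on {?a<..<?b} (\<lambda>x. - h' x)"
    unfolding h'_def
    by (intro continuous_intros cG' continuous_on_compose2[OF contN'] continuous_on_subset[OF contG1[OF hk(1)]]
        continuous_on_subset[OF contv1[OF hk(1)]]) auto
  define G'' where "G'' x = integral {0..1} (\<lambda>s. s ^ 2 * - h' (s * x))" for x
  have dG': "(G' has_real_derivative G'' x) (at x)" if x: "x \<in> {?a<..<?b}" for x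
    using DERIV_weighted_mean_integral[OF dh ch' _ _ x, of 1]
    unfolding G'_def[abs_def] G''_def by (simp add: numeral_2_eq_2)
  have cG'': "continuous_on {?a<..<?b} G''" unfolding G''_def by (rule mean_cont[OF ch'])
  show thesis
  proof (rule that[of k "G k" G' G'' "h k" h'])
    show "G k 0 = 1" using G[of k 0] hk(1) by simp
    show "h k x = lam * G k x / (2 - x) + k * (\<bar>x * G k x\<bar> powr (q - 1) * (x * G k x))"
      if x: "x \<in> {0..1}" for x
      using N_eq[of "x * G k x"] pk.w_le_1[OF x] by (simp add: h_def H_def pk.w_def)
    show "(h k has_real_derivative h' x) (at x)" if "x \<in> {?a<..<?b}" for x
      using DERIV_minus[OF dh[OF that]] by simp
    show "continuous_on {?a<..<?b} h'" using continuous_on_minus[OF ch'] by simp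
    fix x :: real assume x': "x \<in> {?a<..<?b}"
    have veq: "v k y = G k y + y * G' y" if "y \<in> {?a<..<?b}" for y
      using DERIV_unique[OF dw[OF hk(1) that] DERIV_mult[OF DERIV_ident dG[OF that]]] by simp
    have "((\<lambda>y. G k y + y * G' y) has_real_derivative G' x + (1 * G' x + G'' x * x)) (at x)"
      by (intro DERIV_add DERIV_mult DERIV_ident dG dG' x')
    then have "(v k has_real_derivative G' x + (1 * G' x + G'' x * x)) (at x)"
      by (rule has_field_derivative_transform_within_open[where S="{?a<..<?b}"]) (use x' veq in auto)
    from DERIV_unique[OF this dv[OF hk(1) x']]
    show "x * G'' x + 2 * G' x = - h k x" by (simp add: mult.commute)
  qed (use hk dG dG' cG'' G1 in auto)
qed

section \<open>The flow without swirl\<close>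

lemma abs_component_div_norm_le_1: "\<bar>(x::real^3) $ i / norm x\<bar> \<le> 1"
  using component_le_norm_cart[of x i] by (cases "x = 0") (auto simp: divide_le_eq)

lemma C_k_on_norm: "C_k_on k (- {0}) (norm :: 'a::real_inner \<Rightarrow> real)"
proof -
  have op: "open (- {0::'a})" by auto
  have "C_k_on k (- {0}) (\<lambda>x::'a. x \<bullet> x)" by (intro C_k_on_inner C_k_on_id op)
  then have "C_k_on k (- {0}) (\<lambda>x::'a. (x \<bullet> x) powr (1 / 2))"
    by (intro C_k_on_compose_real[OF op open_greaterThan _ _ C_k_on_powr]) auto
  moreover have "(\<lambda>x::'a. (x \<bullet> x) powr (1 / 2)) = norm"
    by (simp add: fun_eq_iff powr_half_sqrt norm_eq_sqrt_inner)
  ultimately show ?thesis by simp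
qed

definition zonal :: "real \<Rightarrow> (real \<Rightarrow> real) \<Rightarrow> real^3 \<Rightarrow> real" where
  "zonal a \<phi> x = norm x powr a * \<phi> (x $ 3 / norm x)"

text \<open>On the axis the cosine x_3/|x| equals 1 or -1, so regularity across the axis needs the
  profile on a neighbourhood of [-1, 1]. This is why all profiles live on a larger interval.\<close>

lemma C_k_on_zonal:
  assumes "C_k_on k {-c<..<c} \<phi>" "c > 1"
  shows "C_k_on k (- {0}) (zonal a \<phi>)"
proof -
  have op: "open (- {0::real^3})" by auto
  have p: "C_k_on k (- {0}) (\<lambda>x::real^3. norm x powr b)" for b
    by (rule C_k_on_compose_real[OF op open_greaterThan _ C_k_on_norm C_k_on_powr]) auto
  have "C_k_on k (- {0}) (\<lambda>x::real^3. x $ 3 * norm x powr (- 1))"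
    by (intro C_k_on_mult op C_k_on_nth p)
  then have s: "C_k_on k (- {0}) (\<lambda>x::real^3. x $ 3 / norm x)"
    by (rule C_k_on_cong[THEN iffD1, OF op, rotated]) (auto simp: powr_minus_divide)
  have "(\<lambda>x::real^3. x $ 3 / norm x) ` (- {0}) \<subseteq> {-c<..<c}"
  proof (rule image_subsetI)
    fix x :: "real^3"
    show "x $ 3 / norm x \<in> {-c<..<c}"
      using abs_component_div_norm_le_1[of x 3] assms(2) unfolding greaterThanLessThan_iff by linarith
  qed
  from C_k_on_compose_real[OF op open_greaterThanLessThan this s assms(1)]
  show ?thesis unfolding zonal_def[abs_def] by (intro C_k_on_mult op p)
qed

lemma has_derivative_zonal:
  assumes x: "x \<noteq> 0" and \<phi>: "(\<phi> has_real_derivative d) (at (x $ 3 / norm x))"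
  shows "(zonal a \<phi> has_derivative (\<lambda>v. norm x powr (a - 2) *
    ((a * \<phi> (x $ 3 / norm x) - d * (x $ 3 / norm x)) * (x \<bullet> v) + norm x * d * v $ 3))) (at x)"
proof -
  let ?\<rho> = "norm x" and ?s = "x $ 3 / norm x"
  have \<rho>: "?\<rho> > 0" using x by simp
  have n: "(norm has_derivative (\<lambda>v. (x \<bullet> v) / ?\<rho>)) (at x)"
    using has_derivative_norm[OF x] by (simp add: sgn_div_norm inner_commute divide_inverse mult.commute)
  have p: "((\<lambda>x. norm x powr a) has_derivative (\<lambda>v. a * ?\<rho> powr (a - 1) * ((x \<bullet> v) / ?\<rho>))) (at x)"
    using has_derivative_compose[OF n has_real_derivative_powr[OF \<rho>, of a, unfolded has_field_derivative_def]] .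
  have l: "((\<lambda>x::real^3. x $ 3) has_derivative (\<lambda>v. v $ 3)) (at x)"
    by (rule bounded_linear_imp_has_derivative) (rule bounded_linear_vec_nth)
  have s: "((\<lambda>x. x $ 3 / norm x) has_derivative (\<lambda>v. (v $ 3 * ?\<rho> - x $ 3 * ((x \<bullet> v) / ?\<rho>)) / (?\<rho> * ?\<rho>))) (at x)"
    using has_derivative_divide'[OF l n] x by simp
  have c: "((\<lambda>x. \<phi> (x $ 3 / norm x)) has_derivative (\<lambda>v. d * ((v $ 3 * ?\<rho> - x $ 3 * ((x \<bullet> v) / ?\<rho>)) / (?\<rho> * ?\<rho>)))) (at x)"
    using has_derivative_compose[OF s \<phi>[unfolded has_field_derivative_def]] .
  have "(zonal a \<phi> has_derivative (\<lambda>v. ?\<rho> powr a * (d * ((v $ 3 * ?\<rho> - x $ 3 * ((x \<bullet> v) / ?\<rho>)) / (?\<rho> * ?\<rho>)))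
      + a * ?\<rho> powr (a - 1) * ((x \<bullet> v) / ?\<rho>) * \<phi> ?s)) (at x)"
    unfolding zonal_def[abs_def] by (rule has_derivative_mult[OF p c])
  moreover have "?\<rho> powr a * (d * ((v $ 3 * ?\<rho> - x $ 3 * ((x \<bullet> v) / ?\<rho>)) / (?\<rho> * ?\<rho>)))
      + a * ?\<rho> powr (a - 1) * ((x \<bullet> v) / ?\<rho>) * \<phi> ?s
      = ?\<rho> powr (a - 2) * ((a * \<phi> ?s - d * ?s) * (x \<bullet> v) + ?\<rho> * d * v $ 3)" for v
  proof -
    have "?\<rho> powr a = ?\<rho> powr (a - 2) * ?\<rho>\<^sup>2" "?\<rho> powr (a - 1) = ?\<rho> powr (a - 2) * ?\<rho>"
      using powr_add[of ?\<rho> "a - 2" 2] powr_add[of ?\<rho> "a - 2" 1] \<rho> by simp_all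
    then show ?thesis using \<rho>
      by (simp add: field_simps power2_eq_square)
  qed
  ultimately show ?thesis by simp
qed

lemma zonal_scaleR:
  assumes "l > 0"
  shows "zonal a \<phi> (l *\<^sub>R x) = l powr a * zonal a \<phi> x"
  using assms by (simp add: zonal_def powr_mult)

section \<open>Reflection at the equator\<close>

lemma DERIV_if_ge:
  fixes f g :: "real \<Rightarrow> real"
  assumes "(f has_real_derivative D) (at a)" "(g has_real_derivative D) (at a)" "f a = g a"
  shows "((\<lambda>x. if x \<ge> a then f x else g x) has_real_derivative D) (at a)"
proof -
  let ?F = "\<lambda>x. if x \<ge> a then f x else g x"
  have "((\<lambda>h. (?F (a + h) - ?F a) / h) \<longlongrightarrow> D) (at 0)"
  proof (rule filterlim_split_at)
    have "((\<lambda>h. (g (a + h) - g a) / h) \<longlongrightarrow> D) (at_left 0)"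
      using assms(2) unfolding DERIV_def by (rule tendsto_mono[OF at_le, rotated]) simp
    then show "((\<lambda>h. (?F (a + h) - ?F a) / h) \<longlongrightarrow> D) (at_left 0)"
      by (rule Lim_transform_eventually)
        (use assms(3) in \<open>auto simp: eventually_at_left_field intro!: exI[of _ "-1"]\<close>)
    have "((\<lambda>h. (f (a + h) - f a) / h) \<longlongrightarrow> D) (at_right 0)"
      using assms(1) unfolding DERIV_def by (rule tendsto_mono[OF at_le, rotated]) simp
    then show "((\<lambda>h. (?F (a + h) - ?F a) / h) \<longlongrightarrow> D) (at_right 0)"
      by (rule Lim_transform_eventually)
        (auto simp: eventually_at_right_field intro!: exI[of _ 1])
  qed
  then show ?thesis by (simp add: DERIV_def)
qed

definition odd_ext :: "(real \<Rightarrow> real) \<Rightarrow> real \<Rightarrow> real" where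
  "odd_ext f s = (if s \<ge> 0 then f s else - f (- s))"

definition even_ext :: "(real \<Rightarrow> real) \<Rightarrow> real \<Rightarrow> real" where
  "even_ext f s = (if s \<ge> 0 then f s else f (- s))"

lemma DERIV_odd_ext:
  assumes f: "\<And>s. s \<in> {-a<..<b} \<Longrightarrow> (f has_real_derivative f' s) (at s)"
    and "f 0 = 0" "a > 0" "s \<in> {-b<..<b}"
  shows "(odd_ext f has_real_derivative even_ext f' s) (at s)"
proof -
  have r: "((\<lambda>s. - f (- s)) has_real_derivative f' (- s)) (at s)" if "- s \<in> {-a<..<b}" for s
    using DERIV_minus[OF DERIV_chain2[OF f[OF that] DERIV_minus[OF DERIV_ident]]] by simp
  consider "s > 0" | "s < 0" | "s = 0" by linarith
  then show ?thesis
  proof cases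
    case 1
    have "(f has_real_derivative even_ext f' s) (at s)"
      using f[of s] 1 assms by (simp add: even_ext_def)
    then show ?thesis
      by (rule has_field_derivative_transform_within_open[where S="{0<..}"])
        (use 1 in \<open>auto simp: odd_ext_def\<close>)
  next
    case 2
    have "((\<lambda>s. - f (- s)) has_real_derivative even_ext f' s) (at s)"
      using r[of s] 2 assms by (simp add: even_ext_def)
    then show ?thesis
      by (rule has_field_derivative_transform_within_open[where S="{..<0}"])
        (use 2 in \<open>auto simp: odd_ext_def\<close>)
  next
    case 3
    have "((\<lambda>x. if x \<ge> 0 then f x else - f (- x)) has_real_derivative f' 0) (at 0)"
      by (rule DERIV_if_ge) (use f[of 0] r[of 0] assms 3 in auto)
    then show ?thesis using 3 by (simp add: odd_ext_def[abs_def] even_ext_def)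
  qed
qed

text \<open>The two halves meet with slopes \<open>f' 0\<close> and \<open>- f' 0\<close>, so the
  slope must vanish; for an odd extension the slopes agree and only the values have to
  match.\<close>

lemma DERIV_even_ext:
  assumes f: "\<And>s. s \<in> {-a<..<b} \<Longrightarrow> (f has_real_derivative f' s) (at s)"
    and "f' 0 = 0" "a > 0" "s \<in> {-b<..<b}"
  shows "(even_ext f has_real_derivative odd_ext f' s) (at s)"
proof -
  have r: "((\<lambda>s. f (- s)) has_real_derivative - f' (- s)) (at s)" if "- s \<in> {-a<..<b}" for s
    using DERIV_chain2[OF f[OF that] DERIV_minus[OF DERIV_ident]] by simp
  consider "s > 0" | "s < 0" | "s = 0" by linarith
  then show ?thesis
  proof cases
    case 1
    have "(f has_real_derivative odd_ext f' s) (at s)"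
      using f[of s] 1 assms by (simp add: odd_ext_def)
    then show ?thesis
      by (rule has_field_derivative_transform_within_open[where S="{0<..}"])
        (use 1 in \<open>auto simp: even_ext_def\<close>)
  next
    case 2
    have "((\<lambda>s. f (- s)) has_real_derivative odd_ext f' s) (at s)"
      using r[of s] 2 assms by (simp add: odd_ext_def)
    then show ?thesis
      by (rule has_field_derivative_transform_within_open[where S="{..<0}"])
        (use 2 in \<open>auto simp: even_ext_def\<close>)
  next
    case 3
    have "((\<lambda>x. if x \<ge> 0 then f x else f (- x)) has_real_derivative f' 0) (at 0)"
      by (rule DERIV_if_ge) (use f[of 0] r[of 0] assms 3 in auto)
    then show ?thesis using 3 by (simp add: even_ext_def[abs_def] odd_ext_def)
  qed
qed

lemma continuous_on_even_ext:
  assumes "continuous_on {-a<..<b} f" "a > 0" "b > 0"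
  shows "continuous_on {-b<..<b} (even_ext f)"
proof -
  have "even_ext f = (\<lambda>s. f \<bar>s\<bar>)" by (auto simp: even_ext_def fun_eq_iff)
  then show ?thesis
    using assms by (auto intro!: continuous_on_compose2[OF assms(1)] continuous_intros)
qed

lemma continuous_on_odd_ext:
  assumes c: "continuous_on {-a<..<b} f" and "a > 0" "b > 0" "f 0 = 0"
  shows "continuous_on {-b<..<b} (odd_ext f)"
proof -
  have "odd_ext f = (\<lambda>s. f (max s 0) - f (max (- s) 0))"
    using assms(4) by (auto simp: odd_ext_def fun_eq_iff max_def)
  then show ?thesis
    using assms by (auto intro!: continuous_on_compose2[OF c] continuous_intros)
qed

text \<open>In terms of the stream profile, g = w / (1 - sigma^2), which is
  \<open>G (1 - s) / (1 + s)\<close> on the upper half. The left side of the equation is the second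
  derivative of (1 - sigma^2) g. Outside [-1, 1] the nonlinearity is the truncated one, so
  \<open>h\<close> is described there only as a continuously differentiable function.\<close>

lemma exists_odd_profile:
  fixes lam q :: real
  assumes lam: "lam > 0" and q: "q > 1"
  obtains k :: real and g g' g'' h h' :: "real \<Rightarrow> real"
  where "k \<ge> 1"
    "\<And>s. s \<in> {-3/2<..<3/2} \<Longrightarrow> (g has_real_derivative g' s) (at s)"
    "\<And>s. s \<in> {-3/2<..<3/2} \<Longrightarrow> (g' has_real_derivative g'' s) (at s)"
    "continuous_on {-3/2<..<3/2} g''"
    "\<And>s. s \<in> {-3/2<..<3/2} \<Longrightarrow> (h has_real_derivative h' s) (at s)"
    "continuous_on {-3/2<..<3/2} h'"
    "\<And>s. s \<in> {-3/2<..<3/2} \<Longrightarrow> (1 - s\<^sup>2) * g'' s - 4 * s * g' s - 2 * g s = - h s"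
    "\<And>s. s \<in> {-1..1} \<Longrightarrow>
      h s = lam * g s + k * (\<bar>(1 - s\<^sup>2) * g s\<bar> powr (q - 1) * ((1 - s\<^sup>2) * g s))"
    "g 1 > 0"
proof -
  obtain k and G G' G'' H H' :: "real \<Rightarrow> real" where k: "k \<ge> 1"
    and G: "\<And>x. x \<in> {-1/2<..<3/2} \<Longrightarrow> (G has_real_derivative G' x) (at x)"
    and G': "\<And>x. x \<in> {-1/2<..<3/2} \<Longrightarrow> (G' has_real_derivative G'' x) (at x)"
    and cG'': "continuous_on {-1/2<..<3/2} G''" and G01: "G 0 = 1" "G 1 = 0"
    and H: "\<And>x. x \<in> {-1/2<..<3/2} \<Longrightarrow> (H has_real_derivative H' x) (at x)"
    and cH': "continuous_on {-1/2<..<3/2} H'"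
    and ode: "\<And>x. x \<in> {-1/2<..<3/2} \<Longrightarrow> x * G'' x + 2 * G' x = - H x"
    and Heq: "\<And>x. x \<in> {0..1} \<Longrightarrow> H x = lam * G x / (2 - x) + k * (\<bar>x * G x\<bar> powr (q - 1) * (x * G x))"
    by (rule exists_profile[OF lam q]) blast
  let ?I = "{-(1/2)<..<3/2} :: real set"
  have fl: "1 - s \<in> {-1/2<..<3/2}" if "s \<in> ?I" for s :: real using that by auto
  define g0 where "g0 s = G (1 - s) / (1 + s)" for s
  define g1 where "g1 s = - (G' (1 - s)) / (1 + s) - G (1 - s) / (1 + s)\<^sup>2" for s
  define g2 where "g2 s = G'' (1 - s) / (1 + s) + 2 * G' (1 - s) / (1 + s)\<^sup>2 + 2 * G (1 - s) / (1 + s) ^ 3" for s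
  have dfl: "((\<lambda>s. F (1 - s)) has_real_derivative - F' (1 - s)) (at s)"
    if "\<And>x. x \<in> {-1/2<..<3/2} \<Longrightarrow> (F has_real_derivative F' x) (at x)" "s \<in> ?I" for F F' :: "real \<Rightarrow> real" and s
  proof -
    have "((\<lambda>s. F (1 - s)) has_real_derivative F' (1 - s) * -1) (at s)"
      by (rule DERIV_chain2[where f=F and g="\<lambda>s. 1 - s", OF that(1)[OF fl[OF that(2)]]])
        (auto intro!: derivative_eq_intros)
    then show ?thesis by simp
  qed
  have d0: "(g0 has_real_derivative g1 s) (at s)" if s: "s \<in> ?I" for s
  proof -
    have "1 + s \<noteq> 0" using s by auto
    then show ?thesis unfolding g0_def g1_def
      by (auto intro!: derivative_eq_intros dfl[OF G s]) (simp add: divide_simps power2_eq_square)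
  qed
  have d1: "(g1 has_real_derivative g2 s) (at s)" if s: "s \<in> ?I" for s
  proof -
    have "1 + s \<noteq> 0" using s by auto
    then show ?thesis unfolding g1_def g2_def
      by (auto intro!: derivative_eq_intros dfl[OF G s] dfl[OF G' s])
        (simp add: divide_simps, simp add: eval_nat_numeral algebra_simps)
  qed
  have cont_flip: "continuous_on ?I (\<lambda>s. F (1 - s))" if "continuous_on {-1/2<..<3/2} F" for F :: "real \<Rightarrow> real"
    by (intro continuous_on_compose2[OF that] continuous_intros) auto
  have cG: "continuous_on {-1/2<..<3/2} G" "continuous_on {-1/2<..<3/2} G'"
    using G G' DERIV_isCont by (blast intro: continuous_at_imp_continuous_on)+
  have c2: "continuous_on ?I g2"
    unfolding g2_def by (intro continuous_intros cont_flip cG cG'') auto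
  have ode0: "(1 - s\<^sup>2) * g2 s - 4 * s * g1 s - 2 * g0 s = - H (1 - s)" if s: "s \<in> ?I" for s
  proof -
    have nz: "1 + s \<noteq> 0" using s by auto
    define c where "c = 1 / (1 + s)"
    have c: "(1 + s) * c = 1" using nz by (simp add: c_def)
    have e: "g0 s = G (1 - s) * c" "g1 s = - (G' (1 - s) * c) - G (1 - s) * c\<^sup>2"
      "g2 s = G'' (1 - s) * c + 2 * G' (1 - s) * c\<^sup>2 + 2 * G (1 - s) * c ^ 3"
      by (simp_all add: g0_def g1_def g2_def c_def power_divide)
    have "(1 - s\<^sup>2) * g2 s - 4 * s * g1 s - 2 * g0 s = (1 - s) * G'' (1 - s) + 2 * G' (1 - s)"
      unfolding e using c by algebra
    then show ?thesis using ode[OF fl[OF s]] by simp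
  qed
  have H1: "H 1 = 0" using Heq[of 1] G01 by simp
  \<comment> \<open>The matching conditions for an odd extension with two continuous derivatives:
    the shooting condition gives the first, and the equation at 0 gives the second.\<close>
  have z: "g0 0 = 0" "g2 0 = 0" using ode0[of 0] H1 G01 by (simp_all add: g0_def)
  let ?h0 = "\<lambda>s. H (1 - s)" and ?h1 = "\<lambda>s. - H' (1 - s)"
  have I': "{- 3/2<..<3/2::real} = {-(3/2)<..<3/2}" by simp
  show thesis
  proof (rule that[of k "odd_ext g0" "even_ext g1" "odd_ext g2" "odd_ext ?h0" "even_ext ?h1"])
    show "(odd_ext g0 has_real_derivative even_ext g1 s) (at s)" if "s \<in> {-3/2<..<3/2}" for s
      by (rule DERIV_odd_ext[OF d0]) (use that z in auto)
    show "(even_ext g1 has_real_derivative odd_ext g2 s) (at s)" if "s \<in> {-3/2<..<3/2}" for s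
      by (rule DERIV_even_ext[OF d1]) (use that z in auto)
    show "continuous_on {-3/2<..<3/2} (odd_ext g2)"
      unfolding I' by (rule continuous_on_odd_ext[OF c2]) (use z in auto)
    show "(odd_ext ?h0 has_real_derivative even_ext ?h1 s) (at s)" if "s \<in> {-3/2<..<3/2}" for s
      by (rule DERIV_odd_ext[OF dfl[OF H]]) (use that H1 in auto)
    show "continuous_on {-3/2<..<3/2} (even_ext ?h1)"
      unfolding I' by (rule continuous_on_even_ext[of "1/2"]) (intro continuous_intros cont_flip cH', auto)
    show "(1 - s\<^sup>2) * odd_ext g2 s - 4 * s * even_ext g1 s - 2 * odd_ext g0 s = - odd_ext ?h0 s"
      if "s \<in> {-3/2<..<3/2}" for s
    proof (cases "s \<ge> 0")
      case True
      then show ?thesis using ode0[of s] that by (simp add: odd_ext_def even_ext_def)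
    next
      case False
      then have "(1 - s\<^sup>2) * g2 (- s) + 4 * s * g1 (- s) - 2 * g0 (- s) = - H (1 + s)"
        using ode0[of "- s"] that by simp
      then show ?thesis using False by (simp add: odd_ext_def even_ext_def)
    qed
    have Heq': "H (1 - s) = lam * g0 s + k * (\<bar>(1 - s\<^sup>2) * g0 s\<bar> powr (q - 1) * ((1 - s\<^sup>2) * g0 s))"
      if "s \<in> {0..1}" for s
    proof -
      have "(1 - s\<^sup>2) * g0 s = (1 - s) * G (1 - s)"
        using that by (simp add: g0_def field_simps power2_eq_square)
      then show ?thesis using Heq[of "1 - s"] that by (simp add: g0_def)
    qed
    show "odd_ext ?h0 s = lam * odd_ext g0 s +
        k * (\<bar>(1 - s\<^sup>2) * odd_ext g0 s\<bar> powr (q - 1) * ((1 - s\<^sup>2) * odd_ext g0 s))" if "s \<in> {-1..1}" for s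
      using Heq'[of s] Heq'[of "- s"] that by (simp add: odd_ext_def)
    show "odd_ext g0 1 > 0" using G01 by (simp add: odd_ext_def g0_def)
  qed (rule k)
qed

section \<open>The Euler flow generated by the profile\<close>

lemma C_k_on_2_abs_powr:
  assumes "q > 1"
  shows "C_k_on 2 UNIV (\<lambda>t::real. \<bar>t\<bar> powr (q + 1))"
proof -
  have "C_k_on (Suc (Suc 0)) UNIV (\<lambda>t::real. \<bar>t\<bar> powr (q + 1))"
  proof (rule C_k_on_realI[OF open_UNIV])
    show "((\<lambda>t. \<bar>t\<bar> powr (q + 1)) has_real_derivative (q + 1) * (\<bar>t\<bar> powr (q - 1) * t)) (at t)" for t :: real
      using DERIV_abs_powr[of "q + 1" t] assms by (simp add: algebra_simps)
    have "((\<lambda>t. \<bar>t\<bar> powr (q - 1) * t) has_real_derivative q * \<bar>t\<bar> powr (q - 1)) (at t)" for t :: real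
      using DERIV_abs_powr_mult[of "q - 1" t] assms by simp
    moreover have "C_k_on 0 UNIV (\<lambda>t::real. q * \<bar>t\<bar> powr (q - 1))"
      using assms by (auto intro!: continuous_intros continuous_on_powr')
    ultimately show "C_k_on (Suc 0) UNIV (\<lambda>t. (q + 1) * (\<bar>t\<bar> powr (q - 1) * t))"
      by (intro C_k_on_cmult C_k_on_realI[where f="\<lambda>t. \<bar>t\<bar> powr (q - 1) * t"] open_UNIV) auto
  qed
  then show ?thesis by (simp only: numeral_2_eq_2)
qed

lemma norm_cylindrical: "norm (vector [rad x, 0, x $ 3] :: real^3) = norm x"
  by (simp add: norm_vec_def L2_set_def sum_3 rad_def)

text \<open>For an axisymmetric flow without swirl the Euler equations reduce to one relation: the
  vorticity divided by r equals minus the derivative of the Bernoulli function with respect to the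
  stream function. For homogeneous data this is the profile equation.\<close>

lemma ex_swirl_free_solution:
  fixes \<alpha> :: real
  assumes "\<alpha> > 2"
  shows "\<exists>u p. rot_axi_hom_solution_punctured 1 \<alpha> u p \<and>
               \<not> bernoulli u p constant_on (- {0}) \<and>
               C_k_on 2 (- {0}) (poloidal u) \<and> C_k_on 2 (- {0}) p \<and>
               C_k_on 1 (- {0}) (toroidal u)"
proof -
  define \<beta> where "\<beta> = \<alpha> - 2"
  define lam where "lam = \<beta> * (\<beta> + 1)"
  \<comment> \<open>Scaling: a multiple of |psi|^(q+1) has degree -2\<alpha> for psi of degree
    -\<beta> iff \<beta> (q + 1) = 2\<alpha>.\<close>
  define q where "q = 1 + 4 / \<beta>"
  have \<beta>: "\<beta> > 0" using assms by (simp add: \<beta>_def)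
  have lam: "lam > 0" and q: "q > 1" using \<beta> by (simp_all add: lam_def q_def)
  obtain k and g g' g'' n n' :: "real \<Rightarrow> real" where k: "k \<ge> 1"
    and g: "\<And>s. s \<in> {-3/2<..<3/2} \<Longrightarrow> (g has_real_derivative g' s) (at s)"
    and g': "\<And>s. s \<in> {-3/2<..<3/2} \<Longrightarrow> (g' has_real_derivative g'' s) (at s)"
    and cg'': "continuous_on {-3/2<..<3/2} g''"
    and n: "\<And>s. s \<in> {-3/2<..<3/2} \<Longrightarrow> (n has_real_derivative n' s) (at s)"
    and cn': "continuous_on {-3/2<..<3/2} n'"
    and ode: "\<And>s. s \<in> {-3/2<..<3/2} \<Longrightarrow> (1 - s\<^sup>2) * g'' s - 4 * s * g' s - 2 * g s = - n s"
    and n_eq: "\<And>s. s \<in> {-1..1} \<Longrightarrow>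
      n s = lam * g s + k * (\<bar>(1 - s\<^sup>2) * g s\<bar> powr (q - 1) * ((1 - s\<^sup>2) * g s))"
    and g1: "g 1 > 0"
    by (rule exists_odd_profile[OF lam q]) blast
  let ?I = "{-3/2<..<3/2} :: real set"
  have I: "?I = {-(3/2)<..<3/2}" "open ?I" by auto
  \<comment> \<open>The profile of the x_3-derivative of \<open>f\<close>.\<close>
  define m where "m s = - (\<beta> + 2) * s * g s + (1 - s\<^sup>2) * g' s" for s
  \<comment> \<open>The differential equation has been used to eliminate \<open>g''\<close>. As
    \<open>n\<close> is continuously differentiable, \<open>m\<close> is twice so, although
    \<open>g''\<close> is merely continuous; this gives the velocity its second derivatives.\<close>
  define m' where "m' s = - \<beta> * g s - \<beta> * s * g' s - n s" for s
  have dm: "(m has_real_derivative m' s) (at s)" if s: "s \<in> ?I" for s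
  proof -
    have "(m has_real_derivative - (\<beta> + 2) * (g s + s * g' s) + (- 2 * s * g' s + (1 - s\<^sup>2) * g'' s)) (at s)"
      unfolding m_def by (auto intro!: derivative_eq_intros g[OF s] g'[OF s] simp: algebra_simps)
    moreover have "- (\<beta> + 2) * (g s + s * g' s) + (- 2 * s * g' s + (1 - s\<^sup>2) * g'' s) = m' s"
      using ode[OF s] by (simp add: m'_def algebra_simps)
    ultimately show ?thesis by simp
  qed
  have Cg: "C_k_on 2 ?I g" "C_k_on 1 ?I g'"
  proof -
    have "C_k_on (Suc 0) ?I g'" by (rule C_k_on_realI[OF I(2) g']) (use cg'' in auto)
    moreover from C_k_on_realI[OF I(2) g this] have "C_k_on (Suc (Suc 0)) ?I g" by blast
    ultimately show "C_k_on 2 ?I g" "C_k_on 1 ?I g'" by (simp_all only: numeral_2_eq_2 One_nat_def)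
  qed
  have Cm: "C_k_on 2 ?I m"
  proof -
    have "C_k_on (Suc 0) ?I n" by (rule C_k_on_realI[OF I(2) n]) (use cn' in auto)
    moreover have "C_k_on (Suc 0) ?I g" by (rule C_k_on_mono[OF Cg(1)]) simp
    ultimately have "C_k_on (Suc 0) ?I m'"
      unfolding m'_def using Cg(2) I(2) unfolding One_nat_def
      by (intro C_k_on_diff C_k_on_mult C_k_on_const C_k_on_id)
    from C_k_on_realI[OF I(2) dm this] have "C_k_on (Suc (Suc 0)) ?I m" by blast
    then show ?thesis by (simp only: numeral_2_eq_2)
  qed
  define f where "f = zonal (- \<beta> - 2) g"
  define h where "h = zonal (- \<beta> - 3) m"
  have op: "open (- {0::real^3})" by auto
  have Cf: "C_k_on 2 (- {0}) f" and Ch: "C_k_on 2 (- {0}) h"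
    unfolding f_def h_def using Cg(1) Cm I(1) by (auto intro: C_k_on_zonal[of _ "3/2"] simp del: C_k_on.simps)
  define \<psi> where "\<psi> x = ((x $ 1)\<^sup>2 + (x $ 2)\<^sup>2) * f x" for x
  \<comment> \<open>The velocity with Stokes stream function \<psi> = r^2 f: the horizontal part is
    -h (x_1, x_2), and the vertical part 2 f + r df/dr is rewritten by Euler's identity for
    homogeneous functions. In this form it is regular on the axis.\<close>
  define u :: "real^3 \<Rightarrow> real^3" where "u x = (- \<beta> * f x) *\<^sub>R e_z - h x *\<^sub>R x" for x
  define P where "P x = - (k / (q + 1)) * \<bar>\<psi> x\<bar> powr (q + 1)" for x
  define p where "p x = P x - (u x \<bullet> u x) * (1 / 2)" for x
  have u_comp: "u x $ 1 = - h x * x $ 1" "u x $ 2 = - h x * x $ 2" "u x $ 3 = - \<beta> * f x - h x * x $ 3" for x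
    by (simp_all add: u_def e_z_def)
  have C\<psi>: "C_k_on 2 (- {0}) \<psi>"
    unfolding \<psi>_def power2_eq_square by (intro C_k_on_mult C_k_on_add C_k_on_nth Cf op)
  have CP: "C_k_on 2 (- {0}) P"
    unfolding P_def
    by (intro C_k_on_cmult op C_k_on_compose_real[OF op open_UNIV subset_UNIV C\<psi> C_k_on_2_abs_powr[OF q]])
  have Cu: "C_k_on 2 (- {0}) u"
    unfolding u_def by (intro C_k_on_diff C_k_on_scaleR C_k_on_mult C_k_on_const C_k_on_id Cf Ch op)
  have Cp: "C_k_on 2 (- {0}) p"
    unfolding p_def by (intro C_k_on_diff C_k_on_mult C_k_on_inner C_k_on_const CP Cu op)
  \<comment> \<open>Minus the derivative of the Bernoulli function \<open>P\<close> with respect to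
    the stream function; the vorticity will be \<kappa> times (-x_2, x_1, 0).\<close>
  define \<kappa> where "\<kappa> x = k * (\<bar>\<psi> x\<bar> powr (q - 1) * \<psi> x)" for x

  text \<open>Writing \<open>\<nabla>f = F (x\<^sub>1, x\<^sub>2, 0) + h e\<^sub>z\<close> and \<open>\<nabla>h = K (x\<^sub>1, x\<^sub>2, 0) + h\<^sub>3 e\<^sub>z\<close>, the profile
    equation becomes \<open>h\<^sub>3 = \<beta> F + K x\<^sub>3 - \<kappa>\<close>.\<close>
  have derivs: "\<exists>F K. (f has_derivative (\<lambda>v. F * (x $ 1 * v $ 1 + x $ 2 * v $ 2) + h x * v $ 3)) (at x) \<and>
      (h has_derivative (\<lambda>v. K * (x $ 1 * v $ 1 + x $ 2 * v $ 2) + (\<beta> * F + K * x $ 3 - \<kappa> x) * v $ 3)) (at x) \<and>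
      F * ((x $ 1)\<^sup>2 + (x $ 2)\<^sup>2) + x $ 3 * h x = - (\<beta> + 2) * f x \<and>
      K * ((x $ 1)\<^sup>2 + (x $ 2)\<^sup>2) + x $ 3 * (\<beta> * F + K * x $ 3 - \<kappa> x) = - (\<beta> + 3) * h x"
    if x: "x \<noteq> 0" for x
  proof -
    define \<rho> where "\<rho> = norm x"
    define s where "s = x $ 3 / \<rho>"
    define R where "R = \<rho> powr (- \<beta> - 4)"
    have \<rho>: "\<rho> > 0" using x by (simp add: \<rho>_def)
    have s1: "s \<in> {-1..1}" using abs_component_div_norm_le_1[of x 3] unfolding s_def \<rho>_def atLeastAtMost_iff by linarith
    then have sI: "s \<in> ?I" by auto
    have x3: "x $ 3 = s * \<rho>" using \<rho> by (simp add: s_def)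
    have r2: "(x $ 1)\<^sup>2 + (x $ 2)\<^sup>2 = \<rho>\<^sup>2 * (1 - s\<^sup>2)"
    proof -
      have "\<rho>\<^sup>2 = (x $ 1)\<^sup>2 + (x $ 2)\<^sup>2 + (x $ 3)\<^sup>2"
        unfolding \<rho>_def power2_norm_eq_inner by (simp add: inner_vec_def sum_3 power2_eq_square)
      then show ?thesis unfolding x3 by (simp add: algebra_simps power_mult_distrib)
    qed
    \<comment> \<open>All powers of \<rho> become \<open>R\<close> times integer powers, after which
      polynomial algebra suffices.\<close>
    have shift: "\<rho> powr b = R * \<rho> powr (b + \<beta> + 4)" for b
      using powr_add[of \<rho> "- \<beta> - 4" "b + \<beta> + 4"] by (simp add: R_def)
    have Rp: "\<rho> powr (- \<beta> - 2) = R * \<rho>\<^sup>2" "\<rho> powr (- \<beta> - 3) = R * \<rho>" "\<rho> powr (- \<beta> - 5) = R / \<rho>"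
      using shift[of "- \<beta> - 2"] shift[of "- \<beta> - 3"] shift[of "- \<beta> - 5"] \<rho>
      by (simp_all add: powr_minus_divide)
    have "- 4 - \<beta> = - \<beta> - 4" "- 5 - \<beta> = - \<beta> - 5" by simp_all
    with Rp(3) have R4: "\<rho> powr (- 4 - \<beta>) = R" and R5: "\<rho> powr (- 5 - \<beta>) = R / \<rho>"
      by (simp_all only: R_def)
    have fx: "f x = R * \<rho>\<^sup>2 * g s" and hx: "h x = R * \<rho> * m s"
      using Rp by (simp_all add: f_def h_def zonal_def s_def \<rho>_def)
    have \<psi>x: "\<psi> x = \<rho> powr (- \<beta>) * ((1 - s\<^sup>2) * g s)"
    proof -
      have "\<rho> powr (- \<beta>) = R * \<rho> ^ 4"
        using shift[of "- \<beta>"] \<rho> by simp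
      then show ?thesis unfolding \<psi>_def r2 fx by (simp add: eval_nat_numeral algebra_simps)
    qed
    have \<kappa>x: "\<kappa> x = R * (n s - lam * g s)"
    proof -
      have "\<bar>\<psi> x\<bar> powr (q - 1) = (\<rho> powr (- \<beta>)) powr (q - 1) * \<bar>(1 - s\<^sup>2) * g s\<bar> powr (q - 1)"
        unfolding \<psi>x abs_mult[of "\<rho> powr (- \<beta>)"] by (simp add: powr_mult)
      moreover have "(\<rho> powr (- \<beta>)) powr (q - 1) * \<rho> powr (- \<beta>) = R"
      proof -
        have "- \<beta> * (q - 1) + - \<beta> = - \<beta> - 4" using \<beta> by (simp add: q_def)
        then show ?thesis by (simp only: powr_powr powr_add[symmetric] R_def)
      qed
      ultimately have "\<kappa> x = R * (k * (\<bar>(1 - s\<^sup>2) * g s\<bar> powr (q - 1) * ((1 - s\<^sup>2) * g s)))"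
        unfolding \<kappa>_def \<psi>x by (simp add: mult_ac)
      then show ?thesis using n_eq[OF s1] by simp
    qed
    have inner: "x \<bullet> v = x $ 1 * v $ 1 + x $ 2 * v $ 2 + s * \<rho> * v $ 3" for v
      by (simp add: inner_vec_def sum_3 x3)
    define F where "F = R * ((- \<beta> - 2) * g s - g' s * s)"
    define K where "K = R / \<rho> * ((- \<beta> - 3) * m s - m' s * s)"
    have m_s: "m s = - (\<beta> + 2) * s * g s + (1 - s\<^sup>2) * g' s" and m'_s: "m' s = - \<beta> * g s - \<beta> * s * g' s - n s"
      by (simp_all add: m_def m'_def)
    have df: "(f has_derivative (\<lambda>v. F * (x $ 1 * v $ 1 + x $ 2 * v $ 2) + h x * v $ 3)) (at x)"
    proof -
      have "(f has_derivative (\<lambda>v. R * (((- \<beta> - 2) * g s - g' s * s) * (x \<bullet> v) + \<rho> * g' s * v $ 3))) (at x)"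
        using has_derivative_zonal[OF x, of g "g' s" "- \<beta> - 2"] g[OF sI]
        by (simp add: f_def s_def[symmetric] \<rho>_def[symmetric] R4)
      moreover have "R * (((- \<beta> - 2) * g s - g' s * s) * (x \<bullet> v) + \<rho> * g' s * v $ 3)
          = F * (x $ 1 * v $ 1 + x $ 2 * v $ 2) + h x * v $ 3" for v
        unfolding inner hx F_def m_s by (simp add: algebra_simps power2_eq_square)
      ultimately show ?thesis by simp
    qed
    have h3: "\<beta> * F + K * x $ 3 - \<kappa> x = R * ((- (\<beta> + 3) * m s - m' s * s) * s + m' s)"
    proof -
      have "K * x $ 3 = R * ((- (\<beta> + 3) * m s - m' s * s) * s)"
        unfolding K_def x3 using \<rho> by (simp add: algebra_simps)
      then show ?thesis unfolding F_def \<kappa>x lam_def m'_s by (simp add: algebra_simps)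
    qed
    have dh: "(h has_derivative (\<lambda>v. K * (x $ 1 * v $ 1 + x $ 2 * v $ 2) + (\<beta> * F + K * x $ 3 - \<kappa> x) * v $ 3)) (at x)"
    proof -
      have "(h has_derivative (\<lambda>v. R / \<rho> * (((- \<beta> - 3) * m s - m' s * s) * (x \<bullet> v) + \<rho> * m' s * v $ 3))) (at x)"
        using has_derivative_zonal[OF x, of m "m' s" "- \<beta> - 3"] dm[OF sI]
        by (simp add: h_def s_def[symmetric] \<rho>_def[symmetric] R5)
      moreover have "R / \<rho> * (((- \<beta> - 3) * m s - m' s * s) * (x \<bullet> v) + \<rho> * m' s * v $ 3)
          = K * (x $ 1 * v $ 1 + x $ 2 * v $ 2) + (\<beta> * F + K * x $ 3 - \<kappa> x) * v $ 3" for v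
        unfolding h3 inner unfolding K_def using \<rho> by (simp add: field_simps)
      ultimately show ?thesis by simp
    qed
    \<comment> \<open>This and the next identity are Euler's relations for \<open>f\<close> and
      \<open>h\<close>, homogeneous of degrees -\<beta> - 2 and -\<beta> - 3.\<close>
    have e1: "F * ((x $ 1)\<^sup>2 + (x $ 2)\<^sup>2) + x $ 3 * h x = - (\<beta> + 2) * f x"
      unfolding r2 fx hx x3 F_def m_s by (simp add: algebra_simps power2_eq_square)
    have e2: "K * ((x $ 1)\<^sup>2 + (x $ 2)\<^sup>2) + x $ 3 * (\<beta> * F + K * x $ 3 - \<kappa> x) = - (\<beta> + 3) * h x"
      unfolding h3 r2 hx unfolding x3 K_def using \<rho> by (simp add: field_simps power2_eq_square)
    show ?thesis using df dh e1 e2 by blast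
  qed
  have main: "convection u x + grad p x = 0 \<and> divergence u x = 0 \<and>
      curl u x = vector [- \<kappa> x * x $ 2, \<kappa> x * x $ 1, 0]" if x: "x \<noteq> 0" for x
  proof -
    obtain F K where df: "(f has_derivative (\<lambda>v. F * (x $ 1 * v $ 1 + x $ 2 * v $ 2) + h x * v $ 3)) (at x)"
      and dh: "(h has_derivative (\<lambda>v. K * (x $ 1 * v $ 1 + x $ 2 * v $ 2) + (\<beta> * F + K * x $ 3 - \<kappa> x) * v $ 3)) (at x)"
      and e1: "F * ((x $ 1)\<^sup>2 + (x $ 2)\<^sup>2) + x $ 3 * h x = - (\<beta> + 2) * f x"
      and e2: "K * ((x $ 1)\<^sup>2 + (x $ 2)\<^sup>2) + x $ 3 * (\<beta> * F + K * x $ 3 - \<kappa> x) = - (\<beta> + 3) * h x"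
      using derivs[OF x] by blast
    define h3 where "h3 = \<beta> * F + K * x $ 3 - \<kappa> x"
    note dh = dh[folded h3_def] and e2 = e2[folded h3_def]
    have dx: "((\<lambda>x::real^3. x $ i) has_derivative (\<lambda>v. v $ i)) (at x)" for i
      by (rule bounded_linear_imp_has_derivative) (rule bounded_linear_vec_nth)
    let ?Dh = "\<lambda>v::real^3. K * (x $ 1 * v $ 1 + x $ 2 * v $ 2) + h3 * v $ 3"
    let ?Df = "\<lambda>v::real^3. F * (x $ 1 * v $ 1 + x $ 2 * v $ 2) + h x * v $ 3"
    have du1: "((\<lambda>y. u y $ 1) has_derivative (\<lambda>v. - (h x * v $ 1 + ?Dh v * x $ 1))) (at x)"
      unfolding u_comp using has_derivative_minus[OF has_derivative_mult[OF dh dx[of 1]]] by simp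
    have du2: "((\<lambda>y. u y $ 2) has_derivative (\<lambda>v. - (h x * v $ 2 + ?Dh v * x $ 2))) (at x)"
      unfolding u_comp using has_derivative_minus[OF has_derivative_mult[OF dh dx[of 2]]] by simp
    have du3: "((\<lambda>y. u y $ 3) has_derivative (\<lambda>v. - \<beta> * ?Df v - (h x * v $ 3 + ?Dh v * x $ 3))) (at x)"
      unfolding u_comp
      using has_derivative_diff[OF has_derivative_mult_right[OF df, of "- \<beta>"] has_derivative_mult[OF dh dx[of 3]]] by simp
    have d\<psi>: "(\<psi> has_derivative (\<lambda>v. ((x $ 1)\<^sup>2 + (x $ 2)\<^sup>2) * ?Df v + (2 * x $ 1 * v $ 1 + 2 * x $ 2 * v $ 2) * f x)) (at x)"
    proof -
      have "((\<lambda>x. (x $ 1)\<^sup>2 + (x $ 2)\<^sup>2) has_derivative (\<lambda>v. 2 * x $ 1 * v $ 1 + 2 * x $ 2 * v $ 2)) (at x)"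
        by (auto intro!: derivative_eq_intros dx simp: algebra_simps)
      from has_derivative_mult[OF this df] show ?thesis unfolding \<psi>_def[abs_def] .
    qed
    have dP: "(P has_derivative (\<lambda>v. - \<kappa> x * (((x $ 1)\<^sup>2 + (x $ 2)\<^sup>2) * ?Df v + (2 * x $ 1 * v $ 1 + 2 * x $ 2 * v $ 2) * f x))) (at x)"
    proof -
      have "((\<lambda>t. - (k / (q + 1)) * \<bar>t\<bar> powr (q + 1)) has_real_derivative
          - (k / (q + 1)) * ((q + 1) * (\<bar>\<psi> x\<bar> powr (q + 1 - 2) * \<psi> x))) (at (\<psi> x))"
        by (intro DERIV_cmult DERIV_abs_powr) (use q in simp)
      moreover have "- (k / (q + 1)) * ((q + 1) * (\<bar>\<psi> x\<bar> powr (q + 1 - 2) * \<psi> x)) = - \<kappa> x"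
      proof -
        have "k = k / (q + 1) * (q + 1)" "q + 1 - 2 = q - 1" using q by simp_all
        then show ?thesis unfolding \<kappa>_def by (metis mult.assoc mult_minus_left)
      qed
      ultimately have "((\<lambda>t. - (k / (q + 1)) * \<bar>t\<bar> powr (q + 1)) has_real_derivative - \<kappa> x) (at (\<psi> x))" by simp
      from has_derivative_compose[OF d\<psi> this[unfolded has_field_derivative_def]]
      show ?thesis unfolding P_def[abs_def] .
    qed
    have sq: "((\<lambda>y. (a y)\<^sup>2) has_derivative (\<lambda>v. 2 * (a x * a' v))) (at x)"
      if "(a has_derivative a') (at x)" for a :: "real^3 \<Rightarrow> real" and a'
      using has_derivative_mult[OF that that] by (simp add: power2_eq_square mult.commute)
    have uu: "(u y \<bullet> u y) * (1 / 2) = (1 / 2) * ((u y $ 1)\<^sup>2 + (u y $ 2)\<^sup>2 + (u y $ 3)\<^sup>2)" for y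
      by (simp add: inner_vec_def sum_3 power2_eq_square)
    have dE: "((\<lambda>y. (u y \<bullet> u y) * (1 / 2)) has_derivative (\<lambda>v.
        u x $ 1 * - (h x * v $ 1 + ?Dh v * x $ 1) + u x $ 2 * - (h x * v $ 2 + ?Dh v * x $ 2)
          + u x $ 3 * (- \<beta> * ?Df v - (h x * v $ 3 + ?Dh v * x $ 3)))) (at x)"
      unfolding uu
      by (rule has_derivative_eq_rhs[OF has_derivative_mult_right[OF
            has_derivative_add[OF has_derivative_add[OF sq[OF du1] sq[OF du2]] sq[OF du3]]]])
        (simp add: fun_eq_iff)
    have dp: "(p has_derivative (\<lambda>v. - \<kappa> x * (((x $ 1)\<^sup>2 + (x $ 2)\<^sup>2) * ?Df v + (2 * x $ 1 * v $ 1 + 2 * x $ 2 * v $ 2) * f x)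
        - (u x $ 1 * - (h x * v $ 1 + ?Dh v * x $ 1) + u x $ 2 * - (h x * v $ 2 + ?Dh v * x $ 2)
          + u x $ 3 * (- \<beta> * ?Df v - (h x * v $ 3 + ?Dh v * x $ 3))))) (at x)"
      unfolding p_def[abs_def] by (rule has_derivative_diff[OF dP dE])
    note part = partialI[OF du1] partialI[OF du2] partialI[OF du3] partialI[OF dp]
    \<comment> \<open>The vertical velocity in its Stokes form (1/r) d psi / dr.\<close>
    have u3: "u x $ 3 = 2 * f x + ((x $ 1)\<^sup>2 + (x $ 2)\<^sup>2) * F"
      using e1 unfolding u_comp by (simp add: algebra_simps)
    have conv: "convection u x + grad p x = 0"
      unfolding vec_eq_iff forall_3
    proof (intro conjI)
      show "(convection u x + grad p x) $ 1 = 0 $ 1"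
        unfolding convection_def grad_def
        apply (simp add: sum_3 part axis_def u3)
        apply (simp add: h3_def u_comp)
        by algebra
      show "(convection u x + grad p x) $ 2 = 0 $ 2"
        unfolding convection_def grad_def
        apply (simp add: sum_3 part axis_def u3)
        apply (simp add: h3_def u_comp)
        by algebra
      show "(convection u x + grad p x) $ 3 = 0 $ 3"
        unfolding convection_def grad_def
        apply (simp add: sum_3 part axis_def)
        apply (simp add: h3_def u_comp)
        by algebra
    qed
    \<comment> \<open>The divergence is -\<beta> h - 3 h minus the derivative of \<open>h\<close>
      along x, and \<open>e2\<close> evaluates the latter as -(\<beta> + 3) h.\<close>
    have div: "divergence u x = 0"
      unfolding divergence_def using e2
      by (simp add: sum_3 part axis_def algebra_simps power2_eq_square)
    have "curl u x = vector [- \<kappa> x * x $ 2, \<kappa> x * x $ 1, 0]"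
      unfolding curl_def by (simp add: part axis_def h3_def algebra_simps)
    with conv div show ?thesis by blast
  qed
  have \<beta>q: "\<beta> * (q + 1) = 2 * \<alpha>" using \<beta> by (simp add: q_def field_simps \<beta>_def)
  have hom: "homogeneous_on (- {0}) \<alpha> u p"
    unfolding homogeneous_on_def
  proof (intro allI ballI impI)
    fix l :: real and x :: "real^3" assume l: "l > 0" and "x \<in> - {0}"
    have fl: "f (l *\<^sub>R x) = l powr (- \<alpha>) * f x"
      using zonal_scaleR[OF l, of "- \<beta> - 2" g x] by (simp add: f_def \<beta>_def)
    have hl: "h (l *\<^sub>R x) * l = l powr (- \<alpha>) * h x"
      using zonal_scaleR[OF l, of "- \<beta> - 3" m x] powr_add[of l "- \<beta> - 3" 1] l
      by (simp add: h_def \<beta>_def mult.commute)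
    have la: "l powr \<alpha> * l powr (- \<alpha>) = 1" using l by (simp add: powr_add[symmetric])
    have ul: "u (l *\<^sub>R x) = l powr (- \<alpha>) *\<^sub>R u x"
      using hl unfolding u_def fl by (simp add: algebra_simps)
    then have "u x = l powr \<alpha> *\<^sub>R u (l *\<^sub>R x)" using la by simp
    moreover have "\<psi> (l *\<^sub>R x) = l powr (- \<beta>) * \<psi> x"
      using powr_add[of l "- \<beta> - 2" 2] l unfolding \<psi>_def fl
      by (simp add: \<beta>_def power_mult_distrib algebra_simps)
    then have "P (l *\<^sub>R x) = (l powr (- \<beta>)) powr (q + 1) * P x"
      by (simp add: P_def abs_mult powr_mult)
    then have Pl: "P (l *\<^sub>R x) = l powr (- (2 * \<alpha>)) * P x"
      using \<beta>q by (simp add: powr_powr)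
    have "l powr (- \<alpha>) * l powr (- \<alpha>) = l powr (- (2 * \<alpha>))" by (simp add: powr_add[symmetric])
    then have "p (l *\<^sub>R x) = l powr (- (2 * \<alpha>)) * p x"
      unfolding p_def Pl ul by (simp add: algebra_simps)
    moreover have "l powr (2 * \<alpha>) * l powr (- (2 * \<alpha>)) = 1" using l by (simp add: powr_add[symmetric])
    ultimately show "u x = l powr \<alpha> *\<^sub>R u (l *\<^sub>R x) \<and> p x = l powr (2 * \<alpha>) * p (l *\<^sub>R x)" by simp
  qed
  have axi: "axisymmetric u p"
    unfolding axisymmetric_def
  proof (rule exI[of _ "\<lambda>r z. - h (vector [r, 0, z]) * r"], rule exI[of _ "\<lambda>r z. 0"],
      rule exI[of _ "\<lambda>r z. u (vector [r, 0, z]) $ 3"], rule exI[of _ "\<lambda>r z. p (vector [r, 0, z])"],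
      intro allI impI conjI)
    fix x :: "real^3" assume r: "rad x > 0"
    let ?y = "vector [rad x, 0, x $ 3] :: real^3"
    have fh: "f ?y = f x" "h ?y = h x" by (simp_all add: f_def h_def zonal_def norm_cylindrical)
    have rad2: "(rad x)\<^sup>2 = (x $ 1)\<^sup>2 + (x $ 2)\<^sup>2" by (simp add: rad_def)
    show "u x = (- h ?y * rad x) *\<^sub>R e_r x + 0 *\<^sub>R e_phi x + u ?y $ 3 *\<^sub>R e_z"
      using r unfolding fh u_comp by (simp add: vec_eq_iff forall_3 u_comp e_r_def e_phi_def e_z_def fh)
    have "u ?y \<bullet> u ?y = u x \<bullet> u x"
      by (simp add: inner_vec_def sum_3 u_comp fh) (use rad2 in algebra)
    moreover have "\<psi> ?y = \<psi> x" by (simp add: \<psi>_def fh rad2)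
    ultimately show "p x = p ?y" by (simp add: p_def P_def)
  qed
  \<comment> \<open>On the axis both the stream function and the vorticity vanish, so a witness is
    taken off the axis but near enough to the pole for \<open>g\<close> to be positive. The lower
    bound 1/2 in the maximum keeps it in the upper half.\<close>
  obtain s0 where s0: "0 < s0" "s0 < 1" "g s0 > 0"
  proof -
    have "isCont g 1" using DERIV_isCont[OF g[of 1]] by simp
    then have "\<forall>\<^sub>F s in at_left 1. g s > 0"
      using g1 order_tendstoD(1)[of g "g 1" "at 1" 0] unfolding isCont_def
      by (metis eventually_at_split)
    then obtain b where "b < 1" "\<And>y. b < y \<Longrightarrow> y < 1 \<Longrightarrow> g y > 0"
      unfolding eventually_at_left_field by blast
    moreover from this(1) have "b < max ((b + 1) / 2) (1 / 2)" "max ((b + 1) / 2) (1 / 2) < 1"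
      by (auto simp: less_max_iff_disj)
    ultimately show thesis using that[of "max ((b + 1) / 2) (1 / 2)"] by simp
  qed
  define c where "c = sqrt (1 - s0\<^sup>2)"
  have s02: "s0\<^sup>2 < 1" using s0 by (simp add: abs_square_less_1)
  have c: "c > 0" "c\<^sup>2 = 1 - s0\<^sup>2" using s02 by (simp_all add: c_def)
  define x0 :: "real^3" where "x0 = vector [c, 0, s0]"
  have nx0: "norm x0 = 1" by (simp add: x0_def norm_vec_def L2_set_def sum_3 c)
  then have x0: "x0 \<noteq> 0" by auto
  have \<psi>0: "\<psi> x0 > 0"
    using c s0 s02 by (simp add: \<psi>_def f_def zonal_def nx0) (simp add: x0_def)
  have \<kappa>0: "\<kappa> x0 > 0" using \<psi>0 k by (simp add: \<kappa>_def)
  have "curl u x0 $ 2 \<noteq> 0" using main[OF x0] \<kappa>0 c by (simp add: x0_def)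
  then have rot: "\<not> irrotational_classical (- {0}) u"
    unfolding irrotational_classical_def using x0 by (metis ComplI singletonD zero_index)
  have bern: "bernoulli u p x = P x" for x
    by (simp add: bernoulli_def p_def power2_norm_eq_inner)
  have "P e_z = 0" by (simp add: P_def \<psi>_def e_z_def)
  moreover have "P x0 \<noteq> 0" using \<psi>0 k q by (simp add: P_def)
  moreover have "e_z \<noteq> 0" by (simp add: e_z_def vec_eq_iff forall_3)
  ultimately have nconst: "\<not> bernoulli u p constant_on (- {0})"
    unfolding constant_on_def bern using x0 by (metis ComplI singletonD)
  have pol: "poloidal u x = u x" for x
  proof (cases "rad x = 0")
    case True
    then have "x $ 1 = 0" "x $ 2 = 0" by (simp_all add: rad_def sum_power2_eq_zero_iff)
    then show ?thesis
      by (simp add: poloidal_def vec_eq_iff forall_3 e_r_def e_z_def u_comp inner_vec_def sum_3)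
  next
    case False
    then have r: "rad x * rad x = (x $ 1)\<^sup>2 + (x $ 2)\<^sup>2" by (simp add: rad_def)
    have "u x \<bullet> e_r x = - h x * (((x $ 1)\<^sup>2 + (x $ 2)\<^sup>2) / rad x)"
      by (simp add: inner_vec_def sum_3 u_comp e_r_def power2_eq_square algebra_simps add_divide_distrib)
    also have "\<dots> = - h x * rad x" unfolding r[symmetric] by simp
    finally have "u x \<bullet> e_r x = - h x * rad x" .
    then show ?thesis
      using False by (simp add: poloidal_def vec_eq_iff forall_3 e_r_def e_z_def u_comp inner_vec_def sum_3)
  qed
  have tor: "toroidal u x = 0" for x
    by (simp add: toroidal_def inner_vec_def sum_3 u_comp e_phi_def)
  have "rot_axi_hom_solution_punctured 1 \<alpha> u p"
    unfolding rot_axi_hom_solution_punctured_def euler_classical_def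
    using main hom axi rot C_k_on_mono[OF Cu, of 1] C_k_on_mono[OF Cp, of 1] by simp
  moreover have "poloidal u = u" "toroidal u = (\<lambda>x. 0)" using pol tor by auto
  moreover have "C_k_on 1 (- {0}) (\<lambda>x::real^3. 0::real^3)" by (rule C_k_on_const[OF op])
  ultimately show ?thesis
    using nconst Cu Cp by (intro exI[of _ u] exI[of _ p]) simp
qed

section \<open>Nonexistence\<close>

lemma continuous_zero_at_left_end:
  fixes f :: "real \<Rightarrow> real"
  assumes "continuous_on {A..B} f" "A < B" "\<And>x. A < x \<Longrightarrow> x < B \<Longrightarrow> f x = 0"
  shows "f A = 0"
proof -
  have "(f \<longlongrightarrow> f A) (at_right A)"
    using assms(1,2) by (simp add: continuous_on_Icc_at_rightD)
  moreover have "\<forall>\<^sub>F x in at_right A. f x = 0"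
    unfolding eventually_at_right_field using assms(2,3) by blast
  then have "(f \<longlongrightarrow> 0) (at_right A)" by (rule tendsto_eventually)
  ultimately show ?thesis using tendsto_unique trivial_limit_at_right_real by blast
qed

text \<open>The end points are the last zero before x and the first zero after it; the zero set is
  compact.\<close>

lemma positive_component:
  fixes W :: "real \<Rightarrow> real"
  assumes W: "continuous_on {A..B} W" "W A = 0" "W B = 0" and x: "x \<in> {A..B}" "W x > 0"
  obtains s t where "A \<le> s" "s < x" "x < t" "t \<le> B" "W s = 0" "W t = 0"
    "\<And>y. s < y \<Longrightarrow> y < t \<Longrightarrow> W y > 0"
proof -
  have Ax: "A < x" "x < B" using x W(2,3) by (auto simp: less_le)
  let ?L = "{y \<in> {A..x}. W y = 0}" and ?R = "{y \<in> {x..B}. W y = 0}"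
  have "closed ?L" "closed ?R"
    by (intro continuous_closed_preimage_constant continuous_on_subset[OF W(1)] closed_atLeastAtMost; use Ax in auto)+
  moreover have "bounded ?L" "bounded ?R"
    by (rule bounded_subset[of "{A..B}"]; use Ax in auto)+
  ultimately have "compact ?L" "compact ?R" by (simp_all add: compact_eq_bounded_closed)
  moreover have "?L \<noteq> {}" "?R \<noteq> {}" using W(2,3) Ax by (auto intro: exI[of _ A] exI[of _ B])
  ultimately obtain s t where s: "s \<in> ?L" "\<And>y. y \<in> ?L \<Longrightarrow> y \<le> s" and t: "t \<in> ?R" "\<And>y. y \<in> ?R \<Longrightarrow> t \<le> y"
    using compact_attains_sup[of ?L] compact_attains_inf[of ?R] by auto
  have sx: "s < x" "x < t" using s(1) t(1) x(2) by (auto simp: less_le)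
  have "W y > 0" if y: "s < y" "y < t" for y
  proof (rule ccontr)
    assume n: "\<not> W y > 0"
    show False
    proof (cases "y \<le> x")
      case True
      have "continuous_on {y..x} W" by (rule continuous_on_subset[OF W(1)]) (use y s Ax in auto)
      then obtain z where "y \<le> z" "z \<le> x" "W z = 0"
        using IVT'[of W y 0 x] n x(2) True by auto
      then show False using s(2)[of z] y s(1) by auto
    next
      case False
      have "continuous_on {x..y} W" by (rule continuous_on_subset[OF W(1)]) (use y t Ax in auto)
      then obtain z where "x \<le> z" "z \<le> y" "W z = 0"
        using IVT2'[of W y 0 x] n x(2) False by auto
      then show False using t(2)[of z] y t(1) by auto
    qed
  qed
  with that[of s t] s t sx show thesis by auto
qed

text \<open>The Euler equations on a meridian of the unit sphere for the spherical components \<open>a\<close>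
  (radial), \<open>b\<close> (polar), \<open>c\<close> (azimuthal) of the velocity and the pressure \<open>p\<close>, as functions of the polar
  angle.\<close>

locale meridian =
  fixes \<alpha> :: real and a b c p a' b' c' p' :: "real \<Rightarrow> real"
  assumes \<alpha>: "0 \<le> \<alpha>" "\<alpha> \<le> 2"
    and cont: "continuous_on {0..pi} a" "continuous_on {0..pi} b" "continuous_on {0..pi} c"
      "continuous_on {0..pi} p"
    and da: "\<And>t. 0 < t \<Longrightarrow> t < pi \<Longrightarrow> (a has_real_derivative a' t) (at t)"
    and db: "\<And>t. 0 < t \<Longrightarrow> t < pi \<Longrightarrow> (b has_real_derivative b' t) (at t)"
    and dc: "\<And>t. 0 < t \<Longrightarrow> t < pi \<Longrightarrow> (c has_real_derivative c' t) (at t)"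
    and dp: "\<And>t. 0 < t \<Longrightarrow> t < pi \<Longrightarrow> (p has_real_derivative p' t) (at t)"
    and cont_c': "continuous_on {0<..<pi} c'"
    and radial: "\<And>t. 0 < t \<Longrightarrow> t < pi \<Longrightarrow> b t * a' t = \<alpha> * (a t)\<^sup>2 + (b t)\<^sup>2 + (c t)\<^sup>2 + 2 * \<alpha> * p t"
    and polar: "\<And>t. 0 < t \<Longrightarrow> t < pi \<Longrightarrow>
      p' t = \<alpha> * a t * b t - b t * (b' t + a t) + (c t)\<^sup>2 * (cos t / sin t)"
    and azimuthal: "\<And>t. 0 < t \<Longrightarrow> t < pi \<Longrightarrow> b t * c' t = (\<alpha> - 1) * a t * c t - cos t / sin t * b t * c t"
    and mass: "\<And>t. 0 < t \<Longrightarrow> t < pi \<Longrightarrow> b' t = (\<alpha> - 2) * a t - cos t / sin t * b t"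
    and axis: "b 0 = 0" "c 0 = 0" "b pi = 0" "c pi = 0"
begin

section \<open>Stream function, circulation and Bernoulli function along the meridian\<close>

definition W :: "real \<Rightarrow> real" where "W t = sin t * b t"
definition \<Gamma> :: "real \<Rightarrow> real" where "\<Gamma> t = sin t * c t"
definition head :: "real \<Rightarrow> real" where "head t = p t + ((a t)\<^sup>2 + (b t)\<^sup>2 + (c t)\<^sup>2) / 2"
definition m :: real where "m = 2 - \<alpha>"

lemma cont_W: "continuous_on {0..pi} W" and cont_\<Gamma>: "continuous_on {0..pi} \<Gamma>"
  and cont_head: "continuous_on {0..pi} head"
  unfolding W_def \<Gamma>_def head_def by (intro continuous_intros cont; simp)+

lemma dW: assumes t: "0 < t" "t < pi"
  shows "(W has_real_derivative - m * sin t * a t) (at t)"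
proof -
  have "(W has_real_derivative cos t * b t + sin t * b' t) (at t)"
    unfolding W_def using db[OF t] by (auto intro!: derivative_eq_intros)
  moreover have "cos t * b t + sin t * b' t = - m * sin t * a t"
    using mass[OF t] sin_gt_zero[OF t] by (simp add: m_def field_simps)
  ultimately show ?thesis by simp
qed

lemma d\<Gamma>: assumes t: "0 < t" "t < pi"
  shows "(\<Gamma> has_real_derivative cos t * c t + sin t * c' t) (at t)"
  unfolding \<Gamma>_def using dc[OF t] by (auto intro!: derivative_eq_intros)

text \<open>The circulation r \<open>u^phi\<close> is constant along the flow and homogeneous of
  degree 1 - \<alpha>, so its radial derivative contributes the right side.\<close>

lemma transport_\<Gamma>: assumes t: "0 < t" "t < pi"
  shows "W t * (cos t * c t + sin t * c' t) = (\<alpha> - 1) * sin t * a t * \<Gamma> t"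
proof -
  have "W t * (cos t * c t + sin t * c' t) = sin t * (cos t * b t * c t + sin t * (b t * c' t))"
    by (simp add: W_def algebra_simps)
  also have "\<dots> = (\<alpha> - 1) * sin t * a t * \<Gamma> t"
    unfolding azimuthal[OF t] using sin_gt_zero[OF t] by (simp add: \<Gamma>_def field_simps)
  finally show ?thesis .
qed

lemma dhead: assumes t: "0 < t" "t < pi"
  shows "(head has_real_derivative p' t + a t * a' t + b t * b' t + c t * c' t) (at t)"
  unfolding head_def using da[OF t] db[OF t] dc[OF t] dp[OF t]
  by (auto intro!: derivative_eq_intros simp: field_simps)

text \<open>The Bernoulli function is constant along the flow and homogeneous of degree -2\<alpha>;
  multiplying the three momentum equations by the velocity components and adding expresses this on
  the meridian.\<close>

lemma transport_head: assumes t: "0 < t" "t < pi"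
  shows "W t * (p' t + a t * a' t + b t * b' t + c t * c' t) = 2 * \<alpha> * sin t * a t * head t"
proof -
  have "b t * (p' t + a t * a' t + b t * b' t + c t * c' t)
      = b t * p' t + a t * (b t * a' t) + (b t)\<^sup>2 * b' t + c t * (b t * c' t)"
    by (simp add: algebra_simps power2_eq_square)
  also have "\<dots> = 2 * \<alpha> * a t * head t"
    unfolding radial[OF t] azimuthal[OF t] polar[OF t] head_def
    by (simp add: algebra_simps power2_eq_square)
  finally show ?thesis unfolding W_def by (simp add: mult_ac)
qed

lemma W_ends: "W 0 = 0" "W pi = 0"
  by (simp_all add: W_def)

text \<open>Since W' = -m a sin, the hypothesis \<open>tr\<close> says X'/X = -e W'/W wherever X is
  nonzero.\<close>

lemma transported_const:
  assumes X: "\<And>t. s < t \<Longrightarrow> t < r \<Longrightarrow> (X has_real_derivative X' t) (at t)"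
    and tr: "\<And>t. s < t \<Longrightarrow> t < r \<Longrightarrow> W t * X' t = m * e * sin t * a t * X t"
    and J: "0 \<le> s" "r \<le> pi" "\<And>t. s < t \<Longrightarrow> t < r \<Longrightarrow> W t > 0" and t: "s < t" "t < r"
  shows "((\<lambda>t. X t * W t powr e) has_real_derivative 0) (at t)"
proof -
  have W: "W t > 0" using J(3) t .
  have dWt: "(W has_real_derivative - m * sin t * a t) (at t)" by (rule dW) (use J t in auto)
  have dp: "((\<lambda>t. W t powr e) has_real_derivative e * W t powr (e - 1) * (- m * sin t * a t)) (at t)"
    by (rule DERIV_chain2[where f="\<lambda>w. w powr e", OF has_real_derivative_powr[OF W] dWt])
  have "X' t * W t powr e + e * W t powr (e - 1) * (- m * sin t * a t) * X t = 0"
  proof -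
    have "W t powr e = W t powr (e - 1) * W t" using powr_add[of "W t" "e - 1" 1] W by simp
    then have "X' t * W t powr e + e * W t powr (e - 1) * (- m * sin t * a t) * X t
        = W t powr (e - 1) * (W t * X' t - m * e * sin t * a t * X t)"
      by (simp add: algebra_simps)
    then show ?thesis using tr[OF t] by simp
  qed
  with DERIV_mult[OF X[OF t] dp] show ?thesis by simp
qed

text \<open>For a positive exponent the constant is evaluated at the left end, where
  \<open>X\<close> is bounded and \<open>W powr e\<close> vanishes.\<close>

lemma transported_zero:
  assumes X: "\<And>t. s < t \<Longrightarrow> t < r \<Longrightarrow> (X has_real_derivative X' t) (at t)"
    and tr: "\<And>t. s < t \<Longrightarrow> t < r \<Longrightarrow> W t * X' t = m * e * sin t * a t * X t"
    and J: "0 \<le> s" "r \<le> pi" "\<And>t. s < t \<Longrightarrow> t < r \<Longrightarrow> W t > 0" "W s = 0"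
    and cX: "continuous_on {0..pi} X" and e: "e > 0" and t: "s < t" "t < r"
  shows "X t = 0"
proof -
  have W0: "W y \<ge> 0" if "s \<le> y" "y \<le> t" for y
    using J(3)[of y] J(4) that t by (cases "y = s") auto
  have "X t * W t powr e = X s * W s powr e"
  proof (rule DERIV_isconst_end[OF t(1)])
    show "continuous_on {s..t} (\<lambda>t. X t * W t powr e)"
      by (intro continuous_intros continuous_on_powr' continuous_on_subset[OF cX] continuous_on_subset[OF cont_W])
        (use J t W0 e in auto)
    show "((\<lambda>t. X t * W t powr e) has_real_derivative 0) (at y)" if "s < y" "y < t" for y
      by (rule transported_const[OF X tr J(1-3)]) (use that t in auto)
  qed
  then show ?thesis using J(3)[OF t] J(4) by simp
qed

text \<open>\<open>W\<close> rises from 0 and returns to 0, and W' = -m a sin, so \<open>a\<close>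
  passes from negative to positive values. The radial equation, freed of the pressure, makes
  \<open>a\<close> nonincreasing for \<alpha> >= 1, which is impossible. For \<alpha> < 1 the swirl
  has to be removed first; then \<open>a\<close> and \<open>W\<close> solve a linear system that is
  compared with a constant flow.\<close>

lemma positive_component_analysis:
  assumes \<alpha>2: "\<alpha> < 2" and J: "0 \<le> s" "s < r" "r \<le> pi" "W s = 0" "W r = 0"
    and pos: "\<And>t. s < t \<Longrightarrow> t < r \<Longrightarrow> W t > 0"
  shows "\<alpha> = 0 \<and> s = 0 \<and> r = pi \<and>
    (\<exists>\<kappa>. \<forall>t. 0 < t \<longrightarrow> t < pi \<longrightarrow> c t = 0 \<and> a t = \<kappa> * cos t \<and> b t = - \<kappa> * sin t)"
proof -
  have m: "m > 0" using \<alpha>2 by (simp add: m_def)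
  have J': "0 < t" "t < pi" "sin t > 0" "b t > 0" "W t > 0" if "s < t" "t < r" for t
  proof -
    show t: "0 < t" "t < pi" using that J by auto
    then show "sin t > 0" by (rule sin_gt_zero)
    with pos[OF that] show "b t > 0" "W t > 0" by (simp_all add: W_def zero_less_mult_iff)
  qed
  \<comment> \<open>At \<alpha> = 0 the transport exponent is 0 and gives no information on the
    head. The radial equation contains the pressure only through 2 \<alpha> p, so the product with
    \<alpha> is enough.\<close>
  have head0: "\<alpha> * head t = 0" if t: "s < t" "t < r" for t
  proof (cases "\<alpha> = 0")
    case False
    have "head t = 0"
    proof (rule transported_zero[where e="2 * \<alpha> / m", OF dhead _ J(1,3) pos J(4) cont_head _ t])
      show "2 * \<alpha> / m > 0" using False \<alpha> m by simp
      fix t assume "s < t" "t < r"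
      with J'(1,2) transport_head[of t] m
      show "W t * (p' t + a t * a' t + b t * b' t + c t * c' t) = m * (2 * \<alpha> / m) * sin t * a t * head t"
        by simp
    qed (use J' in auto)
    then show ?thesis by simp
  qed simp
  have key: "b t * a' t = (1 - \<alpha>) * ((b t)\<^sup>2 + (c t)\<^sup>2)" if t: "s < t" "t < r" for t
  proof -
    have "2 * \<alpha> * p t = - \<alpha> * ((a t)\<^sup>2 + (b t)\<^sup>2 + (c t)\<^sup>2)"
    proof -
      have "2 * \<alpha> * p t = 2 * (\<alpha> * head t) - \<alpha> * ((a t)\<^sup>2 + (b t)\<^sup>2 + (c t)\<^sup>2)"
        by (simp add: head_def field_simps)
      then show ?thesis using head0[OF t] by simp
    qed
    then show ?thesis using radial[of t] J'(1,2)[OF t] by (simp add: algebra_simps)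
  qed
  define x where "x = (s + r) / 2"
  have x: "s < x" "x < r" using J by (auto simp: x_def)
  \<comment> \<open>Mean value theorem on the left half, where \<open>W\<close> has a net increase;
    the right half yields \<open>y2\<close> in the same way.\<close>
  obtain y1 where y1: "s < y1" "y1 < x" "a y1 < 0"
  proof -
    have "continuous_on {s..x} W" by (rule continuous_on_subset[OF cont_W]) (use J x in auto)
    then obtain l y where y: "s < y" "y < x" "(W has_real_derivative l) (at y)" "W x - W s = (x - s) * l"
      using MVT[OF x(1)] dW J' x real_differentiable_def by (meson less_trans)
    have "l = - m * sin y * a y" using DERIV_unique[OF y(3) dW] J'[of y] y x by simp
    moreover have "(x - s) * l > 0" using y(4) J(4) pos[OF x] by simp
    then have "l > 0" using x by (simp add: zero_less_mult_iff)
    ultimately have "a y < 0" using m J'(3)[of y] y x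
      by (smt (verit) mult_nonneg_nonneg mult_minus_left)
    then show thesis using that y by blast
  qed
  obtain y2 where y2: "x < y2" "y2 < r" "a y2 > 0"
  proof -
    have "continuous_on {x..r} W" by (rule continuous_on_subset[OF cont_W]) (use J x in auto)
    then obtain l y where y: "x < y" "y < r" "(W has_real_derivative l) (at y)" "W r - W x = (r - x) * l"
      using MVT[OF x(2)] dW J' x real_differentiable_def by (meson less_trans)
    have "l = - m * sin y * a y" using DERIV_unique[OF y(3) dW] J'[of y] y x by simp
    moreover have "(r - x) * l < 0" using y(4) J(5) pos[OF x] by simp
    then have "l < 0" using x by (simp add: mult_less_0_iff)
    ultimately have "m * sin y * a y > 0" by simp
    moreover have "m * sin y > 0" using m J'(3)[of y] y x by simp
    ultimately have "a y > 0" by (rule zero_less_mult_pos)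
    then show thesis using that y by blast
  qed
  have \<alpha>1: "\<alpha> < 1"
  proof (rule ccontr)
    assume n: "\<not> \<alpha> < 1"
    \<comment> \<open>The circulation has transport exponent (\<alpha> - 1)/m, which is positive for
      \<alpha> > 1; at \<alpha> = 1 the factor 1 - \<alpha> disposes of the swirl term.\<close>
    have c0: "(1 - \<alpha>) * (c t)\<^sup>2 = 0" if t: "s < t" "t < r" for t
    proof (cases "\<alpha> = 1")
      case False
      have "\<Gamma> t = 0"
      proof (rule transported_zero[where e="(\<alpha> - 1) / m", OF d\<Gamma> _ J(1,3) pos J(4) cont_\<Gamma> _ t])
        show "(\<alpha> - 1) / m > 0" using False n m by simp
        fix t assume "s < t" "t < r"
        with J'(1,2) transport_\<Gamma>[of t] m
        show "W t * (cos t * c t + sin t * c' t) = m * ((\<alpha> - 1) / m) * sin t * a t * \<Gamma> t" by simp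
      qed (use J' in auto)
      then show ?thesis using J'(3)[OF t] by (simp add: \<Gamma>_def)
    qed simp
    have "- a y1 \<le> - a y2"
    proof (rule nonneg_derivative_imp_le[where f="\<lambda>t. - a t" and f'="\<lambda>t. - a' t"])
      show "y1 \<le> y2" using y1 y2 by simp
      show "continuous_on {y1..y2} (\<lambda>t. - a t)"
        by (intro continuous_intros continuous_on_subset[OF cont(1)]) (use y1 y2 J in auto)
      fix t assume t: "y1 < t" "t < y2"
      then have t': "s < t" "t < r" using y1 y2 by auto
      show "((\<lambda>t. - a t) has_real_derivative - a' t) (at t)"
        by (rule DERIV_minus[OF da]) (use J' t' in auto)
      have "b t * a' t = (1 - \<alpha>) * (b t)\<^sup>2" using key[OF t'] c0[OF t'] unfolding distrib_left by simp
      then have "b t * a' t \<le> 0" using n by (simp add: mult_nonpos_nonneg)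
      then show "- a' t \<ge> 0" using J'(4)[OF t'] by (simp add: mult_le_0_iff)
    qed
    then show False using y1 y2 by simp
  qed
  have a_mono: "a y \<le> a z" if "s \<le> y" "y \<le> z" "z \<le> r" for y z
  proof (rule nonneg_derivative_imp_le[where f=a and f'=a'])
    show "continuous_on {y..z} a"
      by (intro continuous_on_subset[OF cont(1)]) (use that J in auto)
    fix t assume t: "y < t" "t < z"
    then have t': "s < t" "t < r" using that by auto
    show "(a has_real_derivative a' t) (at t)" by (rule da) (use J' t' in auto)
    have "b t * a' t \<ge> 0" using key[OF t'] \<alpha>1 by simp
    then show "a' t \<ge> 0" using J'(4)[OF t'] by (simp add: zero_le_mult_iff)
  qed (use that in auto)
  have as: "a s < 0" using a_mono[of s y1] y1 y2 x by simp
  have ar: "a r > 0" using a_mono[of y2 r] y1 y2 x by simp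
  \<comment> \<open>Now the transport exponent of the circulation is -e, so \<Gamma> is a constant
    times \<open>W powr e\<close> and vanishes at the ends anyway; \<open>transported_zero\<close>
    gives nothing. The bound 2 e <= 1 is equivalent to \<alpha> >= 0.\<close>
  define e where "e = (1 - \<alpha>) / m"
  have e: "e > 0" "2 * e \<le> 1" using \<alpha>1 m \<alpha> by (simp_all add: e_def m_def divide_le_eq)
  have me: "m * (- e) = \<alpha> - 1" using m by (simp add: e_def)
  define C where "C = \<Gamma> x * W x powr (- e)"
  have \<Gamma>C: "\<Gamma> t = C * W t powr e" if t: "s < t" "t < r" for t
  proof -
    have "\<Gamma> t * W t powr (- e) = C"
      unfolding C_def
    proof (rule DERIV_isconst3[where f="\<lambda>t. \<Gamma> t * W t powr (- e)", OF J(2)])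
      fix y assume y: "y \<in> {s<..<r}"
      show "((\<lambda>t. \<Gamma> t * W t powr (- e)) has_real_derivative 0) (at y)"
      proof (rule transported_const[OF d\<Gamma> _ J(1,3) pos])
        fix t assume "s < t" "t < r"
        then show "W t * (cos t * c t + sin t * c' t) = m * (- e) * sin t * a t * \<Gamma> t"
          unfolding me using J'(1,2) by (intro transport_\<Gamma>)
      qed (use J' y in auto)
    qed (use t x in auto)
    moreover have "W t powr (- e) * W t powr e = 1"
      using J'(5)[OF t] by (simp add: powr_add[symmetric])
    ultimately show ?thesis by (metis mult.assoc mult.right_neutral)
  qed
  have C0: "C = 0"
  proof (cases "s = 0")
    case False
    \<comment> \<open>The transport equation of \<Gamma> divided by \<open>W powr e\<close>. It
      holds inside the component and extends continuously to s, where the power of \<open>W\<close>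
      vanishes because e < 1. There sin s > 0 and a s < 0, which forces C = 0.\<close>
    let ?f = "\<lambda>t. (cos t * c t + sin t * c' t) * W t powr (1 - e) - (\<alpha> - 1) * sin t * a t * C"
    have "?f s = 0"
    proof (rule continuous_zero_at_left_end[OF _ x(1)])
      have "W t \<ge> 0" if "s \<le> t" "t \<le> x" for t using pos[of t] J(4) x that by (cases "t = s") auto
      then show "continuous_on {s..x} ?f"
        by (intro continuous_intros continuous_on_powr' continuous_on_subset[OF cont_c'] continuous_on_subset[OF cont(1)]
            continuous_on_subset[OF cont(3)] continuous_on_subset[OF cont_W])
          (use False J x e in auto)
      fix t assume "s < t" "t < x"
      then have t: "s < t" "t < r" using x by auto
      have W: "W t > 0" by (rule J'(5)[OF t])
      have "W t = W t powr (1 - e) * W t powr e" using W by (simp add: powr_add[symmetric])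
      then have "(cos t * c t + sin t * c' t) * W t powr (1 - e) * W t powr e = (\<alpha> - 1) * sin t * a t * C * W t powr e"
        using transport_\<Gamma>[OF J'(1,2)[OF t]] \<Gamma>C[OF t] by (metis mult.assoc mult.commute)
      then show "?f t = 0" using W by simp
    qed
    then have "(\<alpha> - 1) * sin s * a s * C = 0" using J(4) by simp
    moreover have "sin s > 0" by (rule sin_gt_zero) (use False J in auto)
    ultimately show ?thesis using \<alpha>1 as by auto
  next
    case s0: True
    \<comment> \<open>At a pole sin s = 0 makes the previous identity void. Monotonicity of
      \<open>a\<close> gives a <= -\<mu> near the pole, hence W >= const sin^2, so |c| sin = |C| W^e
      >= const |C| sin^(2e) >= const |C| sin. A nonzero \<open>C\<close> would keep |c| away from 0,
      against c(0) = 0.\<close>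
    define \<mu> where "\<mu> = - a y1"
    have \<mu>: "\<mu> > 0" using y1 by (simp add: \<mu>_def)
    have Wge: "W t \<ge> m * \<mu> / 2 * (sin t)\<^sup>2" if t: "0 < t" "t < y1" for t
    proof -
      have "W 0 - m * \<mu> * (1 - cos 0) \<le> W t - m * \<mu> * (1 - cos t)"
      proof (rule nonneg_derivative_imp_le[where f="\<lambda>t. W t - m * \<mu> * (1 - cos t)" and f'="\<lambda>t. m * sin t * (- a t - \<mu>)"])
        show "continuous_on {0..t} (\<lambda>t. W t - m * \<mu> * (1 - cos t))"
          by (intro continuous_intros continuous_on_subset[OF cont_W]) (use t y1 x J in auto)
        fix z assume z: "0 < z" "z < t"
        then have z': "s < z" "z < r" using s0 t y1 x by auto
        show "((\<lambda>t. W t - m * \<mu> * (1 - cos t)) has_real_derivative m * sin z * (- a z - \<mu>)) (at z)"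
          using dW[OF J'(1,2)[OF z']] by (auto intro!: derivative_eq_intros simp: algebra_simps)
        have "a z \<le> a y1" by (rule a_mono) (use z z' t y1 x in auto)
        then show "m * sin z * (- a z - \<mu>) \<ge> 0" using m J'(3)[OF z'] by (simp add: \<mu>_def)
      qed (use t in auto)
      then have "W t \<ge> m * \<mu> * (1 - cos t)" by (simp add: W_ends)
      moreover have "1 - cos t \<ge> (sin t)\<^sup>2 / 2"
      proof -
        have "(sin t)\<^sup>2 = (1 - cos t) * (1 + cos t)"
          using sin_squared_eq[of t] by (simp add: algebra_simps power2_eq_square)
        also have "\<dots> \<le> (1 - cos t) * 2" by (intro mult_left_mono) auto
        finally show ?thesis by simp
      qed
      then have "m * \<mu> * ((sin t)\<^sup>2 / 2) \<le> m * \<mu> * (1 - cos t)" using m \<mu> by (intro mult_left_mono) auto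
      ultimately show ?thesis by simp
    qed
    have cge: "\<bar>c t\<bar> \<ge> \<bar>C\<bar> * (m * \<mu> / 2) powr e" if t: "0 < t" "t < y1" for t
    proof -
      have t': "s < t" "t < r" using s0 t y1 x by auto
      have sn: "sin t > 0" by (rule J'(3)[OF t'])
      have "(m * \<mu> / 2) powr e * sin t \<le> (m * \<mu> / 2) powr e * sin t powr (2 * e)"
        using powr_mono'[of "2 * e" 1 "sin t"] sn e by (intro mult_left_mono) auto
      also have "\<dots> = (m * \<mu> / 2 * (sin t)\<^sup>2) powr e"
      proof -
        have "(sin t)\<^sup>2 powr e = sin t powr (2 * e)" using powr_powr[of "sin t" 2 e] sn by simp
        then show ?thesis using powr_mult[of "m * \<mu> / 2" "(sin t)\<^sup>2" e] m \<mu> by simp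
      qed
      also have "\<dots> \<le> W t powr e" using Wge[OF t] e m \<mu> by (intro powr_mono2) auto
      finally have "\<bar>C\<bar> * ((m * \<mu> / 2) powr e * sin t) \<le> \<bar>C\<bar> * W t powr e" by (rule mult_left_mono) simp
      also have "\<dots> = \<bar>\<Gamma> t\<bar>" by (simp add: \<Gamma>C[OF t'] abs_mult)
      also have "\<dots> = \<bar>c t\<bar> * sin t" using sn by (simp add: \<Gamma>_def abs_mult)
      finally show ?thesis using sn by (simp add: mult.assoc[symmetric])
    qed
    have "(c \<longlongrightarrow> c 0) (at_right 0)"
      using cont(3) by (simp add: continuous_on_Icc_at_rightD)
    then have "((\<lambda>t. \<bar>c t\<bar>) \<longlongrightarrow> 0) (at_right 0)" using axis tendsto_rabs_zero by fastforce
    moreover have "\<forall>\<^sub>F t in at_right 0. \<bar>C\<bar> * (m * \<mu> / 2) powr e \<le> \<bar>c t\<bar>"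
      unfolding eventually_at_right_field using cge y1 s0 by (intro exI[of _ y1]) auto
    ultimately have "\<bar>C\<bar> * (m * \<mu> / 2) powr e \<le> 0"
      by (intro tendsto_lowerbound) auto
    then show ?thesis using m \<mu> by (simp add: mult_le_0_iff)
  qed
  have c0: "c t = 0" if "s < t" "t < r" for t
    using \<Gamma>C[OF that] C0 J'(3)[OF that] by (simp add: \<Gamma>_def)
  have a'b: "a' t = (1 - \<alpha>) * b t" if t: "s < t" "t < r" for t
    using key[OF t] c0[OF t] J'(4)[OF t] by (simp add: power2_eq_square)

  text \<open>A Wronskian with the constant flow \<open>e\<^sub>z\<close>.\<close>
  define V where "V t = m * a t * (sin t)\<^sup>2 + 2 * cos t * W t" for t
  have dV: "(V has_real_derivative - (\<alpha> * (3 - \<alpha>)) * sin t * W t) (at t)" if t: "s < t" "t < r" for t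
  proof -
    have "(V has_real_derivative m * (a' t * (sin t)\<^sup>2 + a t * (2 * sin t * cos t))
        + 2 * (- sin t * W t + cos t * (- m * sin t * a t))) (at t)"
      unfolding V_def using da[OF J'(1,2)[OF t]] dW[OF J'(1,2)[OF t]]
      by (auto intro!: derivative_eq_intros simp: algebra_simps)
    moreover have "m * (a' t * (sin t)\<^sup>2 + a t * (2 * sin t * cos t))
        + 2 * (- sin t * W t + cos t * (- m * sin t * a t)) = - (\<alpha> * (3 - \<alpha>)) * sin t * W t"
      unfolding a'b[OF t] W_def m_def by (simp add: algebra_simps power2_eq_square)
    ultimately show ?thesis by simp
  qed
  have cV: "continuous_on {s..r} V"
    unfolding V_def by (intro continuous_intros continuous_on_subset[OF cont(1)] continuous_on_subset[OF cont_W])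
      (use J in auto)
  have Vs: "V s = m * (a s * (sin s)\<^sup>2)" and Vr: "V r = m * (a r * (sin r)\<^sup>2)"
    by (simp_all add: V_def J)
  \<comment> \<open>The end values would make \<open>V\<close> increase weakly, while V' is
    -\<alpha> (3 - \<alpha>) times a positive quantity. Only \<alpha> = 0 survives; then
    \<open>V\<close> is constant, hence zero, and both ends lie at poles.\<close>
  have Vsr: "V s \<le> 0" "V r \<ge> 0" unfolding Vs Vr using m as ar by (simp_all add: mult_nonneg_nonpos mult_nonpos_nonneg)
  obtain l z where z: "s < z" "z < r" "(V has_real_derivative l) (at z)" "V r - V s = (r - s) * l"
    using MVT[OF J(2) cV] dV real_differentiable_def by meson
  have "l = - (\<alpha> * (3 - \<alpha>)) * sin z * W z" using DERIV_unique[OF z(3) dV[OF z(1,2)]] .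
  moreover have "(r - s) * l \<ge> 0" using z(4) Vsr by simp
  then have "l \<ge> 0" using J(2) by (simp add: zero_le_mult_iff)
  ultimately have "\<alpha> * (3 - \<alpha>) * (sin z * W z) \<le> 0" by (simp add: mult.assoc)
  moreover have "sin z * W z > 0" using J'[OF z(1,2)] by simp
  ultimately have "\<alpha> * (3 - \<alpha>) \<le> 0" by (simp add: mult_le_0_iff zero_less_mult_iff) linarith
  then have \<alpha>0: "\<alpha> = 0" using \<alpha> by (simp add: mult_le_0_iff)
  have V_const: "V t = V s" if "s \<le> t" "t \<le> r" for t
    by (rule DERIV_isconst2[OF J(2) cV]) (use dV \<alpha>0 that in auto)
  have "V s = 0" "V r = 0" using V_const[of r] J(2) Vsr by auto
  then have "sin s = 0" "sin r = 0" using Vs Vr m as ar by auto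
  then have s0: "s = 0" and rpi: "r = pi"
    using J sin_gt_zero[of s] sin_gt_zero[of r] by (auto simp: less_le)
  have m2: "m = 2" using \<alpha>0 unfolding m_def by linarith
  have orth: "a t * sin t + cos t * b t = 0" if t: "s < t" "t < r" for t
  proof -
    have "2 * sin t * (a t * sin t + cos t * b t) = V t"
      by (simp add: V_def m2 W_def power2_eq_square algebra_simps)
    then show ?thesis using V_const[of t] \<open>V s = 0\<close> t J'(3)[OF t] by simp
  qed
  \<comment> \<open>\<open>y\<close> is the vertical velocity; \<open>orth\<close> says that the
    radial cylindrical component vanishes. Together they identify a constant vertical flow.\<close>
  define y where "y t = a t * cos t - b t * sin t" for t
  have y_const: "y t = y x" if t: "s < t" "t < r" for t
  proof (rule DERIV_isconst3[where f=y, OF J(2)])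
    fix t assume "t \<in> {s<..<r}"
    then have t: "s < t" "t < r" by auto
    have "(y has_real_derivative a' t * cos t - a t * sin t - (b' t * sin t + b t * cos t)) (at t)"
      unfolding y_def using da[OF J'(1,2)[OF t]] db[OF J'(1,2)[OF t]]
      by (auto intro!: derivative_eq_intros simp: algebra_simps)
    moreover have "a' t * cos t - a t * sin t - (b' t * sin t + b t * cos t) = a t * sin t + cos t * b t"
      unfolding a'b[OF t] mass[OF J'(1,2)[OF t]] \<alpha>0 using J'(3)[OF t] by (simp add: algebra_simps)
    ultimately show "(y has_real_derivative 0) (at t)" using orth[OF t] by simp
  qed (use t x in auto)
  have "c t = 0 \<and> a t = y x * cos t \<and> b t = - y x * sin t" if "0 < t" "t < pi" for t
  proof -
    have t: "s < t" "t < r" using that s0 rpi by auto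
    have "y t * cos t = a t" "- y t * sin t = b t"
      using orth[OF t] sin_cos_squared_add[of t] unfolding y_def by algebra+
    then show ?thesis using y_const[OF t] c0[OF t] by simp
  qed
  then show ?thesis using \<alpha>0 s0 rpi by blast
qed

text \<open>With b = 0 the radial, azimuthal and mass equations are algebraic. For \<alpha>
  different from 2 they give a = 0 and c^2 = -2 \<alpha> p, and the polar equation makes p sin^(2
  \<alpha>) constant when \<alpha> > 0. For \<alpha> = 2 they give a c = 0 and p in terms of a and
  c, and the conserved quantity is c^2 sin^4. Both quantities vanish at the pole.\<close>

lemma no_polar_flow:
  assumes b0: "\<And>t. 0 < t \<Longrightarrow> t < pi \<Longrightarrow> b t = 0" and t: "0 < t" "t < pi"
  shows "c t = 0 \<and> (\<alpha> \<noteq> 2 \<longrightarrow> a t = 0) \<and> a t = a (pi / 2)"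
proof -
  have b'0: "b' t = 0" if t: "0 < t" "t < pi" for t
  proof -
    have "((\<lambda>t. 0) has_real_derivative b' t) (at t)"
      by (rule has_field_derivative_transform_within_open[OF db[OF t], where S="{0<..<pi}"]) (use b0 t in auto)
    then show ?thesis using DERIV_unique[OF _ DERIV_const] by blast
  qed
  have p'0: "p' t = (c t)\<^sup>2 * (cos t / sin t)" if "0 < t" "t < pi" for t
    using polar[OF that] b0[OF that] by simp
  show ?thesis
  proof (cases "\<alpha> = 2")
    case False
    have a0: "a t = 0" if "0 < t" "t < pi" for t
      using mass[OF that] b'0[OF that] b0[OF that] False by simp
    have cp: "(c t)\<^sup>2 = - (2 * \<alpha> * p t)" if "0 < t" "t < pi" for t
      using radial[OF that] b0[OF that] a0[OF that] by simp
    have ap: "\<alpha> * p t = 0" if t: "0 < t" "t < pi" for t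
    proof (cases "\<alpha> = 0")
      case False
      then have \<alpha>p: "\<alpha> > 0" using \<alpha> by simp
      have "p t * sin t powr (2 * \<alpha>) = p 0 * sin 0 powr (2 * \<alpha>)"
      proof (rule DERIV_isconst_end[OF t(1)])
        show "continuous_on {0..t} (\<lambda>t. p t * sin t powr (2 * \<alpha>))"
          by (intro continuous_intros continuous_on_powr' continuous_on_subset[OF cont(4)])
            (use t \<alpha>p sin_ge_zero in auto)
        fix y assume "0 < y" "y < t"
        then have y: "0 < y" "y < pi" using t by auto
        have sn: "sin y > 0" by (rule sin_gt_zero[OF y])
        have "((\<lambda>t. p t * sin t powr (2 * \<alpha>)) has_real_derivative
            p' y * sin y powr (2 * \<alpha>) + 2 * \<alpha> * sin y powr (2 * \<alpha> - 1) * cos y * p y) (at y)"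
          by (intro DERIV_mult dp[OF y] DERIV_chain2[where f="\<lambda>w. w powr (2 * \<alpha>)",
                OF has_real_derivative_powr[OF sn] DERIV_sin])
        moreover have "sin y powr (2 * \<alpha>) = sin y powr (2 * \<alpha> - 1) * sin y"
          using powr_add[of "sin y" "2 * \<alpha> - 1" 1] sn by simp
        then have "p' y * sin y powr (2 * \<alpha>) + 2 * \<alpha> * sin y powr (2 * \<alpha> - 1) * cos y * p y = 0"
          unfolding p'0[OF y] cp[OF y] using sn by simp
        ultimately show "((\<lambda>t. p t * sin t powr (2 * \<alpha>)) has_real_derivative 0) (at y)" by simp
      qed
      then show ?thesis using sin_gt_zero[OF t] by simp
    qed simp
    have "c t = 0" if "0 < t" "t < pi" for t using cp[OF that] ap[OF that] by auto
    then show ?thesis using a0[of t] a0[of "pi / 2"] t by simp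
  next
    case True
    have ac: "a t * c t = 0" if "0 < t" "t < pi" for t
      using azimuthal[OF that] b0[OF that] True by simp
    have pac: "p t = - ((a t)\<^sup>2 / 2 + (c t)\<^sup>2 / 4)" if "0 < t" "t < pi" for t
      using radial[OF that] b0[OF that] True by simp
    have dc4: "((\<lambda>t. (c t)\<^sup>2 * sin t ^ 4) has_real_derivative 0) (at y)" if y: "0 < y" "y < pi" for y
    proof -
      have sn: "sin y > 0" by (rule sin_gt_zero[OF y])
      have "((\<lambda>t. (c t)\<^sup>2 * sin t ^ 4) has_real_derivative
          (2 * c y * c' y) * sin y ^ 4 + (c y)\<^sup>2 * (4 * sin y ^ 3 * cos y)) (at y)"
        using dc[OF y] by (auto intro!: derivative_eq_intros simp: algebra_simps)
      moreover have "(2 * c y * c' y) * sin y ^ 4 + (c y)\<^sup>2 * (4 * sin y ^ 3 * cos y) = 0"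
      proof (cases "c y = 0")
        case False
        \<comment> \<open>Near a point with c nonzero, \<open>ac\<close> forces a = 0, so p = -c^2/4
          on an open set and may be differentiated there.\<close>
        have "((\<lambda>x. - ((c x)\<^sup>2 / 4)) has_real_derivative p' y) (at y)"
        proof (rule has_field_derivative_transform_within_open[OF dp[OF y]])
          show "open ({0<..<pi} \<inter> c -` (- {0}))"
            by (rule continuous_open_preimage) (auto intro: continuous_on_subset[OF cont(3)])
          show "y \<in> {0<..<pi} \<inter> c -` (- {0})" using False y by simp
          show "p x = - ((c x)\<^sup>2 / 4)" if "x \<in> {0<..<pi} \<inter> c -` (- {0})" for x
            using ac[of x] pac[of x] that by auto
        qed
        moreover have "((\<lambda>x. - ((c x)\<^sup>2 / 4)) has_real_derivative - (c y * c' y / 2)) (at y)"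
          using dc[OF y] by (auto intro!: derivative_eq_intros)
        ultimately have "p' y = - (c y * c' y / 2)" using DERIV_unique by blast
        then have "2 * c y * c' y = - (4 * (c y)\<^sup>2 * (cos y / sin y))" using p'0[OF y] by simp
        then show ?thesis using sn by (simp add: eval_nat_numeral)
      qed simp
      ultimately show ?thesis by simp
    qed
    have c0: "c t = 0" if t: "0 < t" "t < pi" for t
    proof -
      have "(c t)\<^sup>2 * sin t ^ 4 = (c 0)\<^sup>2 * sin 0 ^ 4"
        by (rule DERIV_isconst_end[OF t(1)])
          (use t dc4 in \<open>auto intro!: continuous_intros continuous_on_subset[OF cont(3)]\<close>)
      then show ?thesis using axis sin_gt_zero[OF t] by simp
    qed
    have dp0: "(p has_real_derivative 0) (at y)" if "0 < y" "y < pi" for y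
      using dp[OF that] p'0[OF that] c0[OF that] by simp
    have p_const: "p y = p z" if "0 < y" "y < pi" "0 < z" "z < pi" for y z
      by (rule DERIV_isconst3[of 0 pi]) (use that dp0 in auto)
    have a2: "(a y)\<^sup>2 = (a z)\<^sup>2" if "0 < y" "y < pi" "0 < z" "z < pi" for y z
      using p_const[OF that] pac[OF that(1,2)] pac[OF that(3,4)] c0[OF that(1,2)] c0[OF that(3,4)] by simp
    have a'0: "a' y = 0" if y: "0 < y" "y < pi" for y
    proof -
      have "((\<lambda>t. (a t)\<^sup>2) has_real_derivative 2 * a y * a' y) (at y)"
        using da[OF y] by (auto intro!: derivative_eq_intros)
      then have "((\<lambda>t. (a y)\<^sup>2) has_real_derivative 2 * a y * a' y) (at y)"
      proof (rule has_field_derivative_transform_within_open)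
        show "(a t)\<^sup>2 = (a y)\<^sup>2" if "t \<in> {0<..<pi}" for t
          by (rule a2[OF _ _ y]) (use that in auto)
      qed (use y in auto)
      then have aa: "a y * a' y = 0" using DERIV_unique[OF _ DERIV_const] by fastforce
      show ?thesis
      proof (cases "a y = 0")
        case True
        have "((\<lambda>t. 0) has_real_derivative a' y) (at y)"
        proof (rule has_field_derivative_transform_within_open[OF da[OF y]])
          show "a t = 0" if "t \<in> {0<..<pi}" for t
            using a2[OF _ _ y, of t] that True by simp
        qed (use y in auto)
        then show ?thesis using DERIV_unique[OF _ DERIV_const] by blast
      qed (use aa in simp)
    qed
    have "(a has_real_derivative 0) (at y)" if "0 < y" "y < pi" for y
      using da[OF that] a'0[OF that] by simp
    then have "a t = a (pi / 2)"
      by (intro DERIV_isconst3[of 0 pi]) (use t in auto)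
    then show ?thesis using c0[OF t] True by simp
  qed
qed

text \<open>The three alternatives are a constant vertical flow, the source \<kappa> x / |x|^3, and
  rest. If the polar velocity is not identically zero, then \<alpha> < 2, because for \<alpha> = 2
  the stream function is constant; a component of positivity exists after a possible change of
  sign.\<close>

lemma classification:
  shows "(\<forall>t. 0 < t \<longrightarrow> t < pi \<longrightarrow> c t = 0) \<and>
    ((\<exists>\<kappa>. \<alpha> = 0 \<and> (\<forall>t. 0 < t \<longrightarrow> t < pi \<longrightarrow> a t = \<kappa> * cos t \<and> b t = - \<kappa> * sin t)) \<or>
     (\<exists>\<kappa>. \<alpha> = 2 \<and> (\<forall>t. 0 < t \<longrightarrow> t < pi \<longrightarrow> a t = \<kappa> \<and> b t = 0)) \<or>
     (\<forall>t. 0 < t \<longrightarrow> t < pi \<longrightarrow> a t = 0 \<and> b t = 0))"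
proof (cases "\<forall>t. 0 < t \<longrightarrow> t < pi \<longrightarrow> b t = 0")
  case True
  then have "c t = 0 \<and> (\<alpha> \<noteq> 2 \<longrightarrow> a t = 0) \<and> a t = a (pi / 2)" if "0 < t" "t < pi" for t
    using no_polar_flow[OF _ that] by blast
  with True show ?thesis by (cases "\<alpha> = 2") blast+
next
  case False
  then obtain t0 where t0: "0 < t0" "t0 < pi" "b t0 \<noteq> 0" by blast
  have sn: "sin t0 > 0" by (rule sin_gt_zero[OF t0(1,2)])
  have "\<alpha> \<noteq> 2"
  proof
    assume "\<alpha> = 2"
    then have m0: "m = 0" unfolding m_def by simp
    have "W t0 = W 0"
    proof (rule DERIV_isconst_end[OF t0(1)])
      show "continuous_on {0..t0} W" by (rule continuous_on_subset[OF cont_W]) (use t0 in auto)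
      show "(W has_real_derivative 0) (at t)" if "0 < t" "t < t0" for t
        using dW[of t] that t0 m0 by simp
    qed
    then show False using t0 sn by (simp add: W_def)
  qed
  then have \<alpha>2: "\<alpha> < 2" using \<alpha> by simp
  show ?thesis
  proof (cases "b t0 > 0")
    case True
    then obtain s r where "0 \<le> s" "s < t0" "t0 < r" "r \<le> pi" "W s = 0" "W r = 0"
        "\<And>y. s < y \<Longrightarrow> y < r \<Longrightarrow> W y > 0"
      using positive_component[OF cont_W W_ends, of t0] t0 sn by (auto simp: W_def)
    from positive_component_analysis[OF \<alpha>2 this(1) _ this(4,5,6,7)] this(2,3)
    show ?thesis by auto
  next
    case False
    \<comment> \<open>The equations are invariant under reversing the velocity and keeping the
      pressure.\<close>
    interpret neg: meridian \<alpha> "\<lambda>t. - a t" "\<lambda>t. - b t" "\<lambda>t. - c t" p "\<lambda>t. - a' t" "\<lambda>t. - b' t" "\<lambda>t. - c' t" p'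
    proof
      fix t assume t: "0 < t" "t < pi"
      show "- b t * - a' t = \<alpha> * (- a t)\<^sup>2 + (- b t)\<^sup>2 + (- c t)\<^sup>2 + 2 * \<alpha> * p t"
        using radial[OF t] by simp
      show "p' t = \<alpha> * - a t * - b t - - b t * (- b' t + - a t) + (- c t)\<^sup>2 * (cos t / sin t)"
        using polar[OF t] by (simp add: right_diff_distrib distrib_left)
      show "- b t * - c' t = (\<alpha> - 1) * - a t * - c t - cos t / sin t * - b t * - c t"
        using azimuthal[OF t] by simp
      show "- b' t = (\<alpha> - 2) * - a t - cos t / sin t * - b t"
        using mass[OF t] by simp
    qed (use \<alpha> cont cont_c' axis in \<open>auto intro!: continuous_intros DERIV_minus da db dc dp\<close>)
    from False obtain s r where "0 \<le> s" "s < t0" "t0 < r" "r \<le> pi" "neg.W s = 0" "neg.W r = 0"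
        "\<And>y. s < y \<Longrightarrow> y < r \<Longrightarrow> neg.W y > 0"
      using positive_component[OF neg.cont_W neg.W_ends, of t0] t0 sn
      by (auto simp: neg.W_def mult_less_0_iff)
    from neg.positive_component_analysis[OF \<alpha>2 this(1) _ this(4,5,6,7)] this(2,3)
    obtain \<kappa> where k: "\<alpha> = 0" "\<And>t. 0 < t \<Longrightarrow> t < pi \<Longrightarrow> - c t = 0 \<and> - a t = \<kappa> * cos t \<and> - b t = - \<kappa> * sin t"
      by auto
    have "\<alpha> = 0 \<and> (\<forall>t. 0 < t \<longrightarrow> t < pi \<longrightarrow> a t = - \<kappa> * cos t \<and> b t = - (- \<kappa>) * sin t)"
      using k by force
    moreover have "\<forall>t. 0 < t \<longrightarrow> t < pi \<longrightarrow> c t = 0" using k(2) by auto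
    ultimately show ?thesis by blast
  qed
qed

end

text \<open>At a point of a meridian off the axis, homogeneity gives the derivative along x,
  axisymmetry the azimuthal one, and the third is the derivative along the meridian. So the full
  Jacobian is known there and the Euler equations become those of \<open>meridian\<close>. All flows
  of the classification are irrotational.\<close>

lemma axisymmetric_homogeneous_imp_irrotational:
  fixes \<alpha> :: real
  assumes \<alpha>: "0 \<le> \<alpha>" "\<alpha> \<le> 2"
    and Cu: "C_k_on (Suc 0) (- {0}) u" and Cp: "C_k_on (Suc 0) (- {0}) p"
    and euler: "euler_classical (- {0}) u p" and hom: "homogeneous_on (- {0}) \<alpha> u p"
    and axi: "axisymmetric u p"
  shows "irrotational_classical (- {0}) u"
proof -
  define D where "D x = frechet_derivative u (at x)" for x
  define Q where "Q x = frechet_derivative p (at x)" for x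
  have du: "(u has_derivative D x) (at x)" and dp: "(p has_derivative Q x) (at x)" if "x \<noteq> 0" for x
    using C_k_on_Suc_has_derivative[OF Cu] C_k_on_Suc_has_derivative[OF Cp] that by (auto simp: D_def Q_def)
  have linD: "linear (D x)" and linQ: "linear (Q x)" if "x \<noteq> 0" for x
    using has_derivative_linear[OF du[OF that]] has_derivative_linear[OF dp[OF that]] by auto
  have contD: "continuous_on (- {0}) (\<lambda>x. D x v)" for v
    using Cu by (simp add: D_def)
  have du_nth: "((\<lambda>y. u y $ i) has_derivative (\<lambda>v. D x v $ i)) (at x)" if "x \<noteq> 0" for x i
    using bounded_linear.has_derivative[OF bounded_linear_vec_nth du[OF that]] .
  have part: "partial j (\<lambda>y. u y $ i) x = D x (axis j 1) $ i" "partial j p x = Q x (axis j 1)"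
    if "x \<noteq> 0" for x i j
    using partialI[OF du_nth[OF that]] partialI[OF dp[OF that]] by auto
  have u_scale: "u (l *\<^sub>R x) = l powr (- \<alpha>) *\<^sub>R u x" and p_scale: "p (l *\<^sub>R x) = l powr (- (2 * \<alpha>)) * p x"
    if "x \<noteq> 0" "l > 0" for x l
  proof -
    have "u x = (l powr \<alpha>) *\<^sub>R u (l *\<^sub>R x)" "p x = l powr (2 * \<alpha>) * p (l *\<^sub>R x)"
      using hom[unfolded homogeneous_on_def, rule_format, of l x] that by (blast, blast)
    then have "l powr (- \<alpha>) *\<^sub>R u x = (l powr (- \<alpha>) * l powr \<alpha>) *\<^sub>R u (l *\<^sub>R x)"
      "l powr (- (2 * \<alpha>)) * p x = (l powr (- (2 * \<alpha>)) * l powr (2 * \<alpha>)) * p (l *\<^sub>R x)"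
      unfolding mult.assoc by (metis scaleR_scaleR, metis)
    then show "u (l *\<^sub>R x) = l powr (- \<alpha>) *\<^sub>R u x" "p (l *\<^sub>R x) = l powr (- (2 * \<alpha>)) * p x"
      using that(2) by (simp_all add: powr_add[symmetric])
  qed
  have dlx: "((\<lambda>l. l *\<^sub>R x) has_derivative (\<lambda>h. h *\<^sub>R x)) (at 1)" for x :: "real^3"
    by (auto intro!: derivative_eq_intros)
  have dpow: "((\<lambda>l. l powr b) has_derivative (\<lambda>h. b * h)) (at (1::real))" for b
    using has_real_derivative_powr[of 1 b] by (simp add: has_field_derivative_def)
  have D_radial: "D x x = - \<alpha> *\<^sub>R u x" and Q_radial: "Q x x = - (2 * \<alpha>) * p x" if x: "x \<noteq> 0" for x
  proof -
    have "((\<lambda>l. u (l *\<^sub>R x)) has_derivative (\<lambda>h. D x (h *\<^sub>R x))) (at 1)"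
      using has_derivative_compose[OF dlx, of u "D x"] du[OF x] by simp
    moreover have "((\<lambda>l. u (l *\<^sub>R x)) has_derivative (\<lambda>h. (- \<alpha> * h) *\<^sub>R u x)) (at 1)"
      by (rule has_derivative_transform_within_open[OF has_derivative_scaleR_left[OF dpow[of "- \<alpha>"]], of "{0<..}"])
        (use u_scale[OF x] in auto)
    ultimately have "(\<lambda>h. D x (h *\<^sub>R x)) = (\<lambda>h. (- \<alpha> * h) *\<^sub>R u x)" by (rule has_derivative_unique)
    from fun_cong[OF this, of 1] show "D x x = - \<alpha> *\<^sub>R u x" by simp
    have "((\<lambda>l. p (l *\<^sub>R x)) has_derivative (\<lambda>h. Q x (h *\<^sub>R x))) (at 1)"
      using has_derivative_compose[OF dlx, of p "Q x"] dp[OF x] by simp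
    moreover have "((\<lambda>l. p (l *\<^sub>R x)) has_derivative (\<lambda>h. (- (2 * \<alpha>) * h) * p x)) (at 1)"
      by (rule has_derivative_transform_within_open[OF has_derivative_mult_left[OF dpow[of "- (2 * \<alpha>)"]], of "{0<..}"])
        (use p_scale[OF x] in auto)
    ultimately have "(\<lambda>h. Q x (h *\<^sub>R x)) = (\<lambda>h. (- (2 * \<alpha>) * h) * p x)" by (rule has_derivative_unique)
    from fun_cong[OF this, of 1] show "Q x x = - (2 * \<alpha>) * p x" by simp
  qed
  have u_rot: "u (vector [s * cos \<phi>, s * sin \<phi>, z]) = vector
      [u (vector [s, 0, z]) $ 1 * cos \<phi> - u (vector [s, 0, z]) $ 2 * sin \<phi>,
       u (vector [s, 0, z]) $ 1 * sin \<phi> + u (vector [s, 0, z]) $ 2 * cos \<phi>, u (vector [s, 0, z]) $ 3]"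
    and p_rot: "p (vector [s * cos \<phi>, s * sin \<phi>, z]) = p (vector [s, 0, z])" if s: "s > 0" for s \<phi> z
  proof -
    obtain ur uphi uz q where A: "\<And>x. rad x > 0 \<Longrightarrow>
       u x = ur (rad x) (x $ 3) *\<^sub>R e_r x + uphi (rad x) (x $ 3) *\<^sub>R e_phi x + uz (rad x) (x $ 3) *\<^sub>R e_z \<and>
       p x = q (rad x) (x $ 3)"
      using axi unfolding axisymmetric_def by blast
    have *: "u (vector [s * cos \<phi>, s * sin \<phi>, z]) = vector [ur s z * cos \<phi> - uphi s z * sin \<phi>,
        ur s z * sin \<phi> + uphi s z * cos \<phi>, uz s z]" "p (vector [s * cos \<phi>, s * sin \<phi>, z]) = q s z" for \<phi>
      using A[of "vector [s * cos \<phi>, s * sin \<phi>, z]"] s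
      by (simp_all add: frame_cylindrical e_z_def vec_eq_iff forall_3)
    from *[of 0] have "u (vector [s, 0, z]) = vector [ur s z, uphi s z, uz s z]" "p (vector [s, 0, z]) = q s z" by simp_all
    with *[of \<phi>] show "u (vector [s * cos \<phi>, s * sin \<phi>, z]) = vector
      [u (vector [s, 0, z]) $ 1 * cos \<phi> - u (vector [s, 0, z]) $ 2 * sin \<phi>,
       u (vector [s, 0, z]) $ 1 * sin \<phi> + u (vector [s, 0, z]) $ 2 * cos \<phi>, u (vector [s, 0, z]) $ 3]"
      "p (vector [s * cos \<phi>, s * sin \<phi>, z]) = p (vector [s, 0, z])" by simp_all
  qed
  have vec3: "(vector [x1, x2, x3] :: real^3) = x1 *\<^sub>R axis 1 1 + x2 *\<^sub>R axis 2 1 + x3 *\<^sub>R axis 3 1" for x1 x2 x3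
    by (simp add: vec_eq_iff forall_3 axis_def)
  have vec0: "(vector [x1, x2, x3] :: real^3) \<noteq> 0" if "x1 \<noteq> 0 \<or> x3 \<noteq> 0" for x1 x2 x3
    using that by (auto simp: vec_eq_iff forall_3)
  have D_azimuthal: "s * D (vector [s, 0, z]) (axis 2 1) $ 1 = - u (vector [s, 0, z]) $ 2"
      "s * D (vector [s, 0, z]) (axis 2 1) $ 2 = u (vector [s, 0, z]) $ 1"
      "s * D (vector [s, 0, z]) (axis 2 1) $ 3 = 0"
      "s * Q (vector [s, 0, z]) (axis 2 1) = 0" if s: "s > 0" for s z
  proof -
    let ?x = "vector [s, 0, z] :: real^3"
    let ?g = "\<lambda>\<phi>. vector [s * cos \<phi>, s * sin \<phi>, z] :: real^3"
    have x: "?x \<noteq> 0" using s by (intro vec0) simp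
    have dg: "(?g has_derivative (\<lambda>h. (h * s) *\<^sub>R axis 2 1)) (at 0)"
      unfolding vec3 by (auto intro!: derivative_eq_intros simp: fun_eq_iff)
    have "((\<lambda>\<phi>. u (?g \<phi>) $ i) has_derivative (\<lambda>h. D ?x ((h * s) *\<^sub>R axis 2 1) $ i)) (at 0)" for i
      using has_derivative_compose[OF dg, of "\<lambda>y. u y $ i" "\<lambda>v. D ?x v $ i"] du_nth[OF x, of i] by simp
    then have d: "((\<lambda>\<phi>. u (?g \<phi>) $ i) has_real_derivative s * D ?x (axis 2 1) $ i) (at 0)" for i
      unfolding has_field_derivative_def linear.scaleR[OF linD[OF x]] by (simp add: mult_ac mult_commute_abs)
    have "((\<lambda>\<phi>. u (?g \<phi>) $ 1) has_real_derivative - u ?x $ 2) (at 0)"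
      "((\<lambda>\<phi>. u (?g \<phi>) $ 2) has_real_derivative u ?x $ 1) (at 0)"
      "((\<lambda>\<phi>. u (?g \<phi>) $ 3) has_real_derivative 0) (at 0)"
      unfolding u_rot[OF s] by (auto intro!: derivative_eq_intros)
    with d show "s * D ?x (axis 2 1) $ 1 = - u ?x $ 2" "s * D ?x (axis 2 1) $ 2 = u ?x $ 1"
        "s * D ?x (axis 2 1) $ 3 = 0"
      using DERIV_unique by blast+
    have "((\<lambda>\<phi>. p (?g \<phi>)) has_derivative (\<lambda>h. Q ?x ((h * s) *\<^sub>R axis 2 1))) (at 0)"
      using has_derivative_compose[OF dg, of p "Q ?x"] dp[OF x] by simp
    then have "((\<lambda>\<phi>. p (?g \<phi>)) has_real_derivative s * Q ?x (axis 2 1)) (at 0)"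
      unfolding has_field_derivative_def linear.scaleR[OF linQ[OF x]] by (simp add: mult_ac mult_commute_abs)
    moreover have "((\<lambda>\<phi>. p (?g \<phi>)) has_real_derivative 0) (at 0)" unfolding p_rot[OF s] by simp
    ultimately show "s * Q ?x (axis 2 1) = 0" using DERIV_unique by blast
  qed
  define X where "X t = (vector [sin t, 0, cos t] :: real^3)" for t
  have X0: "X t \<noteq> 0" for t
  proof -
    have "sin t \<noteq> 0 \<or> cos t \<noteq> 0" using sin_zero_abs_cos_one[of t] by auto
    then show ?thesis unfolding X_def by (rule vec0)
  qed
  have dX: "(X has_derivative (\<lambda>h. h *\<^sub>R (cos t *\<^sub>R axis 1 1 - sin t *\<^sub>R axis 3 1))) (at t)" for t
    unfolding X_def[abs_def] vec3 by (auto intro!: derivative_eq_intros simp: fun_eq_iff algebra_simps)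
  define A where "A i t = u (X t) $ i" for i t
  define A' where "A' i t = cos t * D (X t) (axis 1 1) $ i - sin t * D (X t) (axis 3 1) $ i" for i t
  have dA: "(A i has_real_derivative A' i t) (at t)" for i t
  proof -
    have "(A i has_derivative (\<lambda>h. D (X t) (h *\<^sub>R (cos t *\<^sub>R axis 1 1 - sin t *\<^sub>R axis 3 1)) $ i)) (at t)"
      unfolding A_def[abs_def] by (rule has_derivative_compose[OF dX du_nth[OF X0]])
    moreover have "D (X t) (h *\<^sub>R (cos t *\<^sub>R axis 1 1 - sin t *\<^sub>R axis 3 1)) $ i = A' i t * h" for h
      by (simp add: linear.scaleR[OF linD[OF X0]] linear_diff[OF linD[OF X0]] A'_def)
    ultimately show ?thesis by (simp add: has_field_derivative_def)
  qed
  define P where "P t = p (X t)" for t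
  define P' where "P' t = cos t * Q (X t) (axis 1 1) - sin t * Q (X t) (axis 3 1)" for t
  have dP: "(P has_real_derivative P' t) (at t)" for t
  proof -
    have "(P has_derivative (\<lambda>h. Q (X t) (h *\<^sub>R (cos t *\<^sub>R axis 1 1 - sin t *\<^sub>R axis 3 1)))) (at t)"
      unfolding P_def[abs_def] by (rule has_derivative_compose[OF dX dp[OF X0]])
    moreover have "Q (X t) (h *\<^sub>R (cos t *\<^sub>R axis 1 1 - sin t *\<^sub>R axis 3 1)) = P' t * h" for h
      by (simp add: linear.scaleR[OF linQ[OF X0]] linear_diff[OF linQ[OF X0]] P'_def)
    ultimately show ?thesis by (simp add: has_field_derivative_def)
  qed
  have contA: "continuous_on S (A i)" and contP: "continuous_on S P" for S i
    using dA dP DERIV_isCont by (blast intro: continuous_at_imp_continuous_on)+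
  have contA': "continuous_on S (A' i)" for S i
  proof -
    have cX: "continuous_on S X" using has_derivative_continuous[OF dX] by (blast intro: continuous_at_imp_continuous_on)
    have "continuous_on S (\<lambda>t. D (X t) v)" for v
      by (rule continuous_on_compose2[OF contD cX]) (use X0 in auto)
    then show ?thesis unfolding A'_def by (intro continuous_intros)
  qed
  \<comment> \<open>\<open>X (- t)\<close> is \<open>X t\<close> rotated by pi, which reverses
    horizontal components. Axisymmetry is assumed off the axis only, so the values at the poles are
    recovered from this relation by continuity.\<close>
  have odd: "A i t + A i (- t) = 0" if "0 < t" "t < pi" "i = 1 \<or> i = 2" for i t
    using u_rot[of "sin t" pi "cos t"] sin_gt_zero[OF that(1,2)] that(3) by (auto simp: A_def X_def)
  have contAo: "continuous_on S (\<lambda>t. A i (g t))" if "continuous_on S g" for S i g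
    by (rule continuous_on_compose2[OF contA[of UNIV] that]) simp
  have axis0: "A i 0 = 0" if i: "i = 1 \<or> i = 2" for i
  proof -
    have "A i 0 + A i (- 0) = 0"
    proof (rule continuous_zero_at_left_end[of 0 pi "\<lambda>t. A i t + A i (- t)"])
      show "continuous_on {0..pi} (\<lambda>t. A i t + A i (- t))"
        by (intro continuous_on_add contA contAo continuous_intros)
    qed (use odd[OF _ _ i] in auto)
    then show ?thesis by simp
  qed
  have axispi: "A i pi = 0" if i: "i = 1 \<or> i = 2" for i
  proof -
    have "A i (pi - 0) + A i (- (pi - 0)) = 0"
    proof (rule continuous_zero_at_left_end[of 0 pi "\<lambda>t. A i (pi - t) + A i (- (pi - t))"])
      show "continuous_on {0..pi} (\<lambda>t. A i (pi - t) + A i (- (pi - t)))"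
        by (intro continuous_on_add contAo continuous_intros)
      show "A i (pi - t) + A i (- (pi - t)) = 0" if "0 < t" "t < pi" for t
        by (rule odd[OF _ _ i]) (use that in auto)
    qed simp
    moreover have "X (- pi) = X pi" by (simp add: X_def)
    ultimately show ?thesis by (simp add: A_def)
  qed
  define a where "a t = sin t * A 1 t + cos t * A 3 t" for t
  define b where "b t = cos t * A 1 t - sin t * A 3 t" for t
  define a' where "a' t = cos t * A 1 t + sin t * A' 1 t - sin t * A 3 t + cos t * A' 3 t" for t
  define b' where "b' t = - sin t * A 1 t + cos t * A' 1 t - cos t * A 3 t - sin t * A' 3 t" for t
  have eqs: "b t * a' t = \<alpha> * (a t)\<^sup>2 + (b t)\<^sup>2 + (A 2 t)\<^sup>2 + 2 * \<alpha> * P t \<and>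
      P' t = \<alpha> * a t * b t - b t * (b' t + a t) + (A 2 t)\<^sup>2 * (cos t / sin t) \<and>
      b t * A' 2 t = (\<alpha> - 1) * a t * A 2 t - cos t / sin t * b t * A 2 t \<and>
      b' t = (\<alpha> - 2) * a t - cos t / sin t * b t" if t: "0 < t" "t < pi" for t
  proof -
    define s z where "s = sin t" and "z = cos t"
    have s: "s > 0" and sz: "s\<^sup>2 + z\<^sup>2 = 1" using sin_gt_zero[OF t] by (simp_all add: s_def z_def)
    define d where "d j i = D (X t) (axis j 1) $ i" for j i
    define e where "e j = Q (X t) (axis j 1)" for j
    have Xv: "X t = s *\<^sub>R axis 1 1 + z *\<^sub>R axis 3 1" by (simp add: X_def vec3 s_def z_def)
    have H: "s * d 1 i + z * d 3 i = - \<alpha> * A i t" for i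
    proof -
      have "D (X t) (X t) $ i = s * d 1 i + z * d 3 i"
        by (subst (2) Xv) (simp add: linear_add[OF linD[OF X0]] linear.scaleR[OF linD[OF X0]] d_def)
      then show ?thesis using D_radial[OF X0, of t] by (simp add: A_def)
    qed
    have HP: "s * e 1 + z * e 3 = - (2 * \<alpha>) * P t"
    proof -
      have "Q (X t) (X t) = s * e 1 + z * e 3"
        by (subst (2) Xv) (simp add: linear_add[OF linQ[OF X0]] linear.scaleR[OF linQ[OF X0]] e_def)
      then show ?thesis using Q_radial[OF X0, of t] by (simp add: P_def)
    qed
    have T: "A' i t = z * d 1 i - s * d 3 i" "P' t = z * e 1 - s * e 3" for i
      by (simp_all add: A'_def P'_def d_def e_def s_def z_def)
    have R: "s * d 2 1 = - A 2 t" "s * d 2 2 = A 1 t" "s * d 2 3 = 0" "s * e 2 = 0"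
      using D_azimuthal[OF s, of z] by (simp_all add: d_def e_def A_def X_def s_def z_def)
    have E: "convection u (X t) + grad p (X t) = 0" "divergence u (X t) = 0"
      using euler X0 unfolding euler_classical_def by auto
    have conv: "A 1 t * d 1 i + A 2 t * d 2 i + A 3 t * d 3 i + e i = 0" for i
      using arg_cong[OF E(1), of "\<lambda>v. v $ i"]
      by (simp add: convection_def grad_def sum_3 part[OF X0] d_def e_def A_def)
    have div: "d 1 1 + d 2 2 + d 3 3 = 0"
      using E(2) by (simp add: divergence_def sum_3 part[OF X0] d_def)
    \<comment> \<open>The radial and the tangential derivative in the meridian plane are solved for
      the two Cartesian ones; the system is a rotation.\<close>
    have d1: "d 1 i = - \<alpha> * s * A i t + z * A' i t" and d3: "d 3 i = - \<alpha> * z * A i t - s * A' i t" for i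
      using H[of i] T(1)[of i] sz by algebra+
    have e1: "e 1 = - (2 * \<alpha>) * s * P t + z * P' t" and e3: "e 3 = - (2 * \<alpha>) * z * P t - s * P' t"
      using HP T(2) sz by algebra+
    have a: "a t = s * A 1 t + z * A 3 t" and b: "b t = z * A 1 t - s * A 3 t"
      and a': "a' t = z * A 1 t + s * A' 1 t - s * A 3 t + z * A' 3 t"
      and b': "b' t = - s * A 1 t + z * A' 1 t - z * A 3 t - s * A' 3 t"
      by (simp_all add: a_def b_def a'_def b'_def s_def z_def)
    have e2: "e 2 = 0" "d 2 3 = 0" using R(3,4) s by auto
    have radial: "b t * a' t = \<alpha> * (a t)\<^sup>2 + (b t)\<^sup>2 + (A 2 t)\<^sup>2 + 2 * \<alpha> * P t"
      using conv[of 1] conv[of 3] e2(2) R(1) sz unfolding a b a' d1 d3 e1 e3 by algebra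
    \<comment> \<open>The singular equations are proved after multiplication by \<open>s\<close>, so
      that they are polynomial identities modulo \<open>sz\<close> and can be divided
      afterwards.\<close>
    have polar: "s * P' t = s * (\<alpha> * a t * b t - b t * (b' t + a t)) + (A 2 t)\<^sup>2 * z"
      using conv[of 1] conv[of 3] e2(2) R(1) sz unfolding a b b' d1 d3 e1 e3 by algebra
    have azim: "s * (b t * A' 2 t) = s * ((\<alpha> - 1) * a t * A 2 t) - z * b t * A 2 t"
      using conv[of 2] e2(1) R(2) sz unfolding a b d1 d3 by algebra
    have mass: "s * b' t = s * ((\<alpha> - 2) * a t) - z * b t"
      using div R(2) sz unfolding a b b' d1 d3 by algebra
    have "P' t = \<alpha> * a t * b t - b t * (b' t + a t) + (A 2 t)\<^sup>2 * (z / s)"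
      using polar s by (simp add: field_simps)
    moreover have "b t * A' 2 t = (\<alpha> - 1) * a t * A 2 t - z / s * b t * A 2 t"
      using azim s by (simp add: field_simps)
    moreover have "b' t = (\<alpha> - 2) * a t - z / s * b t"
      using mass s by (simp add: field_simps)
    ultimately show ?thesis using radial unfolding s_def z_def by blast
  qed
  interpret meridian \<alpha> a b "A 2" P a' b' "A' 2" P'
  proof
    show "continuous_on {0..pi} a" "continuous_on {0..pi} b"
      unfolding a_def b_def by (intro continuous_intros contA)+
    show "(a has_real_derivative a' t) (at t)" "(b has_real_derivative b' t) (at t)" for t
      unfolding a_def b_def a'_def b'_def using dA by (auto intro!: derivative_eq_intros simp: algebra_simps)
    show "(P has_real_derivative P' t) (at t)" for t by (rule dP)
    show "b 0 = 0" "b pi = 0" using axis0[of 1] axispi[of 1] by (simp_all add: b_def)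
  qed (use \<alpha> contA contP contA' dA eqs axis0[of 2] axispi[of 2] in auto)
  have AX: "u (X t) = a t *\<^sub>R X t + b t *\<^sub>R vector [cos t, 0, - sin t] + vector [0, A 2 t, 0]" for t
  proof -
    have "sin t * (sin t * A 1 t + cos t * A 3 t) + cos t * (cos t * A 1 t - sin t * A 3 t) = A 1 t"
      "cos t * (sin t * A 1 t + cos t * A 3 t) - sin t * (cos t * A 1 t - sin t * A 3 t) = A 3 t"
      using sin_cos_squared_add[of t] by algebra+
    then show ?thesis unfolding vec_eq_iff forall_3 a_def b_def by (simp add: X_def A_def mult.commute)
  qed
  have full: "\<exists>t \<phi>. 0 < t \<and> t < pi \<and> x = vector [rad x * cos \<phi>, rad x * sin \<phi>, x $ 3] \<and>
      vector [rad x, 0, x $ 3] = norm x *\<^sub>R X t \<and>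
      u (vector [rad x, 0, x $ 3]) = norm x powr (- \<alpha>) *\<^sub>R u (X t)" if r: "rad x > 0" for x
  proof -
    have n2: "(norm x)\<^sup>2 = (rad x)\<^sup>2 + (x $ 3)\<^sup>2" and r2: "(rad x)\<^sup>2 = (x $ 1)\<^sup>2 + (x $ 2)\<^sup>2"
      unfolding power2_norm_eq_inner by (simp_all add: inner_vec_def sum_3 rad_def power2_eq_square)
    have n: "norm x > 0" using r n2 by (smt (verit) norm_eq_zero norm_ge_zero power2_less_eq_zero_iff zero_le_power2 zero_power2)
    have "(x $ 1 / rad x)\<^sup>2 + (x $ 2 / rad x)\<^sup>2 = 1"
    proof -
      have "((x $ 1)\<^sup>2 + (x $ 2)\<^sup>2) / (rad x)\<^sup>2 = 1" unfolding r2[symmetric] using r by simp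
      then show ?thesis by (simp add: power_divide add_divide_distrib)
    qed
    then obtain \<phi> where \<phi>: "x $ 1 / rad x = cos \<phi>" "x $ 2 / rad x = sin \<phi>" using sincos_total_2pi by metis
    have "(x $ 3 / norm x)\<^sup>2 + (rad x / norm x)\<^sup>2 = 1"
    proof -
      have "((rad x)\<^sup>2 + (x $ 3)\<^sup>2) / (norm x)\<^sup>2 = 1" unfolding n2[symmetric] using n by simp
      then show ?thesis by (simp add: power_divide add_divide_distrib add.commute)
    qed
    then obtain t where t: "0 \<le> t" "t \<le> pi" "x $ 3 / norm x = cos t" "rad x / norm x = sin t"
      using sincos_total_pi[of "rad x / norm x" "x $ 3 / norm x"] r n by auto
    have "sin t > 0" using t(4) r n by (metis divide_pos_pos)
    then have "t \<noteq> 0" "t \<noteq> pi" by auto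
    then have t': "0 < t" "t < pi" using t by auto
    have "norm x * sin t = rad x" "norm x * cos t = x $ 3"
      unfolding t(3,4)[symmetric] using n by simp_all
    then have y: "vector [rad x, 0, x $ 3] = norm x *\<^sub>R X t"
      by (simp add: X_def vec_eq_iff forall_3)
    have "rad x * cos \<phi> = x $ 1" "rad x * sin \<phi> = x $ 2"
      unfolding \<phi>[symmetric] using r by simp_all
    then have xv: "x = vector [rad x * cos \<phi>, rad x * sin \<phi>, x $ 3]"
      by (simp add: vec_eq_iff forall_3)
    have "u (vector [rad x, 0, x $ 3]) = norm x powr (- \<alpha>) *\<^sub>R u (X t)"
      unfolding y by (rule u_scale[OF X0 n])
    with t' y xv show ?thesis by blast
  qed
  \<comment> \<open>Scaling and rotation carry the meridian result to all points off the axis. Rest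
    is the constant flow with \<kappa> = 0, so two closed forms remain.\<close>
  have dich: "(\<exists>\<kappa>. \<forall>x. rad x > 0 \<longrightarrow> u x = \<kappa> *\<^sub>R e_z) \<or>
      (\<exists>\<kappa>. \<forall>x. rad x > 0 \<longrightarrow> u x = zonal (- 3) (\<lambda>_. \<kappa>) x *\<^sub>R x)"
  proof -
    have A2: "A 2 t = 0" if "0 < t" "t < pi" for t using classification that by blast
    from classification consider (const) \<kappa> where "\<alpha> = 0" "\<And>t. 0 < t \<Longrightarrow> t < pi \<Longrightarrow> a t = \<kappa> * cos t \<and> b t = - \<kappa> * sin t"
      | (source) \<kappa> where "\<alpha> = 2" "\<And>t. 0 < t \<Longrightarrow> t < pi \<Longrightarrow> a t = \<kappa> \<and> b t = 0"
      | (zero) "\<And>t. 0 < t \<Longrightarrow> t < pi \<Longrightarrow> a t = 0 \<and> b t = 0" by blast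
    then show ?thesis
    proof cases
      case const
      have "u x = \<kappa> *\<^sub>R e_z" if r: "rad x > 0" for x
      proof -
        obtain t \<phi> where t: "0 < t" "t < pi" and x: "x = vector [rad x * cos \<phi>, rad x * sin \<phi>, x $ 3]"
          and y: "u (vector [rad x, 0, x $ 3]) = norm x powr (- \<alpha>) *\<^sub>R u (X t)" using full[OF r] by blast
        have "\<kappa> * cos t * cos t + \<kappa> * sin t * sin t = \<kappa>" using sin_cos_squared_add[of t] by algebra
        then have "u (X t) = vector [0, 0, \<kappa>]"
          unfolding AX A2[OF t] using const(2)[OF t] by (simp add: vec_eq_iff forall_3 X_def)
        moreover have "norm x \<noteq> 0" using r by (auto simp: rad_def)
        ultimately have "u (vector [rad x, 0, x $ 3]) = vector [0, 0, \<kappa>]" using y const(1) by simp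
        then have "u (vector [rad x * cos \<phi>, rad x * sin \<phi>, x $ 3]) = \<kappa> *\<^sub>R e_z"
          unfolding u_rot[OF r] by (simp add: e_z_def vec_eq_iff forall_3)
        with x show ?thesis by simp
      qed
      then show ?thesis by blast
    next
      case source
      have "u x = zonal (- 3) (\<lambda>_. \<kappa>) x *\<^sub>R x" if r: "rad x > 0" for x
      proof -
        obtain t \<phi> where t: "0 < t" "t < pi" and x: "x = vector [rad x * cos \<phi>, rad x * sin \<phi>, x $ 3]"
          and v: "vector [rad x, 0, x $ 3] = norm x *\<^sub>R X t"
          and y: "u (vector [rad x, 0, x $ 3]) = norm x powr (- \<alpha>) *\<^sub>R u (X t)" using full[OF r] by blast
        have "norm x > 0" using r by (auto simp: rad_def)
        then have n: "norm x powr (- 2) = norm x powr (- 3) * norm x" using powr_add[of "norm x" "- 3" 1] by simp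
        have "u (X t) = \<kappa> *\<^sub>R X t"
          unfolding AX A2[OF t] using source(2)[OF t] by (simp add: vec_eq_iff forall_3)
        then have "u (vector [rad x, 0, x $ 3]) = (norm x powr (- 3) * \<kappa>) *\<^sub>R (norm x *\<^sub>R X t)"
          unfolding y source(1) n by (simp add: mult_ac)
        then have "u (vector [rad x, 0, x $ 3]) = (norm x powr (- 3) * \<kappa>) *\<^sub>R vector [rad x, 0, x $ 3]"
          unfolding v .
        then have "u (vector [rad x * cos \<phi>, rad x * sin \<phi>, x $ 3]) =
            (norm x powr (- 3) * \<kappa>) *\<^sub>R vector [rad x * cos \<phi>, rad x * sin \<phi>, x $ 3]"
          unfolding u_rot[OF r] by (simp add: vec_eq_iff forall_3)
        with x show ?thesis by (simp add: zonal_def)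
      qed
      then show ?thesis by blast
    next
      case zero
      have "u x = 0 *\<^sub>R e_z" if r: "rad x > 0" for x
      proof -
        obtain t \<phi> where t: "0 < t" "t < pi" and x: "x = vector [rad x * cos \<phi>, rad x * sin \<phi>, x $ 3]"
          and y: "u (vector [rad x, 0, x $ 3]) = norm x powr (- \<alpha>) *\<^sub>R u (X t)" using full[OF r] by blast
        have "u (X t) = 0"
          unfolding AX A2[OF t] using zero[OF t] by (simp add: vec_eq_iff forall_3)
        then have "u (vector [rad x * cos \<phi>, rad x * sin \<phi>, x $ 3]) = 0"
          unfolding u_rot[OF r] y by (simp add: vec_eq_iff forall_3)
        with x show ?thesis by simp
      qed
      then show ?thesis by blast
    qed
  qed
  have extend: "u x = w x" if w: "continuous_on (- {0}) w" "\<And>x. rad x > 0 \<Longrightarrow> u x = w x" and x: "x \<noteq> 0"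
    for w :: "real^3 \<Rightarrow> real^3" and x
  proof (cases "rad x > 0")
    case False
    then have x12: "x $ 1 = 0" "x $ 2 = 0" by (simp_all add: rad_def sum_power2_gt_zero_iff)
    then have x3: "x $ 3 \<noteq> 0" using x by (auto simp: vec_eq_iff forall_3)
    \<comment> \<open>The point on the axis is approached along a horizontal segment that leaves the
      axis at once and avoids the origin.\<close>
    let ?l = "\<lambda>t. x + t *\<^sub>R axis 1 1"
    have l0: "?l t \<noteq> 0" for t using x3 by (auto simp: vec_eq_iff forall_3 axis_def)
    have cu: "continuous_on (- {0}) u" by (rule C_k_on_imp_continuous_on[OF Cu])
    have cl: "continuous_on {0..1} ?l" by (intro continuous_intros)
    have "u (?l 0) $ i - w (?l 0) $ i = 0" for i
    proof (rule continuous_zero_at_left_end[of 0 1 "\<lambda>t. u (?l t) $ i - w (?l t) $ i"])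
      show "continuous_on {0..1} (\<lambda>t. u (?l t) $ i - w (?l t) $ i)"
        by (intro continuous_intros continuous_on_compose2[OF cu cl] continuous_on_compose2[OF w(1) cl])
          (use l0 in auto)
      fix t :: real assume "0 < t" "t < 1"
      then have "rad (?l t) > 0" using x12 by (simp add: rad_def axis_def)
      from w(2)[OF this] show "u (?l t) $ i - w (?l t) $ i = 0" by simp
    qed simp
    then show ?thesis by (simp add: vec_eq_iff)
  qed (use w in simp)
  have curl_cong: "curl u x = curl w x" if "\<And>x. x \<noteq> 0 \<Longrightarrow> u x = w x" "x \<noteq> 0" for w x
  proof -
    have "partial j (\<lambda>y. u y $ i) x = partial j (\<lambda>y. w y $ i) x" for i j
      unfolding partial_def
      using frechet_derivative_cong_open[of "- {0}" "\<lambda>y. u y $ i" "\<lambda>y. w y $ i" x] that by fastforce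
    then show ?thesis by (simp add: curl_def)
  qed
  have "curl u x = 0" if x: "x \<noteq> 0" for x
    using dich
  proof (elim disjE exE)
    fix \<kappa> assume *: "\<forall>x. rad x > 0 \<longrightarrow> u x = \<kappa> *\<^sub>R e_z"
    have eq: "u x = \<kappa> *\<^sub>R e_z" if "x \<noteq> 0" for x
      by (rule extend[OF _ _ that]) (use * in auto)
    have "partial j (\<lambda>y::real^3. k) x = 0" for j k
      using partialI[OF has_derivative_const] by simp
    then have "curl (\<lambda>x. \<kappa> *\<^sub>R e_z) x = 0" by (simp add: curl_def vec_eq_iff forall_3)
    moreover have "curl u x = curl (\<lambda>x. \<kappa> *\<^sub>R e_z) x" by (rule curl_cong[OF eq x])
    ultimately show ?thesis by simp
  next
    fix \<kappa> assume *: "\<forall>x. rad x > 0 \<longrightarrow> u x = zonal (- 3) (\<lambda>_. \<kappa>) x *\<^sub>R x"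
    have "C_k_on 0 (- {0}) (zonal (- 3) (\<lambda>_. \<kappa>))"
      by (rule C_k_on_zonal[of _ 2]) auto
    then have cont: "continuous_on (- {0}) (\<lambda>x. zonal (- 3) (\<lambda>_. \<kappa>) x *\<^sub>R x)"
      by (intro continuous_on_scaleR continuous_on_id) simp
    have eq: "u x = zonal (- 3) (\<lambda>_. \<kappa>) x *\<^sub>R x" if "x \<noteq> 0" for x
      by (rule extend[OF cont _ that]) (use * in blast)
    have dz: "(zonal (- 3) (\<lambda>_. \<kappa>) has_derivative (\<lambda>v. norm x powr (- 5) * (- 3 * \<kappa> * (x \<bullet> v)))) (at x)"
      using has_derivative_zonal[OF x, of "\<lambda>_. \<kappa>" 0 "- 3"] by simp
    have "((\<lambda>y. (zonal (- 3) (\<lambda>_. \<kappa>) y *\<^sub>R y) $ i) has_derivative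
        (\<lambda>v. zonal (- 3) (\<lambda>_. \<kappa>) x * v $ i + norm x powr (- 5) * (- 3 * \<kappa> * (x \<bullet> v)) * x $ i)) (at x)" for i
      using has_derivative_mult[OF dz bounded_linear_imp_has_derivative[OF bounded_linear_vec_nth]] by simp
    note part_w = partialI[OF this]
    have "curl (\<lambda>x. zonal (- 3) (\<lambda>_. \<kappa>) x *\<^sub>R x) x = 0"
      unfolding curl_def part_w by (simp add: axis_def inner_vec_def sum_3 vec_eq_iff forall_3)
    moreover have "curl u x = curl (\<lambda>x. zonal (- 3) (\<lambda>_. \<kappa>) x *\<^sub>R x) x"
      by (rule curl_cong[OF eq x])
    ultimately show ?thesis by simp
  qed
  then show ?thesis by (simp add: irrotational_classical_def)
qed

theorem theorem1p5:
  shows "(\<forall>\<alpha>::real. 1 \<le> \<alpha> \<and> \<alpha> \<le> 2 \<longrightarrow>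
            \<not> (\<exists>u p. rot_axi_hom_solution_punctured 1 \<alpha> u p))
       \<and> (\<forall>\<alpha>::real. 0 \<le> \<alpha> \<and> \<alpha> < 1 \<longrightarrow>
            \<not> (\<exists>u p. rot_axi_hom_solution_punctured 2 \<alpha> u p))
       \<and> (\<forall>\<alpha>::real. \<alpha> > 2 \<longrightarrow>
            (\<exists>u p. rot_axi_hom_solution_punctured 1 \<alpha> u p \<and>
               \<not> bernoulli u p constant_on (- {0}) \<and>
               C_k_on 2 (- {0}) (poloidal u) \<and> C_k_on 2 (- {0}) p \<and>
               C_k_on 1 (- {0}) (toroidal u)))
       \<and> (\<forall>\<alpha>::real. \<alpha> < -2 \<longrightarrow>
            (\<exists>u p. rot_axi_hom_solution_continuous \<alpha> u p \<and>
               \<not> bernoulli u p constant_on UNIV \<and>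
               C_k_on 1 {x. rad x \<noteq> 0} (poloidal u) \<and> continuous_on UNIV (poloidal u) \<and>
               C_k_on 1 {x. rad x \<noteq> 0} p \<and> continuous_on UNIV p \<and>
               continuous_on UNIV (toroidal u)))"
proof (intro conjI allI impI)
  have irr: "\<not> (\<exists>u p. rot_axi_hom_solution_punctured n \<alpha> u p)" if "0 \<le> \<alpha>" "\<alpha> \<le> 2" "n \<ge> 1" for n and \<alpha> :: real
    using axisymmetric_homogeneous_imp_irrotational[OF that(1,2)] C_k_on_mono[of n _ _ "Suc 0"] that(3)
    unfolding rot_axi_hom_solution_punctured_def by (metis One_nat_def)
  show "\<not> (\<exists>u p. rot_axi_hom_solution_punctured 1 \<alpha> u p)" if "1 \<le> \<alpha> \<and> \<alpha> \<le> 2" for \<alpha> :: real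
    using irr[of \<alpha> 1] that by simp
  show "\<not> (\<exists>u p. rot_axi_hom_solution_punctured 2 \<alpha> u p)" if "0 \<le> \<alpha> \<and> \<alpha> < 1" for \<alpha> :: real
    using irr[of \<alpha> 2] that by simp
qed (use ex_swirl_free_solution ex_shear_solution in blast)+

end
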